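(* Let $L$ be a restricted Lie algebra over a field of characteristic $p>0$ such that its restricted enveloping algebra $u(L)$ is semiperfect. Then $L$ is $p$-algebraic (that is, every element of $L$ is $p$-algebraic) and $L$ contains no infinite-dimensional torus.
   Context: For a ring $R$ with unity, $\mathcal{J}(R)$ denotes its Jacobson radical. $R$ is semiperfect if $R/\mathcal{J}(R)$ is Artinian and idempotents of $R/\mathcal{J}(R)$ can be lifted to $R$. For a restricted Lie algebra $L$ with $p$-map $x\mapsto x^{[p]}$, $u(L)$ denotes its restricted enveloping algebra. For $S\subseteq L$, $\langle S\rangle_p$ denotes the restricted subalgebra generated by $S$. An element $x\in L$ is $p$-algebraic if $\dim\langle x\rangle_p<\infty$. A torus of $L$ is an abelian restricted subalgebra $T$ all of whose elements are semisimple, i.e. $x\in\langle x^{[p]}\rangle_p$ for every $x\in T$. *)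

theory Defs
  imports
    "HOL-Algebra.QuotRing"
    "HOL-Algebra.Algebraic_Closure_Type"
    "HOL-Library.Poly_Mapping"
    "HOL-Computational_Algebra.Polynomial"
begin

section \<open>Semiperfect rings\<close>

definition left_ideal :: "('a, 'm) ring_scheme \<Rightarrow> 'a set \<Rightarrow> bool" where
  "left_ideal R I \<longleftrightarrow>
     additive_subgroup I R \<and> (\<forall>a\<in>I. \<forall>x\<in>carrier R. x \<otimes>\<^bsub>R\<^esub> a \<in> I)"

definition maximal_left_ideal :: "('a, 'm) ring_scheme \<Rightarrow> 'a set \<Rightarrow> bool" where
  "maximal_left_ideal R M \<longleftrightarrow>
     left_ideal R M \<and> M \<noteq> carrier R \<and>
     (\<forall>J. left_ideal R J \<and> M \<subseteq> J \<longrightarrow> J = M \<or> J = carrier R)"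

definition jacobson_radical :: "('a, 'm) ring_scheme \<Rightarrow> 'a set" where
  "jacobson_radical R = {x \<in> carrier R. \<forall>M. maximal_left_ideal R M \<longrightarrow> x \<in> M}"

definition left_artinian :: "('a, 'm) ring_scheme \<Rightarrow> bool" where
  "left_artinian R \<longleftrightarrow>
     (\<forall>I :: nat \<Rightarrow> 'a set.
        (\<forall>n. left_ideal R (I n)) \<and> (\<forall>n. I (Suc n) \<subseteq> I n) \<longrightarrow> (\<exists>N. \<forall>n\<ge>N. I n = I N))"

definition idempotents_lift :: "('a, 'm) ring_scheme \<Rightarrow> 'a set \<Rightarrow> bool" where
  "idempotents_lift R I \<longleftrightarrow>
     (\<forall>e\<in>carrier (R Quot I). e \<otimes>\<^bsub>R Quot I\<^esub> e = e \<longrightarrow>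
        (\<exists>f\<in>carrier R. f \<otimes>\<^bsub>R\<^esub> f = f \<and> I +>\<^bsub>R\<^esub> f = e))"

text \<open>
  The quotient by the Jacobson radical has zero Jacobson radical, so for it the left and the
  right Artinian condition are equivalent (both say that it is semisimple).
\<close>

definition semiperfect :: "('a, 'm) ring_scheme \<Rightarrow> bool" where
  "semiperfect R \<longleftrightarrow>
     left_artinian (R Quot jacobson_radical R) \<and> idempotents_lift R (jacobson_radical R)"


section \<open>Free associative algebras\<close>

text \<open>
  Words under concatenation, written additively because the convolution product on
  \<^type>\<open>poly_mapping\<close> is indexed by an additive monoid. Hence \<open>'a fword \<Rightarrow>\<^sub>0 'k\<close> is
  the free associative unital \<open>'k\<close>-algebra on the set of all elements of \<open>'a\<close>.
\<close>

datatype 'a fword = FWord (letters: "'a list")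

instantiation fword :: (type) monoid_add
begin

definition zero_fword :: "'a fword" where
  "0 = FWord []"

definition plus_fword :: "'a fword \<Rightarrow> 'a fword \<Rightarrow> 'a fword" where
  "u + v = FWord (letters u @ letters v)"

instance
  by standard (simp_all add: zero_fword_def plus_fword_def)

end

definition free_gen :: "'a \<Rightarrow> 'a fword \<Rightarrow>\<^sub>0 'k::field" where
  "free_gen x = Poly_Mapping.single (FWord [x]) 1"

definition free_const :: "'k::field \<Rightarrow> 'a fword \<Rightarrow>\<^sub>0 'k" where
  "free_const c = Poly_Mapping.single 0 c"


lemma (in ring_1) ring_of_type_algebra_is_ring: "ring (ring_of_type_algebra :: 'a ring)"
proof -
  have "\<exists>y. x + y = 0" for x :: 'a
    using add.right_inverse by blast
  then show ?thesis
    unfolding ring_of_type_algebra_def using add.right_inverse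
    by unfold_locales (auto simp: algebra_simps Units_def)
qed


section \<open>Restricted Lie algebras\<close>

locale lie_algebra = vector_space scale
  for scale :: "'k::field \<Rightarrow> 'a::ab_group_add \<Rightarrow> 'a" (infixr \<open>*s\<close> 75) +
  fixes bracket :: "'a \<Rightarrow> 'a \<Rightarrow> 'a"
  assumes bracket_add_left: "bracket (x + y) z = bracket x z + bracket y z"
    and bracket_add_right: "bracket x (y + z) = bracket x y + bracket x z"
    and bracket_scale_left: "bracket (c *s x) y = c *s bracket x y"
    and bracket_scale_right: "bracket x (c *s y) = c *s bracket x y"
    and bracket_self: "bracket x x = 0"
    and jacobi: "bracket x (bracket y z) + bracket y (bracket z x) + bracket z (bracket x y) = 0"
begin

text \<open>
  An element of \<open>'a poly\<close> stands for a polynomial in an indeterminate \<open>t\<close> with coefficients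
  in the Lie algebra \<open>L\<close>, i.e. for an element of \<open>L \<otimes> 'k[t]\<close>; \<open>ad_poly x y\<close> is
  \<open>ad (t x + y)\<close> there. As in Jacobson's formula for \<open>(x + y)\<^sup>p\<close>, \<open>i s\<^sub>i(x, y)\<close> is the
  coefficient of \<open>t\<^sup>i\<^sup>-\<^sup>1\<close> in \<open>(ad (t x + y))\<^sup>p\<^sup>-\<^sup>1 (x)\<close>.
\<close>

definition ad_poly :: "'a \<Rightarrow> 'a \<Rightarrow> 'a poly \<Rightarrow> 'a poly" where
  "ad_poly x y f = pCons 0 (map_poly (bracket x) f) + map_poly (bracket y) f"

definition jacobson_s :: "nat \<Rightarrow> 'a \<Rightarrow> 'a \<Rightarrow> 'a" where
  "jacobson_s i x y =
     inverse (of_nat i) *s coeff ((ad_poly x y ^^ (CHAR('k) - 1)) [:x:]) (i - 1)"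

end

locale restricted_lie_algebra = lie_algebra scale bracket
  for scale :: "'k::field \<Rightarrow> 'a::ab_group_add \<Rightarrow> 'a" (infixr \<open>*s\<close> 75) and bracket +
  fixes pmap :: "'a \<Rightarrow> 'a"
  assumes char_pos: "CHAR('k) > 0"
    and bracket_pmap: "bracket (pmap x) y = (bracket x ^^ CHAR('k)) y"
    and pmap_scale: "pmap (c *s x) = c ^ CHAR('k) *s pmap x"
    and pmap_add: "pmap (x + y) = pmap x + pmap y + (\<Sum>i = 1..CHAR('k) - 1. jacobson_s i x y)"
begin

definition restricted_subalgebra :: "'a set \<Rightarrow> bool" where
  "restricted_subalgebra S \<longleftrightarrow>
     subspace S \<and> (\<forall>x\<in>S. \<forall>y\<in>S. bracket x y \<in> S) \<and> (\<forall>x\<in>S. pmap x \<in> S)"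

definition generated_restricted_subalgebra :: "'a set \<Rightarrow> 'a set" (\<open>\<langle>_\<rangle>\<^sub>p\<close>) where
  "\<langle>S\<rangle>\<^sub>p = restricted_subalgebra hull S"

text \<open>The library's \<open>dim\<close> is \<open>0\<close> on infinite-dimensional subspaces, so it is of no use here.\<close>

definition finite_dimensional :: "'a set \<Rightarrow> bool" where
  "finite_dimensional V \<longleftrightarrow> (\<exists>B. finite B \<and> span B = V)"

definition p_algebraic :: "'a \<Rightarrow> bool" where
  "p_algebraic x \<longleftrightarrow> finite_dimensional \<langle>{x}\<rangle>\<^sub>p"

definition semisimple :: "'a \<Rightarrow> bool" where
  "semisimple x \<longleftrightarrow> x \<in> \<langle>{pmap x}\<rangle>\<^sub>p"

definition torus :: "'a set \<Rightarrow> bool" where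
  "torus T \<longleftrightarrow>
     restricted_subalgebra T \<and> (\<forall>x\<in>T. \<forall>y\<in>T. bracket x y = 0) \<and> (\<forall>x\<in>T. semisimple x)"

text \<open>
  The first two sets of relations turn the free algebra on the set \<open>L\<close> into the tensor
  algebra of the vector space \<open>L\<close>; the third one yields the universal enveloping algebra and
  the last one the restricted enveloping algebra.
\<close>

definition enveloping_relations :: "('a fword \<Rightarrow>\<^sub>0 'k) set" where
  "enveloping_relations =
     {free_gen (x + y) - free_gen x - free_gen y | x y. True} \<union>
     {free_gen (c *s x) - free_const c * free_gen x | c x. True} \<union>
     {free_gen x * free_gen y - free_gen y * free_gen x - free_gen (bracket x y) | x y. True} \<union>
     {free_gen x ^ CHAR('k) - free_gen (pmap x) | x. True}"

definition restricted_enveloping_algebra :: "('a fword \<Rightarrow>\<^sub>0 'k) set ring" where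
  "restricted_enveloping_algebra =
     ring_of_type_algebra Quot genideal ring_of_type_algebra enveloping_relations"

lemma ring_restricted_enveloping_algebra: "ring restricted_enveloping_algebra"
proof -
  interpret R: ring "ring_of_type_algebra :: ('a fword \<Rightarrow>\<^sub>0 'k) ring"
    by (rule ring_of_type_algebra_is_ring)
  have "ideal (genideal ring_of_type_algebra enveloping_relations)
          (ring_of_type_algebra :: ('a fword \<Rightarrow>\<^sub>0 'k) ring)"
    by (rule R.genideal_ideal) (simp add: ring_of_type_algebra_def)
  then show ?thesis
    unfolding restricted_enveloping_algebra_def by (rule ideal.quotient_is_ring)
qed

end

end

theory Submission
  imports Defs "HOL-Computational_Algebra.Formal_Power_Series"
begin

text \<open>
  Let \<open>J\<close> be the Jacobson radical of \<open>u(L)\<close>.  In both parts the failure of the conclusion produces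
  a descending chain of left ideals that cannot become stationary in \<open>u(L)/J\<close>.

  Suppose that \<open>x\<close> is not \<open>p\<close>-algebraic.  Then the elements \<open>x\<close>, \<open>x\<^bsup>[p]\<^esup>\<close>, \<open>x\<^bsup>[p][p]\<^esup>\<close>, \<dots> are
  linearly independent, the subalgebra of \<open>u(L)\<close> generated by \<open>x\<close> is a polynomial ring, and \<open>u(L)\<close> is
  free over it.  Put \<open>g\<^sub>0 = x\<close> and \<open>g\<^sub>n\<^sub>+\<^sub>1 = (1 + g\<^sub>n) g\<^sub>n\<close>.  If the left ideals generated by the
  \<open>g\<^sub>n\<close> become stationary modulo \<open>J\<close>, then \<open>g\<^sub>n - r (1 + g\<^sub>n) g\<^sub>n \<in> J\<close>, hence
  \<open>(1 - r g\<^sub>n) (1 + g\<^sub>n) \<in> 1 + J\<close>, and \<open>1 + g\<^sub>n\<close> is left invertible in \<open>u(L)\<close>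
  (\<open>coprime_chain_left_invertible\<close>).  A nonconstant polynomial in \<open>x\<close> is not left invertible.

  Suppose that \<open>T\<close> is an infinite-dimensional torus.  A semisimple \<open>x\<close> is a combination of the
  powers \<open>x\<^bsup>p^i\<^esup>\<close> with \<open>i \<ge> 1\<close> and thus gives an idempotent \<open>f = a x\<close> with \<open>f x = x\<close>.  Joining the
  idempotents of suitable elements of \<open>T\<close> gives a sequence of idempotents \<open>e\<^sub>n\<close>, where \<open>e\<^sub>n\<close> lies in
  the left ideal generated by a finite-dimensional restricted subalgebra \<open>H\<^sub>n\<close> of \<open>T\<close>, and \<open>e\<^sub>n\<^sub>+\<^sub>1\<close>
  acts as the identity on an element of \<open>T\<close> outside \<open>H\<^sub>n\<close>.  The subalgebras \<open>H\<^sub>n\<close> stay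
  finite-dimensional, hence different from \<open>T\<close>, by the first part.  The left ideals generated by the
  \<open>1 - e\<^sub>n\<close> descend, and if they become stationary modulo \<open>J\<close> then some \<open>e\<^sub>n\<^sub>+\<^sub>1 - e\<^sub>n\<close> is an idempotent
  in \<open>J\<close>, that is, zero (\<open>increasing_idempotents_stationary\<close>).  This places an element outside \<open>H\<^sub>n\<close>
  in \<open>u(L) H\<^sub>n\<close>, which is impossible (\<open>gen_not_in_left_ideal\<close>).

  The two facts about \<open>u(L)\<close> that enter here belong to the Poincare-Birkhoff-Witt theorem for
  restricted Lie algebras.  They are instances of one statement,
  \<open>exists_equivariant_functional\<close>: for a restricted subalgebra \<open>H\<close> and a character
  \<open>\<chi> : H \<rightarrow> k[t]\<close> there is a functional \<open>T\<close> on \<open>u(L)\<close> with values in \<open>k[t]\<close> such that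
  \<open>T(a h) = \<chi>(h) T(a)\<close> for \<open>h \<in> H\<close>, and \<open>T\<close> can be chosen to be \<open>1\<close> at \<open>1\<close>, or at a given element
  outside \<open>H\<close>.  For \<open>\<chi> = 0\<close> it shows that such an element is not in \<open>u(L) H\<close>.  For the span of the
  iterated \<open>p\<close>-th powers of \<open>x\<close> and \<open>\<chi>(x) = t\<close> it turns a left inverse of \<open>g(x)\<close> into an inverse of the polynomial \<open>g(t)\<close>.

  The functional is constructed with Bergman's diamond lemma (\<open>diamond\<close>): a function on the words
  that admit no rewriting step extends to all words, compatibly with the rewriting rules, if any two
  steps that start at the same word can be reconciled below it.  Words are taken in all elements of \<open>L\<close>.
  Given an ordered basis, the rules are \<open>y x \<rightarrow> x y + [y, x]\<close> for basis elements \<open>x < y\<close>,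
  \<open>b\<^bsup>p\<^esup> \<rightarrow> b\<^bsup>[p]\<^esup>\<close> for a basis element \<open>b\<close>, and the expansion of all other letters in the basis.  The
  overlap \<open>z y x\<close> is resolved by the Jacobi identity, and the overlaps \<open>y x\<^bsup>p\<^esup>\<close> and \<open>y\<^bsup>p\<^esup> x\<close> by
  \<open>ad(x\<^bsup>[p]\<^esup>) = ad(x)\<^bsup>p\<^esup>\<close>.  The relation \<open>x\<^bsup>p\<^esup> = x\<^bsup>[p]\<^esup>\<close> passes from basis elements to all of \<open>L\<close> by
  Jacobson's formula for \<open>(x + y)\<^bsup>p\<^esup>\<close>.
\<close>

section \<open>Left ideals and the Jacobson radical\<close>

context ring
begin

lemma left_ideal_memberD:
  assumes "left_ideal R I"
  shows "I \<subseteq> carrier R" "\<zero> \<in> I"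
    "\<And>a b. a \<in> I \<Longrightarrow> b \<in> I \<Longrightarrow> a \<oplus> b \<in> I"
    "\<And>a. a \<in> I \<Longrightarrow> \<ominus> a \<in> I"
    "\<And>a x. a \<in> I \<Longrightarrow> x \<in> carrier R \<Longrightarrow> x \<otimes> a \<in> I"
proof -
  interpret additive_subgroup I R
    using assms by (simp add: left_ideal_def)
  show "I \<subseteq> carrier R" "\<zero> \<in> I" "\<And>a b. a \<in> I \<Longrightarrow> b \<in> I \<Longrightarrow> a \<oplus> b \<in> I"
    "\<And>a. a \<in> I \<Longrightarrow> \<ominus> a \<in> I"
    using a_subset a_inv_closed by auto
  show "\<And>a x. a \<in> I \<Longrightarrow> x \<in> carrier R \<Longrightarrow> x \<otimes> a \<in> I"
    using assms by (simp add: left_ideal_def)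
qed

lemma left_idealI:
  assumes "I \<subseteq> carrier R" "\<zero> \<in> I"
    "\<And>a b. a \<in> I \<Longrightarrow> b \<in> I \<Longrightarrow> a \<oplus> b \<in> I"
    "\<And>a x. a \<in> I \<Longrightarrow> x \<in> carrier R \<Longrightarrow> x \<otimes> a \<in> I"
  shows "left_ideal R I"
proof -
  have "\<ominus> a \<in> I" if "a \<in> I" for a
  proof -
    have "\<ominus> a = (\<ominus> \<one>) \<otimes> a"
      using that assms(1) by (auto simp: l_minus)
    then show ?thesis
      using assms(4)[OF that, of "\<ominus> \<one>"] by simp
  qed
  then have "additive_subgroup I R"
    using assms unfolding additive_subgroup_def
    by (intro add.subgroupI) (auto simp: a_inv_def)
  then show ?thesis
    using assms(4) by (simp add: left_ideal_def)
qed

lemma left_ideal_with_one: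
  assumes "left_ideal R I" "\<one> \<in> I"
  shows "I = carrier R"
proof
  show "I \<subseteq> carrier R"
    using left_ideal_memberD(1)[OF assms(1)] .
  show "carrier R \<subseteq> I"
  proof
    fix x assume "x \<in> carrier R"
    then show "x \<in> I"
      using left_ideal_memberD(5)[OF assms(1) assms(2), of x] by simp
  qed
qed

lemma left_ideal_add_principal:
  assumes "left_ideal R I" "a \<in> carrier R"
  shows "left_ideal R {m \<oplus> r \<otimes> a | m r. m \<in> I \<and> r \<in> carrier R}" (is "left_ideal R ?S")
proof (rule left_idealI)
  note I = left_ideal_memberD[OF assms(1)]
  have Ic: "m \<in> carrier R" if "m \<in> I" for m
    using I(1) that by auto
  show "?S \<subseteq> carrier R"
    using Ic assms(2) by auto
  have "\<zero> = \<zero> \<oplus> \<zero> \<otimes> a"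
    using assms(2) by simp
  then show "\<zero> \<in> ?S"
    using I(2) by blast
  show "x \<oplus> y \<in> ?S" if xy: "x \<in> ?S" "y \<in> ?S" for x y
  proof -
    obtain m r where x: "x = m \<oplus> r \<otimes> a" "m \<in> I" "r \<in> carrier R"
      using xy(1) by blast
    obtain n s where y: "y = n \<oplus> s \<otimes> a" "n \<in> I" "s \<in> carrier R"
      using xy(2) by blast
    have "x \<oplus> y = (m \<oplus> n) \<oplus> (r \<oplus> s) \<otimes> a"
      using x y assms(2) Ic[OF x(2)] Ic[OF y(2)] by (simp add: l_distr a_ac)
    then show ?thesis
      using x y I(3) by (blast intro: a_closed)
  qed
  show "t \<otimes> x \<in> ?S" if xt: "x \<in> ?S" and t: "t \<in> carrier R" for x t
  proof -
    obtain m r where x: "x = m \<oplus> r \<otimes> a" "m \<in> I" "r \<in> carrier R"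
      using xt by blast
    have "t \<otimes> x = t \<otimes> m \<oplus> (t \<otimes> r) \<otimes> a"
      using x t assms(2) Ic[OF x(2)] by (simp add: r_distr m_assoc)
    then show ?thesis
      using x t I(5) by (blast intro: m_closed)
  qed
qed

lemma left_ideal_zero: "left_ideal R {\<zero>}"
  by (rule left_idealI) auto

lemma left_ideal_principal:
  assumes "a \<in> carrier R"
  shows "left_ideal R {r \<otimes> a | r. r \<in> carrier R}"
proof -
  have "\<zero> \<oplus> r \<otimes> a = r \<otimes> a" if "r \<in> carrier R" for r
    using assms that by simp
  then have "{r \<otimes> a | r. r \<in> carrier R} = {m \<oplus> r \<otimes> a | m r. m \<in> {\<zero>} \<and> r \<in> carrier R}"
    by (auto, metis)
  then show ?thesis
    using left_ideal_add_principal[OF left_ideal_zero assms] by simp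
qed

text \<open>
  Zorn's lemma applies to the left ideals that avoid \<open>1\<close>, because a union of a chain avoids \<open>1\<close> too.
\<close>
lemma proper_left_ideal_le_maximal:
  assumes "left_ideal R I" "I \<noteq> carrier R"
  obtains M where "maximal_left_ideal R M" "I \<subseteq> M"
proof -
  define A where "A = {J. left_ideal R J \<and> I \<subseteq> J \<and> \<one> \<notin> J}"
  have "\<exists>M\<in>A. \<forall>Y\<in>A. M \<subseteq> Y \<longrightarrow> Y = M"
  proof (rule subset_Zorn_nonempty)
    have "\<one> \<notin> I"
      using left_ideal_with_one assms by blast
    then show "A \<noteq> {}"
      using assms A_def by blast
    fix \<C> assume ne: "\<C> \<noteq> {}" and ch: "subset.chain A \<C>"
    have mem: "left_ideal R J" "I \<subseteq> J" "\<one> \<notin> J" if "J \<in> \<C>" for J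
      using ch that by (auto simp: subset.chain_def A_def)
    have "left_ideal R (\<Union>\<C>)"
    proof (rule left_idealI)
      show "\<Union>\<C> \<subseteq> carrier R"
        using mem(1) left_ideal_memberD(1) by blast
      show "\<zero> \<in> \<Union>\<C>"
        using ne mem(1) left_ideal_memberD(2) by blast
      show "t \<otimes> x \<in> \<Union>\<C>" if "x \<in> \<Union>\<C>" "t \<in> carrier R" for x t
        using that mem(1) left_ideal_memberD(5) by blast
      show "x \<oplus> y \<in> \<Union>\<C>" if xy: "x \<in> \<Union>\<C>" "y \<in> \<Union>\<C>" for x y
      proof -
        obtain J K where JK: "J \<in> \<C>" "x \<in> J" "K \<in> \<C>" "y \<in> K"
          using xy by blast
        then have "J \<subseteq> K \<or> K \<subseteq> J"
          using ch unfolding subset.chain_def by blast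
        then obtain N where "N \<in> \<C>" "x \<in> N" "y \<in> N"
          using JK by blast
        then show ?thesis
          using mem(1) left_ideal_memberD(3) by blast
      qed
    qed
    then show "\<Union>\<C> \<in> A"
      using mem ne unfolding A_def by blast
  qed
  then obtain M where M: "M \<in> A" "\<And>Y. Y \<in> A \<Longrightarrow> M \<subseteq> Y \<Longrightarrow> Y = M"
    by blast
  have "maximal_left_ideal R M"
    unfolding maximal_left_ideal_def
  proof (intro conjI allI impI)
    show "left_ideal R M" "M \<noteq> carrier R"
      using M(1) by (auto simp: A_def)
    fix J assume J: "left_ideal R J \<and> M \<subseteq> J"
    show "J = M \<or> J = carrier R"
    proof (cases "\<one> \<in> J")
      case True
      then show ?thesis
        using J left_ideal_with_one by blast
    next
      case False
      then have "J \<in> A"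
        using J M(1) by (auto simp: A_def)
      then show ?thesis
        using M(2) J by blast
    qed
  qed
  then show thesis
    using that M(1) by (auto simp: A_def)
qed

lemma left_invertible_of_not_in_maximal:
  assumes "a \<in> carrier R" "\<And>M. maximal_left_ideal R M \<Longrightarrow> a \<notin> M"
  shows "\<exists>s\<in>carrier R. s \<otimes> a = \<one>"
proof -
  let ?S = "{r \<otimes> a | r. r \<in> carrier R}"
  have aS: "a \<in> ?S"
  proof -
    have "a = \<one> \<otimes> a"
      using assms(1) by simp
    then show ?thesis
      by blast
  qed
  have "?S = carrier R"
  proof (rule ccontr)
    assume "?S \<noteq> carrier R"
    then obtain M where "maximal_left_ideal R M" "?S \<subseteq> M"
      using proper_left_ideal_le_maximal[OF left_ideal_principal[OF assms(1)]] by blast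
    then show False
      using assms(2) aS by blast
  qed
  then have "\<one> \<in> ?S"
    by simp
  then show ?thesis
    by auto
qed

text \<open>
  A maximal left ideal contains \<open>j\<close>, so if it contained \<open>1 + j\<close> it would contain \<open>1\<close>.
\<close>
lemma one_plus_jacobson_left_invertible:
  assumes "j \<in> jacobson_radical R"
  shows "\<exists>s\<in>carrier R. s \<otimes> (\<one> \<oplus> j) = \<one>"
proof (rule left_invertible_of_not_in_maximal)
  have j: "j \<in> carrier R" "\<And>M. maximal_left_ideal R M \<Longrightarrow> j \<in> M"
    using assms by (auto simp: jacobson_radical_def)
  show "\<one> \<oplus> j \<in> carrier R"
    using j by simp
  fix M assume M: "maximal_left_ideal R M"
  then have li: "left_ideal R M" and ne: "M \<noteq> carrier R"
    by (auto simp: maximal_left_ideal_def)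
  show "\<one> \<oplus> j \<notin> M"
  proof
    assume "\<one> \<oplus> j \<in> M"
    then have "(\<one> \<oplus> j) \<oplus> \<ominus> j \<in> M"
      using left_ideal_memberD(3,4)[OF li] j(2)[OF M] by blast
    then have "\<one> \<in> M"
      using j(1) by (simp add: a_assoc r_neg)
    then show False
      using left_ideal_with_one[OF li] ne by blast
  qed
qed

text \<open>
  For \<open>x \<notin> M\<close> the map \<open>r \<mapsto> r x\<close> induces an isomorphism of \<open>R / {r. r x \<in> M}\<close> with the simple
  module \<open>R / M\<close>.  This is what makes the intersection of the maximal \<^emph>\<open>left\<close> ideals a two-sided
  ideal.
\<close>
lemma maximal_left_ideal_transport:
  assumes M: "maximal_left_ideal R M" and x: "x \<in> carrier R" "x \<notin> M"
  shows "maximal_left_ideal R {r \<in> carrier R. r \<otimes> x \<in> M}" (is "maximal_left_ideal R ?N")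
proof -
  have li: "left_ideal R M" and mx: "\<And>J. left_ideal R J \<Longrightarrow> M \<subseteq> J \<Longrightarrow> J = M \<or> J = carrier R"
    using M by (auto simp: maximal_left_ideal_def)
  note MD = left_ideal_memberD[OF li]
  have Nli: "left_ideal R ?N"
    by (rule left_idealI) (use x MD in \<open>auto simp: l_distr m_assoc\<close>)
  moreover have "\<one> \<notin> ?N"
    using x by simp
  moreover have "J = ?N \<or> J = carrier R" if J: "left_ideal R J" "?N \<subseteq> J" for J
  proof (cases "J \<subseteq> ?N")
    case True
    then show ?thesis
      using J(2) by blast
  next
    case False
    then obtain s where s: "s \<in> J" "s \<notin> ?N"
      by blast
    have sc: "s \<in> carrier R"
      using s(1) left_ideal_memberD(1)[OF J(1)] by blast
    then have sx: "s \<otimes> x \<notin> M" "s \<otimes> x \<in> carrier R"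
      using s(2) x by auto
    let ?S = "{m \<oplus> r \<otimes> (s \<otimes> x) | m r. m \<in> M \<and> r \<in> carrier R}"
    have MS: "M \<subseteq> ?S"
    proof
      fix m assume m: "m \<in> M"
      then have "m = m \<oplus> \<zero> \<otimes> (s \<otimes> x)"
        using MD(1) sx by auto
      then show "m \<in> ?S"
        using m by blast
    qed
    have "s \<otimes> x = \<zero> \<oplus> \<one> \<otimes> (s \<otimes> x)"
      using sx by simp
    then have "s \<otimes> x \<in> ?S"
      using MD(2) by blast
    then have "?S = carrier R"
      using mx[OF left_ideal_add_principal[OF li sx(2)] MS] sx(1) by blast
    then have "x \<in> ?S"
      using x by simp
    then obtain m r where mr: "x = m \<oplus> r \<otimes> (s \<otimes> x)" "m \<in> M" "r \<in> carrier R"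
      by blast
    have mc: "m \<in> carrier R"
      using mr(2) MD(1) by blast
    have "(\<one> \<oplus> \<ominus> (r \<otimes> s)) \<otimes> x = x \<oplus> \<ominus> (r \<otimes> (s \<otimes> x))"
      using x sc mr(3) by (simp add: l_distr l_minus m_assoc)
    also have "\<dots> = m"
    proof -
      have "x \<oplus> \<ominus> (r \<otimes> (s \<otimes> x)) = (m \<oplus> r \<otimes> (s \<otimes> x)) \<oplus> \<ominus> (r \<otimes> (s \<otimes> x))"
        using mr(1) by simp
      also have "\<dots> = m"
        using mc sc x mr(3) by (simp add: a_assoc r_neg)
      finally show ?thesis .
    qed
    finally have "\<one> \<oplus> \<ominus> (r \<otimes> s) \<in> ?N"
      using mr(2,3) sc by simp
    then have "\<one> \<oplus> \<ominus> (r \<otimes> s) \<in> J"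
      using J(2) by blast
    moreover have "r \<otimes> s \<in> J"
      using left_ideal_memberD(5)[OF J(1) s(1) mr(3)] .
    ultimately have "(\<one> \<oplus> \<ominus> (r \<otimes> s)) \<oplus> r \<otimes> s \<in> J"
      using left_ideal_memberD(3)[OF J(1)] by blast
    then have "\<one> \<in> J"
      using mr(3) sc by (simp add: a_assoc l_neg)
    then show ?thesis
      using left_ideal_with_one[OF J(1)] by blast
  qed
  ultimately show ?thesis
    unfolding maximal_left_ideal_def by blast
qed

lemma jacobson_radical_ideal: "ideal (jacobson_radical R) R"
proof -
  let ?J = "jacobson_radical R"
  have mli: "left_ideal R M" if "maximal_left_ideal R M" for M
    using that by (simp add: maximal_left_ideal_def)
  have li: "left_ideal R ?J"
    by (rule left_idealI)
      (auto simp: jacobson_radical_def intro: left_ideal_memberD(2)[OF mli]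
        left_ideal_memberD(3)[OF mli] left_ideal_memberD(5)[OF mli])
  have right: "j \<otimes> x \<in> ?J" if "j \<in> ?J" "x \<in> carrier R" for j x
  proof -
    have j: "j \<in> carrier R" "\<And>M. maximal_left_ideal R M \<Longrightarrow> j \<in> M"
      using that by (auto simp: jacobson_radical_def)
    have "j \<otimes> x \<in> M" if M: "maximal_left_ideal R M" for M
    proof (cases "x \<in> M")
      case True
      then show ?thesis
        using left_ideal_memberD(5)[OF mli[OF M]] j by blast
    next
      case False
      then show ?thesis
        using j(2)[OF maximal_left_ideal_transport[OF M \<open>x \<in> carrier R\<close> False]] by blast
    qed
    then show ?thesis
      using that j by (auto simp: jacobson_radical_def)
  qed
  show ?thesis
    using li right by (intro idealI) (auto simp: left_ideal_def additive_subgroup_def ring_axioms)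
qed

text \<open>
  The left ideals generated by the classes of the \<open>a n\<close> form a descending chain, and where it is
  stationary the class of \<open>a n\<close> lies in the left ideal generated by the next one.
\<close>
lemma left_artinian_quotient_chain:
  assumes I: "ideal I R" and art: "left_artinian (R Quot I)"
    and a: "\<And>n::nat. a n \<in> carrier R"
    and step: "\<And>n. \<exists>s\<in>carrier R. a (Suc n) = s \<otimes> a n"
  shows "\<exists>n. \<exists>r\<in>carrier R. a n \<ominus> r \<otimes> a (Suc n) \<in> I"
proof -
  interpret I: ideal I R by (rule I)
  let ?Q = "R Quot I"
  interpret Q: ring ?Q by (rule I.quotient_is_ring)
  have hom: "(+>) I \<in> ring_hom R ?Q"
    by (rule I.rcos_ring_hom)
  have carQ: "A \<in> carrier ?Q \<longleftrightarrow> (\<exists>x\<in>carrier R. A = I +> x)" for A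
    by (auto simp: FactRing_simps)
  let ?L = "\<lambda>n. {A \<otimes>\<^bsub>?Q\<^esub> (I +> a n) | A. A \<in> carrier ?Q}"
  have "\<forall>n. left_ideal ?Q (?L n)"
    using Q.left_ideal_principal carQ a by blast
  moreover have "\<forall>n. ?L (Suc n) \<subseteq> ?L n"
  proof (intro allI subsetI)
    fix n T assume "T \<in> ?L (Suc n)"
    then obtain A where A: "A \<in> carrier ?Q" "T = A \<otimes>\<^bsub>?Q\<^esub> (I +> a (Suc n))"
      by blast
    obtain s where s: "s \<in> carrier R" "a (Suc n) = s \<otimes> a n"
      using step by blast
    have "T = (A \<otimes>\<^bsub>?Q\<^esub> (I +> s)) \<otimes>\<^bsub>?Q\<^esub> (I +> a n)"
      using A s a carQ ring_hom_mult[OF hom, of s "a n"] by (metis Q.m_assoc)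
    moreover have "A \<otimes>\<^bsub>?Q\<^esub> (I +> s) \<in> carrier ?Q"
      using A s carQ by blast
    ultimately show "T \<in> ?L n"
      by blast
  qed
  ultimately have "\<exists>N. \<forall>n\<ge>N. ?L n = ?L N"
    using art unfolding left_artinian_def by (elim allE[of _ ?L]) simp
  then obtain N where N: "\<forall>n\<ge>N. ?L n = ?L N" ..
  have "?L (Suc N) = ?L N"
    using N[rule_format, of "Suc N"] by simp
  moreover have "I +> a N \<in> ?L N"
  proof -
    have "I +> a N = \<one>\<^bsub>?Q\<^esub> \<otimes>\<^bsub>?Q\<^esub> (I +> a N)"
      using carQ a by (intro Q.l_one[symmetric]) blast
    then show ?thesis
      by blast
  qed
  ultimately have "I +> a N \<in> ?L (Suc N)"
    by (simp only:)
  then obtain A where A: "A \<in> carrier ?Q" "I +> a N = A \<otimes>\<^bsub>?Q\<^esub> (I +> a (Suc N))"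
    by auto
  obtain r where r: "r \<in> carrier R" "A = I +> r"
    using A carQ by blast
  have "I +> a N = I +> (r \<otimes> a (Suc N))"
    using A r a ring_hom_mult[OF hom] by simp
  then have "a N \<ominus> r \<otimes> a (Suc N) \<in> I"
    using quotient_eq_iff_same_a_r_cos[OF I] a r by simp
  then show ?thesis
    using r by blast
qed

end

section \<open>Commutators in characteristic p\<close>

definition commutator :: "'r::ring_1 \<Rightarrow> 'r \<Rightarrow> 'r" where
  "commutator x y = x * y - y * x"

lemma commutator_power_telescope:
  fixes x z :: "'r::ring_1"
  shows "x ^ n * z - z * x ^ n = (\<Sum>i<n. x ^ i * commutator x z * x ^ (n - Suc i))"
proof (induction n)
  case 0
  then show ?case by simp
next
  case (Suc n)
  have "(\<Sum>i<Suc n. x ^ i * commutator x z * x ^ (Suc n - Suc i))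
      = (\<Sum>i<n. x ^ i * commutator x z * x ^ (n - Suc i) * x) + x ^ n * commutator x z"
    by (auto simp: mult.assoc Suc_diff_Suc simp flip: power_Suc2 intro!: sum.cong)
  also have "\<dots> = (x ^ n * z - z * x ^ n) * x + x ^ n * commutator x z"
    unfolding Suc.IH by (simp add: sum_distrib_right)
  also have "\<dots> = x ^ Suc n * z - z * x ^ Suc n"
  proof -
    have "x ^ n * (x * z) = x * (x ^ n * z)"
      by (simp add: power_commutes flip: mult.assoc)
    then show ?thesis
      by (simp add: commutator_def algebra_simps power_commutes)
  qed
  finally show ?case by simp
qed

text \<open>
  With \<open>ad x\<close> the difference of the commuting left and right multiplications by \<open>x\<close>, this is the
  binomial theorem.
\<close>
lemma commutator_funpow_binomial:
  fixes x z :: "'r::ring_1"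
  shows "(commutator x ^^ n) z = (\<Sum>i\<le>n. of_nat (n choose i) * (-1) ^ i * (x ^ (n - i) * z * x ^ i))"
proof (induction n)
  case 0
  then show ?case by simp
next
  case (Suc n)
  define t where "t i j = x ^ i * z * x ^ j" for i j
  define c where "c m i = (of_nat (m choose i) * (-1) ^ i :: 'r)" for m i
  have comm: "x * c m i = c m i * x" for m i
  proof -
    have "x * (- 1) ^ i = (- 1) ^ i * x"
      by (cases "even i") auto
    then show ?thesis
      unfolding c_def by (metis mult.assoc mult_of_nat_commute)
  qed
  have xt: "x * (c n i * t a b) = c n i * t (Suc a) b" for i a b
    using comm by (simp add: t_def mult.assoc) (simp flip: mult.assoc)
  have tx: "(c n i * t a b) * x = c n i * t a (Suc b)" for i a b
    by (simp add: t_def mult.assoc power_commutes)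
  have "(commutator x ^^ Suc n) z = commutator x (\<Sum>i\<le>n. c n i * t (n - i) i)"
    by (simp add: Suc.IH c_def t_def)
  also have "\<dots> = (\<Sum>i\<le>n. c n i * t (Suc n - i) i) - (\<Sum>i\<le>n. c n i * t (n - i) (Suc i))"
    by (simp add: commutator_def sum_distrib_left sum_distrib_right xt tx Suc_diff_le)
  also have "(\<Sum>i\<le>n. c n i * t (n - i) (Suc i)) = (\<Sum>i\<in>{1..Suc n}. c n (i - 1) * t (Suc n - i) i)"
    by (rule sum.reindex_bij_witness[of _ "\<lambda>i. i - 1" Suc]) auto
  also have "(\<Sum>i\<le>n. c n i * t (Suc n - i) i) = (\<Sum>i\<le>Suc n. c n i * t (Suc n - i) i)"
    by (simp add: c_def binomial_eq_0)
  also have "\<dots> = c n 0 * t (Suc n) 0 + (\<Sum>i\<in>{1..Suc n}. c n i * t (Suc n - i) i)"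
    by (simp add: atMost_atLeast0 sum.atLeast_Suc_atMost)
  also have "c n 0 * t (Suc n) 0 + (\<Sum>i\<in>{1..Suc n}. c n i * t (Suc n - i) i)
        - (\<Sum>i\<in>{1..Suc n}. c n (i - 1) * t (Suc n - i) i)
      = c n 0 * t (Suc n) 0 + (\<Sum>i\<in>{1..Suc n}. (c n i - c n (i - 1)) * t (Suc n - i) i)"
    by (simp only: sum_subtractf left_diff_distrib add_diff_eq)
  also have "(\<Sum>i\<in>{1..Suc n}. (c n i - c n (i - 1)) * t (Suc n - i) i)
      = (\<Sum>i\<in>{1..Suc n}. c (Suc n) i * t (Suc n - i) i)"
  proof (intro sum.cong refl arg_cong2[where f = "(*)"])
    fix i assume "i \<in> {1..Suc n}"
    then obtain j where "i = Suc j"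
      by (cases i) auto
    then show "c n i - c n (i - 1) = c (Suc n) i"
      by (simp add: c_def algebra_simps)
  qed
  also have "c n 0 * t (Suc n) 0 + \<dots> = (\<Sum>i\<le>Suc n. c (Suc n) i * t (Suc n - i) i)"
    by (simp add: atMost_atLeast0 sum.atLeast_Suc_atMost c_def)
  finally show ?case
    by (simp add: c_def t_def)
qed

lemma of_nat_zero_of_dvd:
  assumes "of_nat p = (0::'r::semiring_1)" "p dvd n"
  shows "of_nat n = (0::'r)"
  using assms by (auto elim!: dvdE)

text \<open>
  Pascal's rule and \<open>p dvd (p choose i)\<close> give \<open>(p - 1 choose i) = - (p - 1 choose (i - 1))\<close>
  modulo \<open>p\<close>.
\<close>
lemma binomial_prime_minus_one:
  assumes p: "prime p" and char: "of_nat p = (0::'r::ring_1)" and "i < p"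
  shows "of_nat ((p - 1) choose i) * (-1) ^ i = (1::'r)"
  using \<open>i < p\<close>
proof (induction i)
  case 0
  then show ?case by simp
next
  case (Suc i)
  obtain q where q: "p = Suc q"
    using Suc.prems by (cases p) auto
  have "p dvd (p choose Suc i)"
    using Suc.prems p by (intro dvd_choose_prime) auto
  then have "of_nat (p choose Suc i) = (0::'r)"
    by (rule of_nat_zero_of_dvd[OF char])
  then have "of_nat ((p - 1) choose Suc i) = - (of_nat ((p - 1) choose i) :: 'r)"
    unfolding q by (simp add: eq_neg_iff_add_eq_0 add.commute)
  then show ?case
    using Suc by simp
qed

text \<open>
  This sum is what remains when \<open>z\<close> is the commutator picked up while moving a letter past \<open>x\<^sup>p\<close>,
  and also the derivative of \<open>x\<^sup>p\<close> in the direction \<open>z\<close>.  The first reading resolves the overlaps of the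
  rewriting system below, the second one gives Jacobson's formula.
\<close>
lemma commutator_funpow_prime_minus_one:
  fixes x z :: "'r::ring_1"
  assumes p: "prime p" and char: "of_nat p = (0::'r)"
  shows "(commutator x ^^ (p - 1)) z = (\<Sum>i<p. x ^ i * z * x ^ (p - Suc i))"
proof -
  have "(commutator x ^^ (p - 1)) z = (\<Sum>i\<le>p - 1. x ^ (p - 1 - i) * z * x ^ i)"
    unfolding commutator_funpow_binomial
    using binomial_prime_minus_one[OF p char] prime_gt_0_nat[OF p]
    by (intro sum.cong refl) simp
  also have "\<dots> = (\<Sum>i<p. x ^ i * z * x ^ (p - Suc i))"
    using prime_gt_0_nat[OF p]
    by (intro sum.reindex_bij_witness[of _ "\<lambda>i. p - 1 - i" "\<lambda>i. p - 1 - i"]) auto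
  finally show ?thesis .
qed

lemma fps_deriv_power_noncommutative:
  fixes P :: "'r::ring_1 fps"
  shows "fps_deriv (P ^ n) = (\<Sum>i<n. P ^ i * fps_deriv P * P ^ (n - Suc i))"
proof (induction n)
  case 0
  then show ?case by simp
next
  case (Suc n)
  have "fps_deriv (P ^ Suc n) = P ^ n * fps_deriv P + fps_deriv (P ^ n) * P"
    by (simp only: power_Suc2 fps_deriv_mult)
  also have "fps_deriv (P ^ n) * P = (\<Sum>i<n. P ^ i * fps_deriv P * P ^ (Suc n - Suc i))"
    unfolding Suc.IH sum_distrib_right
    by (intro sum.cong refl) (simp add: mult.assoc Suc_diff_Suc flip: power_Suc2)
  finally show ?case by simp
qed

text \<open>
  Power series serve as the polynomials in a central indeterminate over a noncommutative ring.
\<close>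
lemma fps_linear_power_nth:
  fixes x y :: "'r::ring_1"
  defines "P \<equiv> fps_const x * fps_X + fps_const y"
  shows "fps_nth (P ^ n) 0 = y ^ n" "fps_nth (P ^ n) n = x ^ n" "k > n \<Longrightarrow> fps_nth (P ^ n) k = 0"
    "(\<Sum>i\<le>n. fps_nth (P ^ n) i) = (x + y) ^ n"
proof -
  have rec: "fps_nth (P ^ Suc n) k = (if k = 0 then 0 else x * fps_nth (P ^ n) (k - 1)) + y * fps_nth (P ^ n) k"
    for n k
    by (simp add: P_def distrib_right mult.assoc fps_mult_fps_X_commute[symmetric])
  show "fps_nth (P ^ n) 0 = y ^ n"
    by (induction n) (simp_all only: rec, simp_all)
  have high: "k > n \<Longrightarrow> fps_nth (P ^ n) k = 0" for n k
    by (induction n arbitrary: k) (simp_all only: rec, simp_all)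
  then show "k > n \<Longrightarrow> fps_nth (P ^ n) k = 0" .
  show "fps_nth (P ^ n) n = x ^ n"
    by (induction n) (simp_all only: rec, simp_all add: high)
  show "(\<Sum>i\<le>n. fps_nth (P ^ n) i) = (x + y) ^ n"
  proof (induction n)
    case 0
    then show ?case by simp
  next
    case (Suc n)
    have "(\<Sum>i\<le>Suc n. fps_nth (P ^ Suc n) i)
        = (\<Sum>i\<le>Suc n. if i = 0 then 0 else x * fps_nth (P ^ n) (i - 1))
          + y * (\<Sum>i\<le>Suc n. fps_nth (P ^ n) i)"
      by (simp only: rec sum.distrib sum_distrib_left)
    also have "(\<Sum>i\<le>Suc n. if i = 0 then 0 else x * fps_nth (P ^ n) (i - 1))
        = x * (\<Sum>i\<le>n. fps_nth (P ^ n) i)"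
      by (subst sum.atMost_Suc_shift) (simp add: sum_distrib_left)
    also have "(\<Sum>i\<le>Suc n. fps_nth (P ^ n) i) = (\<Sum>i\<le>n. fps_nth (P ^ n) i)"
      by (simp add: high)
    finally show ?case
      unfolding Suc.IH by (simp add: distrib_right)
  qed
qed

text \<open>
  The derivative of \<open>(t x + y)\<^sup>p\<close> with respect to \<open>t\<close> is
  \<open>(ad (t x + y))\<^sup>p\<^sup>-\<^sup>1 (x)\<close>; comparing coefficients yields Jacobson's formula.
\<close>
lemma fps_linear_power_prime_nth:
  fixes x y :: "'r::ring_1"
  assumes p: "prime p" and char: "of_nat p = (0::'r)"
  defines "P \<equiv> fps_const x * fps_X + fps_const y"
  shows "of_nat (Suc i) * fps_nth (P ^ p) (Suc i) = fps_nth ((commutator P ^^ (p - 1)) (fps_const x)) i"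
proof -
  have "of_nat p = (0 :: 'r fps)"
    by (simp add: fps_eq_iff fps_nth_of_nat char)
  then have "(commutator P ^^ (p - 1)) (fps_const x) = (\<Sum>i<p. P ^ i * fps_const x * P ^ (p - Suc i))"
    by (rule commutator_funpow_prime_minus_one[OF p])
  also have "\<dots> = fps_deriv (P ^ p)"
    unfolding fps_deriv_power_noncommutative by (simp add: P_def)
  finally show ?thesis
    by simp
qed

section \<open>Functionals on free algebras\<close>

definition word :: "'a list \<Rightarrow> 'a fword \<Rightarrow>\<^sub>0 'k::field" where
  "word w = Poly_Mapping.single (FWord w) 1"

text \<open>
  The linear extension of a function on words.  The values are polynomials over the ground field so
  that a functional can record the action of a polynomial subalgebra.
\<close>
definition lin_ext :: "('a list \<Rightarrow> 'k poly) \<Rightarrow> ('a fword \<Rightarrow>\<^sub>0 'k::field) \<Rightarrow> 'k poly" where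
  "lin_ext \<tau> f = (\<Sum>w\<in>Poly_Mapping.keys f. smult (poly_mapping.lookup f w) (\<tau> (letters w)))"

lemma word_Nil: "word [] = 1"
  by (simp add: word_def flip: zero_fword_def)

lemma word_append: "word (u @ v) = word u * word v"
  by (simp add: word_def mult_single plus_fword_def)

lemma word_Cons: "word (x # u) = free_gen x * word u"
  using word_append[of "[x]" u] by (simp add: word_def free_gen_def)

lemma word_single: "word [x] = free_gen x"
  by (simp add: word_def free_gen_def)

lemma word_replicate: "word (replicate n x) = free_gen x ^ n"
  by (induction n) (simp_all add: word_Nil word_Cons)

lemma free_const_simps:
  "free_const 0 = 0" "free_const 1 = 1" "free_const (c + d) = free_const c + free_const d"
  "free_const (c * d) = free_const c * free_const d" "free_const (c ^ n) = free_const c ^ n"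
  "free_const (of_nat m) = of_nat m"
proof -
  show *: "free_const 1 = 1" for c d :: 'k
    by (simp add: free_const_def)
  show mult: "free_const (c * d) = free_const c * free_const d" for c d
    by (simp add: free_const_def mult_single)
  show "free_const (c ^ n) = free_const c ^ n"
    by (induction n) (simp_all add: * mult)
qed (simp_all add: free_const_def single_add)

lemma poly_mapping_expand_words:
  "f = (\<Sum>w\<in>Poly_Mapping.keys f. free_const (poly_mapping.lookup f w) * word (letters w))"
proof (rule poly_mapping_eqI)
  fix u
  have "poly_mapping.lookup (\<Sum>w\<in>Poly_Mapping.keys f. free_const (poly_mapping.lookup f w) * word (letters w)) u
      = (\<Sum>w\<in>Poly_Mapping.keys f. if w = u then poly_mapping.lookup f w else 0)"
    by (simp add: lookup_sum free_const_def word_def mult_single lookup_single when_def)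
  then show "poly_mapping.lookup f u =
      poly_mapping.lookup (\<Sum>w\<in>Poly_Mapping.keys f. free_const (poly_mapping.lookup f w) * word (letters w)) u"
    by (simp add: in_keys_iff)
qed

lemma free_algebra_induct [case_names zero word add]:
  assumes "P 0" "\<And>c w. P (free_const c * word w)" "\<And>f g. P f \<Longrightarrow> P g \<Longrightarrow> P (f + g)"
  shows "P f"
proof -
  have "P (\<Sum>w\<in>A. free_const (poly_mapping.lookup f w) * word (letters w))" for A
    by (induction A rule: infinite_finite_induct) (use assms in auto)
  then show ?thesis
    using poly_mapping_expand_words by metis
qed

lemma free_const_commute: "f * free_const c = free_const c * f"
  by (induction f rule: free_algebra_induct)
    (simp_all add: free_const_def word_def mult_single algebra_simps)

lemma free_const_left_commute: "f * (free_const c * g) = free_const c * (f * g)"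
  by (simp only: free_const_commute[of f] flip: mult.assoc)

lemma lin_ext_superset:
  assumes "finite A" "Poly_Mapping.keys f \<subseteq> A"
  shows "lin_ext \<tau> f = (\<Sum>w\<in>A. smult (poly_mapping.lookup f w) (\<tau> (letters w)))"
  unfolding lin_ext_def
  by (rule sum.mono_neutral_left) (use assms in \<open>auto simp: in_keys_iff\<close>)

lemma lin_ext_zero [simp]: "lin_ext \<tau> 0 = 0"
  by (simp add: lin_ext_def)

lemma lin_ext_add: "lin_ext \<tau> (f + g) = lin_ext \<tau> f + lin_ext \<tau> g"
proof -
  let ?A = "Poly_Mapping.keys f \<union> Poly_Mapping.keys g"
  have "Poly_Mapping.keys (f + g) \<subseteq> ?A"
    by (rule keys_add)
  then show ?thesis
    by (simp add: lin_ext_superset[of ?A] lookup_add smult_add_left sum.distrib)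
qed

lemma lin_ext_single: "lin_ext \<tau> (Poly_Mapping.single w c) = smult c (\<tau> (letters w))"
  by (simp add: lin_ext_def)

lemma lin_ext_word [simp]: "lin_ext \<tau> (word w) = \<tau> w"
  by (simp add: word_def lin_ext_single)

lemma smult_sum_right: "smult c (sum f A) = (\<Sum>i\<in>A. smult c (f i))"
  by (induction A rule: infinite_finite_induct) (simp_all add: smult_add_right)

lemma lin_ext_free_const: "lin_ext \<tau> (free_const c * f) = smult c (lin_ext \<tau> f)"
proof -
  have l: "poly_mapping.lookup (free_const c * f) w = c * poly_mapping.lookup f w" for w
    by (induction f rule: free_algebra_induct)
      (simp_all add: free_const_def word_def mult_single lookup_single lookup_add when_def algebra_simps)
  then have "Poly_Mapping.keys (free_const c * f) \<subseteq> Poly_Mapping.keys f"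
    by (auto simp: in_keys_iff)
  then have "lin_ext \<tau> (free_const c * f)
      = (\<Sum>w\<in>Poly_Mapping.keys f. smult (c * poly_mapping.lookup f w) (\<tau> (letters w)))"
    by (simp add: lin_ext_superset[of "Poly_Mapping.keys f"] l)
  then show ?thesis
    by (simp add: lin_ext_def smult_sum_right)
qed

lemma lin_ext_diff: "lin_ext \<tau> (f - g) = lin_ext \<tau> f - lin_ext \<tau> g"
  using lin_ext_add[of \<tau> "f - g" g] by (simp add: eq_diff_eq)

lemma lin_ext_sum: "lin_ext \<tau> (sum f A) = (\<Sum>i\<in>A. lin_ext \<tau> (f i))"
  by (induction A rule: infinite_finite_induct) (simp_all add: lin_ext_add)

lemma lin_ext_sandwich:
  "lin_ext \<tau> (a * f * b) =
    (\<Sum>w\<in>Poly_Mapping.keys f. smult (poly_mapping.lookup f w) (lin_ext \<tau> (a * word (letters w) * b)))"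
  by (subst poly_mapping_expand_words[of f])
    (simp add: sum_distrib_left sum_distrib_right lin_ext_sum lin_ext_free_const
      free_const_left_commute mult.assoc)

lemma lin_ext_cong_sandwich:
  assumes "\<And>w. FWord w \<in> Poly_Mapping.keys f \<Longrightarrow>
    lin_ext \<tau> (a * word w * b) = lin_ext \<tau> (a' * word w * b')"
  shows "lin_ext \<tau> (a * f * b) = lin_ext \<tau> (a' * f * b')"
  unfolding lin_ext_sandwich[of \<tau> a f b] lin_ext_sandwich[of \<tau> a' f b']
  by (intro sum.cong refl arg_cong2[where f = smult] assms) simp

lemma lin_ext_cong:
  assumes "\<And>w. FWord w \<in> Poly_Mapping.keys f \<Longrightarrow> \<tau> w = \<tau>' w"
  shows "lin_ext \<tau> f = lin_ext \<tau>' f"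
  unfolding lin_ext_def
  by (intro sum.cong refl arg_cong2[where f = smult] assms) simp

text \<open>
  \<open>red w f\<close> says that one rewriting step leads from the word \<open>w\<close> to the linear combination \<open>f\<close>.  The
  restriction to a set of words makes the notion usable as an induction hypothesis.
\<close>
definition reduction_invariant :: "('a list \<Rightarrow> ('a fword \<Rightarrow>\<^sub>0 'k::field) \<Rightarrow> bool) \<Rightarrow>
    'a list set \<Rightarrow> ('a list \<Rightarrow> 'k poly) \<Rightarrow> bool" where
  "reduction_invariant red W \<tau> \<longleftrightarrow> (\<forall>w\<in>W. \<forall>f. red w f \<longrightarrow> \<tau> w = lin_ext \<tau> f)"

text \<open>
  Bergman's diamond lemma, stated for functions instead of normal forms.  The value at a reducible word
  is computed by well-founded recursion along one chosen step; the hypothesis of local confluence says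
  precisely that, if all smaller words are treated consistently, another step yields the same value.
\<close>
lemma diamond:
  fixes red :: "'a list \<Rightarrow> ('a fword \<Rightarrow>\<^sub>0 'k::field) \<Rightarrow> bool"
  assumes wf: "wf R"
    and decreasing: "\<And>w f u. red w f \<Longrightarrow> FWord u \<in> Poly_Mapping.keys f \<Longrightarrow> (u, w) \<in> R"
    and confluent: "\<And>w f g \<tau>. red w f \<Longrightarrow> red w g \<Longrightarrow>
      reduction_invariant red {u. (u, w) \<in> R} \<tau> \<Longrightarrow> lin_ext \<tau> f = lin_ext \<tau> g"
  obtains \<tau> where "reduction_invariant red UNIV \<tau>" "\<And>w. \<nexists>f. red w f \<Longrightarrow> \<tau> w = \<nu> w"
proof -
  define step where "step \<sigma> w = (if \<exists>f. red w f then lin_ext \<sigma> (SOME f. red w f) else \<nu> w)"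
    for \<sigma> :: "'a list \<Rightarrow> 'k poly" and w
  define \<tau> where "\<tau> = wfrec R step"
  have \<tau>: "\<tau> w = step \<tau> w" for w
  proof -
    have "step (cut \<tau> R w) w = step \<tau> w"
    proof (cases "\<exists>f. red w f")
      case True
      then have "red w (SOME f. red w f)"
        by (rule someI_ex)
      then have "lin_ext (cut \<tau> R w) (SOME f. red w f) = lin_ext \<tau> (SOME f. red w f)"
        by (intro lin_ext_cong cut_apply decreasing)
      then show ?thesis
        by (simp add: step_def)
    qed (simp add: step_def)
    then show ?thesis
      unfolding \<tau>_def by (subst wfrec[OF wf]) simp
  qed
  have inv: "\<forall>f. red w f \<longrightarrow> \<tau> w = lin_ext \<tau> f" for w
    using wf
  proof (induction w rule: wf_induct_rule)
    case (less w)
    show ?case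
    proof (intro allI impI)
      fix f assume f: "red w f"
      then have "red w (SOME f. red w f)"
        by (rule someI)
      then have "lin_ext \<tau> (SOME f. red w f) = lin_ext \<tau> f"
        using f less by (intro confluent) (auto simp: reduction_invariant_def)
      then show "\<tau> w = lin_ext \<tau> f"
        using f \<tau>[of w] by (auto simp: step_def)
    qed
  qed
  show thesis
  proof (rule that)
    show "reduction_invariant red UNIV \<tau>"
      using inv by (simp add: reduction_invariant_def)
    show "\<tau> w = \<nu> w" if "\<nexists>f. red w f" for w
      using that \<tau>[of w] by (simp add: step_def)
  qed
qed

section \<open>Jacobson's formula modulo an ideal of the free algebra\<close>

text \<open>
  The type class counterpart of the predicate \<open>ideal\<close>; calculations modulo an ideal of the free
  algebra then take place in a type of class \<open>ring_1\<close>.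
\<close>
definition two_sided_ideal :: "'r::ring_1 set \<Rightarrow> bool" where
  "two_sided_ideal K \<longleftrightarrow> 0 \<in> K \<and> (\<forall>f\<in>K. \<forall>g\<in>K. f - g \<in> K) \<and> (\<forall>f\<in>K. \<forall>a. a * f \<in> K \<and> f * a \<in> K)"

context
  fixes K :: "'r::ring_1 set"
  assumes K: "two_sided_ideal K"
begin

lemma ideal_zero: "0 \<in> K"
  and ideal_diff: "f \<in> K \<Longrightarrow> g \<in> K \<Longrightarrow> f - g \<in> K"
  and ideal_mult_left: "f \<in> K \<Longrightarrow> a * f \<in> K"
  and ideal_mult_right: "f \<in> K \<Longrightarrow> f * a \<in> K"
  using K by (auto simp: two_sided_ideal_def)

lemma ideal_minus: "f \<in> K \<Longrightarrow> - f \<in> K"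
  using ideal_diff[OF ideal_zero, of f] by simp

lemma ideal_add: "f \<in> K \<Longrightarrow> g \<in> K \<Longrightarrow> f + g \<in> K"
  using ideal_diff[OF _ ideal_minus, of f g] by simp

lemma ideal_cong_sym: "a - b \<in> K \<Longrightarrow> b - a \<in> K"
  using ideal_minus[of "a - b"] by simp

lemma ideal_cong_trans: "a - b \<in> K \<Longrightarrow> b - c \<in> K \<Longrightarrow> a - c \<in> K"
  using ideal_add[of "a - b" "b - c"] by simp

lemma ideal_cong_add: "a - b \<in> K \<Longrightarrow> c - d \<in> K \<Longrightarrow> (a + c) - (b + d) \<in> K"
  using ideal_add[of "a - b" "c - d"] by (simp add: algebra_simps)

lemma ideal_cong_mult:
  assumes "a - b \<in> K" "c - d \<in> K"
  shows "a * c - b * d \<in> K"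
proof -
  have "a * c - b * d = (a - b) * c + b * (c - d)"
    by (simp add: algebra_simps)
  then show ?thesis
    using assms by (simp only: ideal_add ideal_mult_left ideal_mult_right)
qed

lemma ideal_cong_power: "a - b \<in> K \<Longrightarrow> a ^ n - b ^ n \<in> K"
  by (induction n) (simp_all add: ideal_zero ideal_cong_mult)

end

lemma fps_linear_commutator_nth:
  fixes x y :: "'r::ring_1"
  shows "fps_nth (commutator (fps_const x * fps_X + fps_const y) f) i
    = (if i = 0 then 0 else commutator x (fps_nth f (i - 1))) + commutator y (fps_nth f i)"
proof -
  have "f * (fps_const x * fps_X) = (f * fps_const x) * fps_X"
    by (simp add: mult.assoc)
  moreover have "(fps_const x * fps_X) * f = (fps_const x * f) * fps_X"
    by (simp add: mult.assoc fps_mult_fps_X_commute)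
  ultimately show ?thesis
    by (simp add: commutator_def distrib_left distrib_right)
qed

context restricted_lie_algebra
begin

abbreviation gen :: "'a \<Rightarrow> 'a fword \<Rightarrow>\<^sub>0 'k" (\<open>\<iota>\<close>) where
  "\<iota> \<equiv> free_gen"

lemma prime_char: "prime CHAR('k)"
  using prime_CHAR_semidom[where ?'a = 'k] char_pos by blast

lemma char_ge_2: "CHAR('k) \<ge> 2"
  using prime_char by (rule prime_ge_2_nat)

lemma free_algebra_char: "of_nat CHAR('k) = (0 :: 'a fword \<Rightarrow>\<^sub>0 'k)"
  by (metis free_const_simps(1,6) of_nat_CHAR)

lemma bracket_anticommute: "bracket x y = - bracket y x"
proof -
  have "bracket (x + y) (x + y) = bracket x y + bracket y x"
    unfolding bracket_add_left bracket_add_right by (simp add: bracket_self add.commute)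
  then show ?thesis
    by (simp add: bracket_self eq_neg_iff_add_eq_0)
qed

lemma bracket_zero_right [simp]: "bracket x 0 = 0"
  using bracket_scale_right[of x 0 0] by simp

lemma bracket_minus_right: "bracket x (- y) = - bracket x y"
  using bracket_add_right[of x "- y" y] by (simp add: eq_neg_iff_add_eq_0)

lemma bracket_funpow_minus: "(bracket x ^^ n) (- y) = - (bracket x ^^ n) y"
  by (induction n) (simp_all add: bracket_minus_right)

lemma bracket_funpow_char: "(bracket x ^^ (CHAR('k) - 1)) (bracket x y) = bracket (pmap x) y"
proof -
  obtain q where "CHAR('k) = Suc q"
    using char_pos by (cases "CHAR('k)") auto
  then show ?thesis
    by (simp add: bracket_pmap funpow_swap1)
qed

lemma coeff_ad_poly:
  "coeff (ad_poly x y f) i = (if i = 0 then 0 else bracket x (coeff f (i - 1))) + bracket y (coeff f i)"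
  by (simp add: ad_poly_def coeff_pCons coeff_map_poly split: nat.splits)

context
  fixes K :: "('a fword \<Rightarrow>\<^sub>0 'k) set"
  assumes K: "two_sided_ideal K"
    and rel_add: "\<And>x y. \<iota> (x + y) - \<iota> x - \<iota> y \<in> K"
    and rel_scale: "\<And>c x. \<iota> (c *s x) - free_const c * \<iota> x \<in> K"
    and rel_bracket: "\<And>x y. commutator (\<iota> x) (\<iota> y) - \<iota> (bracket x y) \<in> K"
begin

lemma gen_zero_in_ideal: "\<iota> 0 \<in> K"
  using rel_scale[of 0 0] by (simp add: free_const_simps)

lemma gen_add_cong: "a - \<iota> x \<in> K \<Longrightarrow> b - \<iota> y \<in> K \<Longrightarrow> (a + b) - \<iota> (x + y) \<in> K"
  using ideal_diff[OF K ideal_cong_add[OF K, of a "\<iota> x" b "\<iota> y"] rel_add[of x y]]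
  by (simp add: algebra_simps)

lemma gen_sum_cong:
  "(\<And>i. i \<in> A \<Longrightarrow> f i - \<iota> (x i) \<in> K) \<Longrightarrow> sum f A - \<iota> (sum x A) \<in> K"
  using gen_zero_in_ideal
  by (induction A rule: infinite_finite_induct)
    (auto simp: gen_add_cong intro: ideal_minus[OF K, of "\<iota> 0", simplified])

lemma gen_bracket_cong:
  assumes "a - \<iota> z \<in> K"
  shows "commutator (\<iota> x) a - \<iota> (bracket x z) \<in> K"
proof -
  have "commutator (\<iota> x) a - \<iota> (bracket x z)
      = \<iota> x * (a - \<iota> z) - (a - \<iota> z) * \<iota> x + (commutator (\<iota> x) (\<iota> z) - \<iota> (bracket x z))"
    by (simp add: commutator_def algebra_simps)
  then show ?thesis
    using assms rel_bracket
    by (simp only: ideal_add[OF K] ideal_diff[OF K] ideal_mult_left[OF K] ideal_mult_right[OF K])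
qed

text \<open>
  The computation in \<open>L \<otimes> k[t]\<close> by which the terms \<open>s\<^sub>i(x, y)\<close> are defined is carried over to
  power series over the free algebra.
\<close>
lemma ad_poly_cong:
  "fps_nth ((commutator (fps_const (\<iota> x) * fps_X + fps_const (\<iota> y)) ^^ n) (fps_const (\<iota> x))) i
     - \<iota> (coeff ((ad_poly x y ^^ n) [:x:]) i) \<in> K"
proof (induction n arbitrary: i)
  case 0
  then show ?case
    using gen_zero_in_ideal ideal_zero[OF K] ideal_minus[OF K, of "\<iota> 0"]
    by (simp add: coeff_pCons split: nat.splits)
next
  case (Suc n)
  have zero: "0 - \<iota> 0 \<in> K"
    using ideal_minus[OF K gen_zero_in_ideal] by simp
  show ?case
    unfolding funpow.simps(2) o_apply fps_linear_commutator_nth coeff_ad_poly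
    by (rule gen_add_cong) (use gen_bracket_cong[OF Suc] zero in auto)
qed

text \<open>
  The \<open>i\<close>-th coefficient of \<open>(t x + y)\<^sup>p\<close> is congruent to \<open>s\<^sub>i(x, y)\<close> for \<open>0 < i < p\<close>, because \<open>i\<close> is
  invertible in the ground field, and the two outer coefficients are \<open>x\<^sup>p\<close> and \<open>y\<^sup>p\<close>.  Setting \<open>t = 1\<close>
  matches the axiom for the \<open>p\<close>-map of a sum.
\<close>
lemma power_relation_add:
  assumes "\<iota> x ^ CHAR('k) - \<iota> (pmap x) \<in> K" "\<iota> y ^ CHAR('k) - \<iota> (pmap y) \<in> K"
  shows "\<iota> (x + y) ^ CHAR('k) - \<iota> (pmap (x + y)) \<in> K"
proof -
  let ?p = "CHAR('k)"
  define P where "P = fps_const (\<iota> x) * fps_X + fps_const (\<iota> y)"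
  have middle: "fps_nth (P ^ ?p) i - \<iota> (jacobson_s i x y) \<in> K" if "i \<in> {1..?p - 1}" for i
  proof -
    obtain j where j: "i = Suc j"
      using \<open>i \<in> {1..?p - 1}\<close> by (cases i) auto
    let ?c = "free_const (inverse (of_nat i :: 'k)) :: 'a fword \<Rightarrow>\<^sub>0 'k"
    have "\<not> ?p dvd i"
      using that prime_gt_0_nat[OF prime_char] by (auto dest: dvd_imp_le)
    then have "of_nat i \<noteq> (0 :: 'k)"
      by (simp add: of_nat_eq_0_iff_char_dvd)
    then have "?c * of_nat i = 1"
      by (simp flip: free_const_simps)
    then have "fps_nth (P ^ ?p) i = ?c * (of_nat i * fps_nth (P ^ ?p) i)"
      by (simp flip: mult.assoc)
    also have "of_nat i * fps_nth (P ^ ?p) i = fps_nth ((commutator P ^^ (?p - 1)) (fps_const (\<iota> x))) (i - 1)"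
      using fps_linear_power_prime_nth[OF prime_char free_algebra_char, of j "\<iota> x" "\<iota> y"]
      unfolding P_def j diff_Suc_1 .
    finally have eq: "fps_nth (P ^ ?p) i = ?c * fps_nth ((commutator P ^^ (?p - 1)) (fps_const (\<iota> x))) (i - 1)" .
    have "?c * fps_nth ((commutator P ^^ (?p - 1)) (fps_const (\<iota> x))) (i - 1)
        - ?c * \<iota> (coeff ((ad_poly x y ^^ (?p - 1)) [:x:]) (i - 1)) \<in> K"
      unfolding right_diff_distrib[symmetric] P_def
      by (rule ideal_mult_left[OF K ad_poly_cong])
    from ideal_cong_trans[OF K this ideal_cong_sym[OF K rel_scale]] show ?thesis
      unfolding eq jacobson_s_def .
  qed
  have "(\<iota> x + \<iota> y) ^ ?p = (\<Sum>i\<le>?p. fps_nth (P ^ ?p) i)"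
    by (simp add: P_def fps_linear_power_nth(4))
  also have "\<dots> = fps_nth (P ^ ?p) ?p + fps_nth (P ^ ?p) 0 + (\<Sum>i\<in>{1..?p - 1}. fps_nth (P ^ ?p) i)"
  proof -
    have "{..?p} = insert ?p (insert 0 {1..?p - 1})"
      using prime_gt_0_nat[OF prime_char] by auto
    then show ?thesis
      using prime_gt_0_nat[OF prime_char] by (simp add: add.assoc)
  qed
  also have "\<dots> = \<iota> x ^ ?p + \<iota> y ^ ?p + (\<Sum>i\<in>{1..?p - 1}. fps_nth (P ^ ?p) i)"
    by (simp add: P_def fps_linear_power_nth(1,2))
  finally have "(\<iota> x + \<iota> y) ^ ?p - \<iota> (pmap (x + y)) \<in> K"
    unfolding pmap_add by (simp only:) (intro gen_add_cong gen_sum_cong assms middle)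
  moreover have "\<iota> (x + y) ^ ?p - (\<iota> x + \<iota> y) ^ ?p \<in> K"
    using rel_add by (intro ideal_cong_power[OF K]) (simp add: diff_diff_eq)
  ultimately show ?thesis
    using ideal_cong_trans[OF K] by blast
qed

lemma power_relation_scale:
  assumes "\<iota> x ^ CHAR('k) - \<iota> (pmap x) \<in> K"
  shows "\<iota> (c *s x) ^ CHAR('k) - \<iota> (pmap (c *s x)) \<in> K"
proof -
  let ?p = "CHAR('k)"
  have "(free_const c * \<iota> x) ^ n = free_const (c ^ n) * \<iota> x ^ n" for n
  proof (induction n)
    case 0
    show ?case by (simp add: free_const_simps)
  next
    case (Suc n)
    then show ?case
      by (simp add: free_const_simps(4) free_const_left_commute[of "\<iota> x"] mult.assoc)
  qed
  then have "\<iota> (c *s x) ^ ?p - free_const (c ^ ?p) * \<iota> x ^ ?p \<in> K"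
    using ideal_cong_power[OF K rel_scale[of c x], of ?p] by simp
  moreover have "free_const (c ^ ?p) * \<iota> x ^ ?p - free_const (c ^ ?p) * \<iota> (pmap x) \<in> K"
    unfolding right_diff_distrib[symmetric] by (rule ideal_mult_left[OF K assms])
  ultimately show ?thesis
    unfolding pmap_scale
    using ideal_cong_trans[OF K] ideal_cong_sym[OF K rel_scale[of "c ^ ?p" "pmap x"]] by blast
qed

text \<open>
  Thus the relations \<open>x\<^sup>p = x\<^bsup>[p]\<^esup>\<close> for a basis imply all the others.
\<close>
lemma power_relation_span:
  assumes "\<And>b. b \<in> B \<Longrightarrow> \<iota> b ^ CHAR('k) - \<iota> (pmap b) \<in> K" "x \<in> span B"
  shows "\<iota> x ^ CHAR('k) - \<iota> (pmap x) \<in> K"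
proof -
  have "pmap 0 = 0"
    using pmap_scale[of 0 0] by (simp add: zero_power[OF char_pos])
  moreover have "\<iota> 0 ^ CHAR('k) \<in> K"
    using char_pos gen_zero_in_ideal by (cases "CHAR('k)") (auto intro: ideal_mult_right[OF K])
  ultimately have "\<iota> 0 ^ CHAR('k) - \<iota> (pmap 0) \<in> K"
    using gen_zero_in_ideal by (simp add: ideal_diff[OF K])
  then have "subspace {x. \<iota> x ^ CHAR('k) - \<iota> (pmap x) \<in> K}"
    by (intro subspaceI) (simp_all add: power_relation_add power_relation_scale)
  then show ?thesis
    using span_induct[OF assms(2)] assms(1) by blast
qed

end

end

section \<open>A confluent rewriting system for the restricted enveloping algebra\<close>

text \<open>
  A basis \<open>B\<close> of the Lie algebra that contains a basis \<open>C\<close> of a restricted subalgebra.  For \<open>span C\<close> to be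
  one, brackets and \<open>p\<close>-th powers have to be checked on \<open>C\<close> only: the terms \<open>s\<^sub>i(x, y)\<close> of the \<open>p\<close>-map of a
  sum are made of brackets.
\<close>
locale adapted_basis = restricted_lie_algebra scale bracket pmap
  for scale :: "'k::field \<Rightarrow> 'a::ab_group_add \<Rightarrow> 'a" (infixr \<open>*s\<close> 75) and bracket pmap +
  fixes B C :: "'a set"
  assumes independent_B: "independent B" and span_B: "span B = UNIV" and C_subset_B: "C \<subseteq> B"
    and bracket_C: "b \<in> C \<Longrightarrow> c \<in> C \<Longrightarrow> bracket b c \<in> span C"
    and pmap_C: "b \<in> C \<Longrightarrow> pmap b \<in> span C"
begin

definition expansion :: "'a \<Rightarrow> 'a fword \<Rightarrow>\<^sub>0 'k" where
  "expansion x = (\<Sum>b | representation B x b \<noteq> 0. free_const (representation B x b) * \<iota> b)"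

lemma expansion_superset:
  assumes "finite A" "{b. representation B x b \<noteq> 0} \<subseteq> A"
  shows "expansion x = (\<Sum>b\<in>A. free_const (representation B x b) * \<iota> b)"
  unfolding expansion_def
  by (rule sum.mono_neutral_left) (use assms in \<open>auto simp: free_const_simps\<close>)

lemma expansion_add: "expansion (x + y) = expansion x + expansion y"
proof -
  have rep: "representation B (x + y) = (\<lambda>b. representation B x b + representation B y b)"
    by (rule representation_add) (simp_all add: independent_B span_B)
  let ?A = "{b. representation B x b \<noteq> 0} \<union> {b. representation B y b \<noteq> 0}"
  have "finite ?A"
    by (simp add: finite_representation)
  moreover have "{b. representation B (x + y) b \<noteq> 0} \<subseteq> ?A"
    by (auto simp: rep)
  ultimately show ?thesis
    by (simp add: expansion_superset[of ?A] rep free_const_simps distrib_right sum.distrib)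
qed

lemma expansion_scale: "expansion (c *s x) = free_const c * expansion x"
proof -
  have rep: "representation B (c *s x) = (\<lambda>b. c * representation B x b)"
    by (rule representation_scale) (simp_all add: independent_B span_B)
  let ?A = "{b. representation B x b \<noteq> 0}"
  have "finite ?A"
    by (simp add: finite_representation)
  moreover have "{b. representation B (c *s x) b \<noteq> 0} \<subseteq> ?A"
    by (auto simp: rep)
  ultimately show ?thesis
    by (simp add: expansion_superset[of ?A] rep free_const_simps mult.assoc sum_distrib_left)
qed

text \<open>
  In an irreducible word the letters never decrease, so the letters from \<open>C\<close> stand at its right end.  Letters
  outside the basis are the largest ones, which makes their expansion a decreasing step.
\<close>
definition letter_rank :: "'a \<Rightarrow> nat" where
  "letter_rank x = (if x \<in> C then 1 else if x \<in> B then 0 else 2)"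

text \<open>
  A well-order on the letters, so that the length-lexicographic order on words is well-founded.
\<close>
definition letter_order :: "('a \<times> 'a) set" where
  "letter_order = inv_image (less_than <*lex*> ((SOME r. Well_order r \<and> Field r = UNIV) - Id))
     (\<lambda>x. (letter_rank x, x))"

inductive rule :: "'a list \<Rightarrow> ('a fword \<Rightarrow>\<^sub>0 'k) \<Rightarrow> bool" where
  swap: "x \<in> B \<Longrightarrow> y \<in> B \<Longrightarrow> (x, y) \<in> letter_order \<Longrightarrow> rule [y, x] (\<iota> x * \<iota> y + \<iota> (bracket y x))"
| power: "b \<in> B \<Longrightarrow> rule (replicate CHAR('k) b) (\<iota> (pmap b))"
| expand: "x \<notin> B \<Longrightarrow> rule [x] (expansion x)"

inductive red :: "'a list \<Rightarrow> ('a fword \<Rightarrow>\<^sub>0 'k) \<Rightarrow> bool" where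
  "rule r f \<Longrightarrow> red (u @ r @ v) (word u * f * word v)"

lemma letter_order_props:
  shows letter_order_wf: "wf letter_order"
    and letter_order_trans: "(x, y) \<in> letter_order \<Longrightarrow> (y, z) \<in> letter_order \<Longrightarrow> (x, z) \<in> letter_order"
    and letter_order_irrefl: "(x, x) \<notin> letter_order"
    and letter_order_total: "x \<noteq> y \<Longrightarrow> (x, y) \<in> letter_order \<or> (y, x) \<in> letter_order"
    and letter_order_rank: "letter_rank x < letter_rank y \<Longrightarrow> (x, y) \<in> letter_order"
    and letter_order_rank_le: "(x, y) \<in> letter_order \<Longrightarrow> letter_rank x \<le> letter_rank y"
proof -
  define r where "r = (SOME r :: 'a rel. Well_order r \<and> Field r = UNIV)"
  have r: "Well_order r" "Field r = UNIV"
    using someI_ex[OF well_ordering[where 'a = 'a]] by (auto simp: r_def)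
  have lo: "(x, y) \<in> letter_order \<longleftrightarrow>
      letter_rank x < letter_rank y \<or> letter_rank x = letter_rank y \<and> (x, y) \<in> r \<and> x \<noteq> y" for x y
    by (auto simp: letter_order_def r_def)
  have w: "wf (r - Id)" and t: "trans r" and a: "antisym r" and tot: "total r"
    using r by (auto simp: order_on_defs)
  show "wf letter_order"
    unfolding letter_order_def r_def[symmetric] using w by (intro wf_inv_image wf_lex_prod) auto
  show "(x, y) \<in> letter_order \<Longrightarrow> (y, z) \<in> letter_order \<Longrightarrow> (x, z) \<in> letter_order"
    unfolding lo using t a by (auto dest: transD antisymD)
  show "(x, x) \<notin> letter_order"
    by (simp add: lo)
  show "x \<noteq> y \<Longrightarrow> (x, y) \<in> letter_order \<or> (y, x) \<in> letter_order"
    unfolding lo using tot by (auto simp: total_on_def)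
  show "letter_rank x < letter_rank y \<Longrightarrow> (x, y) \<in> letter_order"
    "(x, y) \<in> letter_order \<Longrightarrow> letter_rank x \<le> letter_rank y"
    by (auto simp: lo)
qed

abbreviation word_order :: "('a list \<times> 'a list) set" where
  "word_order \<equiv> lenlex letter_order"

lemma word_order_shorter: "length u < length w \<Longrightarrow> (u, w) \<in> word_order"
  by (simp add: lenlex_conv)

lemma word_order_context:
  assumes "(r, s) \<in> word_order"
  shows "(u @ r @ v, u @ s @ v) \<in> word_order"
  using lenlex_append1[OF assms, of v v] letter_order_irrefl
  by (simp add: irrefl_def)

lemma word_order_lex:
  assumes "(x, y) \<in> letter_order" "length r = length s"
  shows "(u @ x # r, u @ y # s) \<in> word_order"
  using assms letter_order_irrefl by (simp add: irrefl_def Cons_lenlex_iff)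

lemma keys_word_mult:
  assumes "FWord k \<in> Poly_Mapping.keys (word u * f * word v)"
  obtains k' where "k = u @ k' @ v" "FWord k' \<in> Poly_Mapping.keys f"
proof -
  obtain a b where ab: "FWord k = a + b" "a \<in> Poly_Mapping.keys (word u * f)" "b = FWord v"
    using assms keys_mult[of "word u * f" "word v"] by (auto simp: word_def)
  obtain c where c: "a = FWord u + c" "c \<in> Poly_Mapping.keys f"
    using ab(2) keys_mult[of "word u" f] by (auto simp: word_def)
  show thesis
    by (rule that[of "letters c"]) (use ab c in \<open>auto simp: plus_fword_def\<close>)
qed

lemma keys_expansion:
  assumes "FWord k \<in> Poly_Mapping.keys (expansion x)"
  obtains b where "k = [b]" "representation B x b \<noteq> 0" "b \<in> B"
proof -
  have "FWord k \<in> (\<Union>b\<in>{b. representation B x b \<noteq> 0}.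
      Poly_Mapping.keys (free_const (representation B x b) * \<iota> b))"
    using assms unfolding expansion_def by (rule set_mp[OF keys_sum])
  then obtain b where "representation B x b \<noteq> 0" "k = [b]"
    by (auto simp: free_const_def free_gen_def mult_single split: if_splits)
  then show thesis
    using that representation_ne_zero by blast
qed

lemma rule_decreasing:
  assumes "rule r f" "FWord k \<in> Poly_Mapping.keys f"
  shows "(k, r) \<in> word_order"
  using assms
proof cases
  case (swap x y)
  have "FWord k \<in> {FWord [x, y], FWord [bracket y x]}"
    using set_mp[OF keys_add assms(2)[unfolded swap]]
    by (auto simp: free_gen_def mult_single plus_fword_def)
  then show ?thesis
    using swap by (auto simp: lenlex_conv)
next
  case (power b)
  then have "k = [pmap b]"
    using assms(2) by (simp add: free_gen_def)
  then show ?thesis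
    using char_ge_2 power by (intro word_order_shorter) auto
next
  case (expand x)
  then obtain b where b: "k = [b]" "b \<in> B"
    using assms(2) keys_expansion by metis
  then have "(b, x) \<in> letter_order"
    using expand C_subset_B by (intro letter_order_rank) (auto simp: letter_rank_def)
  then show ?thesis
    using b expand by (simp add: lenlex_conv)
qed

lemma red_decreasing:
  assumes "red w f" "FWord k \<in> Poly_Mapping.keys f"
  shows "(k, w) \<in> word_order"
  using assms by cases (auto elim!: keys_word_mult intro: word_order_context rule_decreasing)

lemma reduction_invariantD:
  assumes "reduction_invariant red S \<tau>" "rule r f" "u @ r @ v \<in> S"
  shows "lin_ext \<tau> (word u * word r * word v) = lin_ext \<tau> (word u * f * word v)"
  using assms red.intros[OF assms(2), of u v]
  unfolding reduction_invariant_def by (simp flip: word_append)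

subsection \<open>Consequences of the relations below a length bound\<close>

text \<open>
  \<open>\<tau>\<close> extends linearly to a map that vanishes on \<open>u f v\<close> for all words \<open>u\<close>, \<open>v\<close> such that \<open>u f v\<close> has degree
  at most \<open>M\<close>, when \<open>f\<close> is given the degree \<open>n\<close>.  If \<open>\<tau>\<close> respects the rules for words of length at most \<open>M\<close>,
  then the relations of \<open>u(L)\<close> are null in this sense, for arbitrary elements of \<open>L\<close>; they may be used freely
  for the terms of an overlap that are shorter than the overlap itself.
\<close>
definition null :: "('a list \<Rightarrow> 'k poly) \<Rightarrow> nat \<Rightarrow> nat \<Rightarrow> ('a fword \<Rightarrow>\<^sub>0 'k) \<Rightarrow> bool" where
  "null \<tau> M n f \<longleftrightarrow> (\<forall>u v. length u + n + length v \<le> M \<longrightarrow> lin_ext \<tau> (word u * f * word v) = 0)"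

lemma null_zero: "null \<tau> M n 0"
  by (simp add: null_def)

lemma null_add: "null \<tau> M n f \<Longrightarrow> null \<tau> M n g \<Longrightarrow> null \<tau> M n (f + g)"
  by (simp add: null_def algebra_simps lin_ext_add)

lemma null_diff: "null \<tau> M n f \<Longrightarrow> null \<tau> M n g \<Longrightarrow> null \<tau> M n (f - g)"
  by (simp add: null_def algebra_simps lin_ext_diff)

lemma null_minus: "null \<tau> M n f \<Longrightarrow> null \<tau> M n (- f)"
  using null_diff[OF null_zero, of \<tau> M n f] by simp

lemma null_free_const:
  assumes "null \<tau> M n f"
  shows "null \<tau> M n (free_const c * f)"
proof -
  have "word u * (free_const c * f) * word v = free_const c * (word u * f * word v)" for u v
    by (simp add: free_const_left_commute mult.assoc)
  then show ?thesis
    using assms by (simp add: null_def lin_ext_free_const)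
qed

lemma null_mono: "null \<tau> M n f \<Longrightarrow> n \<le> m \<Longrightarrow> null \<tau> M m f"
  by (simp add: null_def)

lemma null_word_mult:
  assumes "null \<tau> M n f"
  shows "null \<tau> M (length a + n + length b) (word a * f * word b)"
proof -
  have "word u * (word a * f * word b) * word v = word (u @ a) * f * word (b @ v)" for u v
    by (simp add: word_append mult.assoc)
  then show ?thesis
    using assms unfolding null_def
    by (metis (no_types, lifting) add.assoc add.commute length_append)
qed

lemma null_gen_mult_left: "null \<tau> M n f \<Longrightarrow> null \<tau> M (Suc n) (\<iota> x * f)"
  using null_word_mult[of \<tau> M n f "[x]" "[]"] by (simp add: word_single word_Nil)

lemma null_gen_mult_right: "null \<tau> M n f \<Longrightarrow> null \<tau> M (Suc n) (f * \<iota> x)"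
  using null_word_mult[of \<tau> M n f "[]" "[x]"] by (simp add: word_single word_Nil)

context
  fixes \<tau> :: "'a list \<Rightarrow> 'k poly" and M :: nat
  assumes invariant: "reduction_invariant red {w. length w \<le> M} \<tau>"
begin

lemma null_rule:
  assumes "rule r f"
  shows "null \<tau> M (length r) (word r - f)"
  using reduction_invariantD[OF invariant assms]
  by (simp add: null_def algebra_simps lin_ext_diff)

lemma null_expansion: "null \<tau> M 1 (\<iota> x - expansion x)"
proof (cases "x \<in> B")
  case True
  then have "expansion x = \<iota> x"
    by (simp add: expansion_def representation_basis[OF independent_B] free_const_simps)
  then show ?thesis
    by (simp add: null_zero)
next
  case False
  then show ?thesis
    using null_rule[OF rule.expand[OF False]] by (simp add: word_single)
qed

lemma null_gen_add: "null \<tau> M 1 (\<iota> (x + y) - \<iota> x - \<iota> y)"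
proof -
  have "\<iota> (x + y) - \<iota> x - \<iota> y
      = (\<iota> (x + y) - expansion (x + y)) - (\<iota> x - expansion x) - (\<iota> y - expansion y)"
    by (simp add: expansion_add)
  then show ?thesis
    by (simp only: null_diff null_expansion)
qed

lemma null_gen_scale: "null \<tau> M 1 (\<iota> (c *s x) - free_const c * \<iota> x)"
proof -
  have "\<iota> (c *s x) - free_const c * \<iota> x
      = (\<iota> (c *s x) - expansion (c *s x)) - free_const c * (\<iota> x - expansion x)"
    by (simp add: expansion_scale right_diff_distrib)
  then show ?thesis
    by (simp only: null_diff null_expansion null_free_const)
qed

lemma null_gen_zero: "null \<tau> M 1 (\<iota> 0)"
  using null_gen_scale[of 0 0] by (simp add: free_const_simps)

lemma null_gen_minus: "null \<tau> M 1 (\<iota> (- x) + \<iota> x)"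
  using null_diff[OF null_gen_zero null_gen_add[of "- x" x]] by (simp add: algebra_simps)

text \<open>
  Both sides are bilinear, and modulo linearity in the letters the relation is antisymmetric; so it is
  enough to know it for \<open>x < y\<close> in the basis, where it is a rule.
\<close>
lemma null_bracket: "null \<tau> M 2 (commutator (\<iota> x) (\<iota> y) - \<iota> (bracket x y))"
proof -
  define D where "D x y = commutator (\<iota> x) (\<iota> y) - \<iota> (bracket x y)" for x y
  have mult: "null \<tau> M 2 (\<iota> z * f)" "null \<tau> M 2 (f * \<iota> z)" if "null \<tau> M 1 f" for z f
    using null_gen_mult_left[OF that] null_gen_mult_right[OF that] by (simp_all add: numeral_2_eq_2)
  have up: "null \<tau> M 2 f" if "null \<tau> M 1 f" for f
    using that by (rule null_mono) simp
  have "null \<tau> M 2 (D x y - (- D y x))" for x y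
  proof -
    have "D x y - (- D y x) = - (\<iota> (- bracket x y) + \<iota> (bracket x y)) "
      using bracket_anticommute[of y x] by (simp add: D_def commutator_def)
    then show ?thesis
      using up[OF null_minus[OF null_gen_minus]] by simp
  qed
  then have anti: "null \<tau> M 2 (D x y)" if "null \<tau> M 2 (D y x)" for x y
    using null_add[OF _ null_minus[OF that], of "D x y - (- D y x)"] by simp
  have sub: "subspace {x. null \<tau> M 2 (D x y)}" for y
  proof (rule subspaceI)
    have "D 0 y = \<iota> 0 * \<iota> y - \<iota> y * \<iota> 0 - \<iota> 0"
      using bracket_scale_left[of 0 0 y] by (simp add: D_def commutator_def)
    then show "0 \<in> {x. null \<tau> M 2 (D x y)}"
      by (simp only: mem_Collect_eq null_diff mult up null_gen_zero)
    fix x assume x: "x \<in> {x. null \<tau> M 2 (D x y)}"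
    have "D (c *s x) y = free_const c * D x y
        + ((\<iota> (c *s x) - free_const c * \<iota> x) * \<iota> y - \<iota> y * (\<iota> (c *s x) - free_const c * \<iota> x)
        - (\<iota> (c *s bracket x y) - free_const c * \<iota> (bracket x y)))" for c
      by (simp add: D_def commutator_def bracket_scale_left algebra_simps free_const_left_commute)
    then show "c *s x \<in> {x. null \<tau> M 2 (D x y)}" for c
      using x by (simp only: mem_Collect_eq null_add null_diff null_free_const mult up null_gen_scale)
    fix z assume z: "z \<in> {x. null \<tau> M 2 (D x y)}"
    have "D (x + z) y = D x y + D z y
        + ((\<iota> (x + z) - \<iota> x - \<iota> z) * \<iota> y - \<iota> y * (\<iota> (x + z) - \<iota> x - \<iota> z)
        - (\<iota> (bracket x y + bracket z y) - \<iota> (bracket x y) - \<iota> (bracket z y)))"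
      by (simp add: D_def commutator_def bracket_add_left algebra_simps)
    then show "x + z \<in> {x. null \<tau> M 2 (D x y)}"
      using x z by (simp only: mem_Collect_eq null_add null_diff mult up null_gen_add)
  qed
  have less: "null \<tau> M 2 (D y x)" if "x \<in> B" "y \<in> B" "(x, y) \<in> letter_order" for x y
    using null_rule[OF rule.swap[OF that]]
    by (simp add: word_Cons word_Nil D_def commutator_def algebra_simps numeral_2_eq_2)
  have basis: "null \<tau> M 2 (D x y)" if "x \<in> B" "y \<in> B" for x y
  proof (cases "x = y")
    case True
    then show ?thesis
      using null_minus[OF up[OF null_gen_zero]] by (simp add: D_def commutator_def bracket_self)
  next
    case False
    then show ?thesis
      using letter_order_total[OF False] less that anti by blast
  qed
  have "null \<tau> M 2 (D x y)" if "y \<in> B" for x y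
    using span_induct[of x B "\<lambda>x. null \<tau> M 2 (D x y)"] sub basis that by (simp add: span_B)
  then have "null \<tau> M 2 (D x y)"
    using span_induct[of y B "\<lambda>y. null \<tau> M 2 (D y x)"] sub anti by (simp add: span_B)
  then show ?thesis
    by (simp add: D_def)
qed

lemma null_bracket_funpow:
  "null \<tau> M (Suc n) ((commutator (\<iota> x) ^^ n) (\<iota> z) - \<iota> ((bracket x ^^ n) z))"
proof (induction n)
  case 0
  then show ?case
    by (simp add: null_zero)
next
  case (Suc n)
  define f where "f = (commutator (\<iota> x) ^^ n) (\<iota> z) - \<iota> ((bracket x ^^ n) z)"
  have "(commutator (\<iota> x) ^^ Suc n) (\<iota> z) - \<iota> ((bracket x ^^ Suc n) z)
      = \<iota> x * f - f * \<iota> x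
        + (commutator (\<iota> x) (\<iota> ((bracket x ^^ n) z)) - \<iota> (bracket x ((bracket x ^^ n) z)))"
    by (simp add: f_def commutator_def algebra_simps)
  moreover have "null \<tau> M (Suc n) f"
    using Suc by (simp add: f_def)
  ultimately show ?case
    using null_mono[OF null_bracket, of "Suc (Suc n)"]
    by (simp only: null_add null_diff null_gen_mult_left null_gen_mult_right)
qed

text \<open>
  The relation behind the overlaps \<open>y x\<^sup>p\<close> and \<open>y\<^sup>p x\<close>: the commutators that arise when a letter is moved
  past a \<open>p\<close>-th power add up to an iterated bracket.
\<close>
lemma null_power_sum:
  "null \<tau> M CHAR('k) ((\<Sum>i<CHAR('k). \<iota> x ^ i * \<iota> z * \<iota> x ^ (CHAR('k) - Suc i))
     - \<iota> ((bracket x ^^ (CHAR('k) - 1)) z))"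
  using null_bracket_funpow[of "CHAR('k) - 1" x z] char_pos
  unfolding commutator_funpow_prime_minus_one[OF prime_char free_algebra_char] by simp

end

subsection \<open>Confluence\<close>

lemma solve_for_subtrahend:
  fixes a b c s z :: "'g::ab_group_add"
  assumes "a - b + s = a - c - z"
  shows "b = c + s + z"
proof -
  have "a - b = a - c - z - s"
    using assms by (simp only: eq_diff_eq)
  then have "a - (a - b) = a - (a - c - z - s)"
    by (simp only:)
  then show ?thesis
    by (simp add: algebra_simps)
qed

context
  fixes \<tau> :: "'a list \<Rightarrow> 'k poly" and w u v :: "'a list"
  assumes invariant: "reduction_invariant red {t. (t, w) \<in> word_order} \<tau>"
begin

abbreviation (input) val :: "('a fword \<Rightarrow>\<^sub>0 'k) \<Rightarrow> 'k poly" where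
  "val f \<equiv> lin_ext \<tau> (word u * f * word v)"

lemma val_add: "val (f + g) = val f + val g"
  by (simp add: algebra_simps lin_ext_add)

lemma val_diff: "val (f - g) = val f - val g"
  by (simp add: algebra_simps lin_ext_diff)

lemma val_eqI: "val (f - g) = 0 \<Longrightarrow> val f = val g"
  by (simp add: val_diff)

lemma invariant_below_length: "M < length w \<Longrightarrow> reduction_invariant red {t. length t \<le> M} \<tau>"
  using invariant word_order_shorter unfolding reduction_invariant_def by fastforce

lemma val_null:
  assumes "null \<tau> M n f" "length u + n + length v \<le> M"
  shows "val f = 0"
  using assms by (simp add: null_def)

lemma val_rule:
  assumes "rule r f" "(u @ a @ r @ b @ v, w) \<in> word_order"
  shows "val (word a * (word r - f) * word b) = 0"
  using reduction_invariantD[OF invariant assms(1), of "u @ a" "b @ v"] assms(2)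
  by (simp add: word_append mult.assoc algebra_simps lin_ext_diff)

text \<open>
  Both reductions are brought to \<open>x y z\<close>.  The difference of the shorter terms is a sum of three
  commutators, which become double brackets whose sum vanishes by the Jacobi identity.
\<close>
lemma confluent_swap_swap:
  assumes w: "w = u @ [z, y, x] @ v" and B: "x \<in> B" "y \<in> B" "z \<in> B"
    and less: "(x, y) \<in> letter_order" "(y, z) \<in> letter_order"
  shows "val ((\<iota> y * \<iota> z + \<iota> (bracket z y)) * \<iota> x) = val (\<iota> z * (\<iota> x * \<iota> y + \<iota> (bracket y x)))"
proof -
  define M where "M = length u + 2 + length v"
  note inv = invariant_below_length[of M]
  have M: "M < length w"
    by (simp add: M_def w)
  have xz: "(x, z) \<in> letter_order"
    using less letter_order_trans by blast
  define R where "R a b = word [a, b] - (\<iota> b * \<iota> a + \<iota> (bracket a b))" for a b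
  have R: "R a b = \<iota> a * \<iota> b - \<iota> b * \<iota> a - \<iota> (bracket a b)" for a b
    by (simp add: R_def word_Cons word_Nil algebra_simps)
  have r1: "val (\<iota> y * R z x) = 0"
    using val_rule[OF rule.swap[OF B(1,3) xz], of "[y]" "[]"] less(2)
    by (simp add: R_def w word_order_lex word_single word_Nil)
  have r2: "val (R y x * \<iota> z) = 0"
    using val_rule[OF rule.swap[OF B(1,2) less(1)], of "[]" "[z]"] less(2)
    by (simp add: R_def w word_order_lex word_single word_Nil)
  have r3: "val (R z x * \<iota> y) = 0"
    using val_rule[OF rule.swap[OF B(1,3) xz], of "[]" "[y]"]
      word_order_lex[OF less(1), of "y # v" "x # v" "u @ [z]"]
    by (simp add: R_def w word_single word_Nil)
  have r4: "val (\<iota> x * R z y) = 0"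
    using val_rule[OF rule.swap[OF B(2,3) less(2)], of "[x]" "[]"] xz
    by (simp add: R_def w word_order_lex word_single word_Nil)
  define N where "N a b = commutator (\<iota> a) (\<iota> b) - \<iota> (bracket a b)" for a b
  define S where "S = \<iota> (bracket (bracket y x) z) + \<iota> (bracket y (bracket z x)) + \<iota> (bracket (bracket z y) x)"
  have "val (N a b) = 0" for a b
    unfolding N_def by (rule val_null[OF null_bracket[OF inv[OF M]]]) (simp add: M_def)
  moreover have "val S = 0"
  proof (rule val_null)
    have "bracket (bracket y x) z + bracket y (bracket z x) + bracket (bracket z y) x = 0"
      using jacobi[of x y z] bracket_anticommute[of "bracket y x" z] bracket_anticommute[of y x]
        bracket_anticommute[of "bracket z y" x] bracket_anticommute[of z y]
      by (simp add: bracket_minus_right algebra_simps)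
    then have "S = \<iota> 0
        - (\<iota> (bracket (bracket y x) z + bracket y (bracket z x) + bracket (bracket z y) x)
           - \<iota> (bracket (bracket y x) z + bracket y (bracket z x)) - \<iota> (bracket (bracket z y) x))
        - (\<iota> (bracket (bracket y x) z + bracket y (bracket z x))
           - \<iota> (bracket (bracket y x) z) - \<iota> (bracket y (bracket z x)))"
      by (simp add: S_def)
    then show "null \<tau> M 1 S"
      using null_gen_add[OF inv[OF M]] null_gen_zero[OF inv[OF M]] by (simp only: null_diff)
  qed (simp add: M_def)
  moreover have "(\<iota> y * \<iota> z + \<iota> (bracket z y)) * \<iota> x - \<iota> z * (\<iota> x * \<iota> y + \<iota> (bracket y x))
      = \<iota> y * R z x + R y x * \<iota> z - R z x * \<iota> y - \<iota> x * R z y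
        + (N (bracket y x) z + N y (bracket z x) + N (bracket z y) x) + S"
    unfolding R N_def S_def commutator_def by (simp add: algebra_simps)
  ultimately show ?thesis
    by (intro val_eqI) (simp only: val_add val_diff r1 r2 r3 r4 add_0 diff_0 minus_zero diff_zero)
qed

text \<open>
  Swapping first, \<open>y\<close> is moved to the right past all letters \<open>x\<close>; this passes through words
  \<open>x\<^sup>i y x\<^bsup>p-i\<^esup>\<close> with \<open>i \<ge> 1\<close>, which are smaller than \<open>y x\<^sup>p\<close>, and ends with \<open>x\<^sup>p y\<close>, where the power rule
  applies.
\<close>
lemma confluent_swap_power:
  assumes w: "w = u @ (y # replicate CHAR('k) x) @ v" and B: "x \<in> B" "y \<in> B"
    and less: "(x, y) \<in> letter_order"
  shows "val ((\<iota> x * \<iota> y + \<iota> (bracket y x)) * \<iota> x ^ (CHAR('k) - 1)) = val (\<iota> y * \<iota> (pmap x))"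
proof -
  define M where "M = length u + CHAR('k) + length v"
  note inv = invariant_below_length[of M]
  have M: "M < length w"
    by (simp add: M_def w)
  obtain q where q: "CHAR('k) = Suc q"
    using char_pos by (cases "CHAR('k)") auto
  define z where "z = bracket y x"
  \<comment> \<open>\<open>Q i\<close> moves \<open>y\<close> past the letter \<open>x\<close> with number \<open>i\<close>; \<open>Q 0\<close> starts at the overlap itself,
    the other ones at smaller words\<close>
  define Q where "Q i = \<iota> x ^ i * (\<iota> y * \<iota> x - (\<iota> x * \<iota> y + \<iota> z)) * \<iota> x ^ (q - i)" for i
  have Q: "val (Q (Suc i)) = 0" if "i < q" for i
  proof -
    have "(u @ replicate (Suc i) x @ [y, x] @ replicate (q - Suc i) x @ v, w) \<in> word_order"
      using that by (simp add: w q word_order_lex less)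
    from val_rule[OF rule.swap[OF B less] this] show ?thesis
      by (simp add: Q_def z_def word_replicate word_Cons word_Nil mult.assoc)
  qed
  have P: "val ((\<iota> x ^ CHAR('k) - \<iota> (pmap x)) * \<iota> y) = 0"
  proof -
    have "(u @ [] @ replicate CHAR('k) x @ [y] @ v, w) \<in> word_order"
      by (simp add: w q word_order_lex less)
    from val_rule[OF rule.power[OF B(1)] this] show ?thesis
      by (simp add: word_replicate word_single word_Nil)
  qed
  let ?Z = "\<Sum>i<CHAR('k). \<iota> x ^ i * \<iota> z * \<iota> x ^ (CHAR('k) - Suc i)"
  have Z: "val (?Z - \<iota> ((bracket x ^^ (CHAR('k) - 1)) z)) = 0"
    by (rule val_null[OF null_power_sum[OF inv[OF M]]]) (simp add: M_def)
  have "(bracket x ^^ (CHAR('k) - 1)) z = bracket y (pmap x)"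
    unfolding z_def bracket_anticommute[of y x] bracket_funpow_minus bracket_funpow_char
    by (simp add: bracket_anticommute[of y "pmap x"])
  then have Z': "val (commutator (\<iota> y) (\<iota> (pmap x)) - \<iota> ((bracket x ^^ (CHAR('k) - 1)) z)) = 0"
    using val_null[OF null_bracket[OF inv[OF M]], of y "pmap x"] char_ge_2 by (simp add: M_def)
  have telescope: "(\<Sum>i<CHAR('k). Q i) = \<iota> y * \<iota> x ^ CHAR('k) - \<iota> x ^ CHAR('k) * \<iota> y - ?Z"
  proof -
    have "Q i = - (\<iota> x ^ i * commutator (\<iota> x) (\<iota> y) * \<iota> x ^ (CHAR('k) - Suc i))
        - \<iota> x ^ i * \<iota> z * \<iota> x ^ (CHAR('k) - Suc i)" for i
      by (simp add: Q_def q commutator_def algebra_simps)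
    then show ?thesis
      by (simp only: sum_subtractf sum_negf commutator_power_telescope[symmetric]) simp
  qed
  have "(\<iota> x * \<iota> y + \<iota> z) * \<iota> x ^ (CHAR('k) - 1)
      = \<iota> x ^ CHAR('k) * \<iota> y + (\<Sum>i<q. Q (Suc i)) + ?Z"
  proof -
    have "Q 0 = \<iota> y * \<iota> x ^ CHAR('k) - (\<iota> x * \<iota> y + \<iota> z) * \<iota> x ^ (CHAR('k) - 1)"
      by (simp add: Q_def q left_diff_distrib mult.assoc)
    moreover have "Q 0 + (\<Sum>i<q. Q (Suc i)) = \<iota> y * \<iota> x ^ CHAR('k) - \<iota> x ^ CHAR('k) * \<iota> y - ?Z"
      using telescope unfolding q sum.lessThan_Suc_shift .
    ultimately show ?thesis
      by (intro solve_for_subtrahend) (simp only:)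
  qed
  then have "(\<iota> x * \<iota> y + \<iota> z) * \<iota> x ^ (CHAR('k) - 1) - \<iota> y * \<iota> (pmap x)
     = (\<iota> x ^ CHAR('k) - \<iota> (pmap x)) * \<iota> y + (\<Sum>i<q. Q (Suc i))
       + (?Z - \<iota> ((bracket x ^^ (CHAR('k) - 1)) z))
       - (commutator (\<iota> y) (\<iota> (pmap x)) - \<iota> ((bracket x ^^ (CHAR('k) - 1)) z))"
    by (simp only: commutator_def left_diff_distrib) simp
  moreover have "val (\<Sum>i<q. Q (Suc i)) = 0"
    using Q by (simp add: sum_distrib_left sum_distrib_right lin_ext_sum)
  ultimately have "val ((\<iota> x * \<iota> y + \<iota> z) * \<iota> x ^ (CHAR('k) - 1) - \<iota> y * \<iota> (pmap x)) = 0"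
    using P Z Z' by (simp only: val_add val_diff add_0 diff_0 minus_zero diff_zero)
  then show ?thesis
    unfolding z_def by (rule val_eqI)
qed

text \<open>
  The mirror image of the preceding overlap: \<open>x\<close> is moved to the left.
\<close>
lemma confluent_power_swap:
  assumes w: "w = u @ (replicate CHAR('k) y @ [x]) @ v" and B: "x \<in> B" "y \<in> B"
    and less: "(x, y) \<in> letter_order"
  shows "val (\<iota> (pmap y) * \<iota> x) = val (\<iota> y ^ (CHAR('k) - 1) * (\<iota> x * \<iota> y + \<iota> (bracket y x)))"
proof -
  define M where "M = length u + CHAR('k) + length v"
  note inv = invariant_below_length[of M]
  have M: "M < length w"
    by (simp add: M_def w)
  obtain q where q: "CHAR('k) = Suc q"
    using char_pos by (cases "CHAR('k)") auto
  define z where "z = bracket y x"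
  \<comment> \<open>here \<open>Q q\<close> starts at the overlap itself, and the \<open>Q i\<close> with \<open>i < q\<close> at smaller words\<close>
  define Q where "Q i = \<iota> y ^ i * (\<iota> y * \<iota> x - (\<iota> x * \<iota> y + \<iota> z)) * \<iota> y ^ (q - i)" for i
  have Q: "val (Q i) = 0" if i: "i < q" for i
  proof -
    obtain j where j: "q - i = Suc j"
      using i by (cases "q - i") auto
    have "replicate CHAR('k) y = replicate (Suc i) y @ y # replicate j y"
    proof -
      have "CHAR('k) = Suc i + Suc j"
        using j q by linarith
      then show ?thesis
        by (simp only: replicate_add replicate_Suc)
    qed
    then have "w = (u @ replicate (Suc i) y) @ y # (replicate j y @ x # v)"
      by (simp add: w)
    moreover have "(u @ replicate i y @ [y, x] @ replicate (q - i) y @ v)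
        = (u @ replicate (Suc i) y) @ x # (replicate (Suc j) y @ v)"
      by (simp add: j replicate_app_Cons_same)
    ultimately have "(u @ replicate i y @ [y, x] @ replicate (q - i) y @ v, w) \<in> word_order"
      by (simp only:) (rule word_order_lex[OF less], simp)
    from val_rule[OF rule.swap[OF B less] this] show ?thesis
      by (simp add: Q_def z_def word_replicate word_Cons word_Nil mult.assoc)
  qed
  have P: "val (\<iota> x * (\<iota> y ^ CHAR('k) - \<iota> (pmap y))) = 0"
  proof -
    have "(u @ [x] @ replicate CHAR('k) y @ [] @ v, w) \<in> word_order"
      by (simp add: w q word_order_lex less)
    from val_rule[OF rule.power[OF B(2)] this] show ?thesis
      by (simp add: word_replicate word_single word_Nil)
  qed
  let ?Z = "\<Sum>i<CHAR('k). \<iota> y ^ i * \<iota> z * \<iota> y ^ (CHAR('k) - Suc i)"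
  have Z: "val (?Z - \<iota> ((bracket y ^^ (CHAR('k) - 1)) z)) = 0"
    by (rule val_null[OF null_power_sum[OF inv[OF M]]]) (simp add: M_def)
  have Z': "val (commutator (\<iota> (pmap y)) (\<iota> x) - \<iota> ((bracket y ^^ (CHAR('k) - 1)) z)) = 0"
    using val_null[OF null_bracket[OF inv[OF M]], of "pmap y" x] char_ge_2
    by (simp add: M_def z_def bracket_funpow_char[simplified])
  have telescope: "(\<Sum>i<CHAR('k). Q i) = \<iota> y ^ CHAR('k) * \<iota> x - \<iota> x * \<iota> y ^ CHAR('k) - ?Z"
  proof -
    have "Q i = \<iota> y ^ i * commutator (\<iota> y) (\<iota> x) * \<iota> y ^ (CHAR('k) - Suc i)
        - \<iota> y ^ i * \<iota> z * \<iota> y ^ (CHAR('k) - Suc i)" for i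
      by (simp add: Q_def q commutator_def algebra_simps)
    then show ?thesis
      by (simp only: sum_subtractf commutator_power_telescope)
  qed
  have "\<iota> y ^ (CHAR('k) - 1) * (\<iota> x * \<iota> y + \<iota> z)
      = \<iota> x * \<iota> y ^ CHAR('k) + (\<Sum>i<q. Q i) + ?Z"
  proof -
    have Qq: "Q q = \<iota> y ^ CHAR('k) * \<iota> x - \<iota> y ^ (CHAR('k) - 1) * (\<iota> x * \<iota> y + \<iota> z)"
      by (simp add: Q_def q right_diff_distrib power_commutes flip: mult.assoc)
    have "(\<Sum>i<q. Q i) + Q q = \<iota> y ^ CHAR('k) * \<iota> x - \<iota> x * \<iota> y ^ CHAR('k) - ?Z"
      using telescope unfolding q sum.lessThan_Suc .
    then have "Q q + (\<Sum>i<q. Q i) = \<iota> y ^ CHAR('k) * \<iota> x - \<iota> x * \<iota> y ^ CHAR('k) - ?Z"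
      by (simp only: add.commute)
    with Qq show ?thesis
      by (intro solve_for_subtrahend) (simp only:)
  qed
  then have "\<iota> (pmap y) * \<iota> x - \<iota> y ^ (CHAR('k) - 1) * (\<iota> x * \<iota> y + \<iota> z)
     = (commutator (\<iota> (pmap y)) (\<iota> x) - \<iota> ((bracket y ^^ (CHAR('k) - 1)) z))
       - (?Z - \<iota> ((bracket y ^^ (CHAR('k) - 1)) z))
       - (\<Sum>i<q. Q i) - \<iota> x * (\<iota> y ^ CHAR('k) - \<iota> (pmap y))"
    by (simp only: commutator_def right_diff_distrib) simp
  moreover have "val (\<Sum>i<q. Q i) = 0"
    using Q by (simp add: sum_distrib_left sum_distrib_right lin_ext_sum)
  ultimately have "val (\<iota> (pmap y) * \<iota> x - \<iota> y ^ (CHAR('k) - 1) * (\<iota> x * \<iota> y + \<iota> z)) = 0"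
    using P Z Z' by (simp only: val_add val_diff add_0 diff_0 minus_zero diff_zero)
  then show ?thesis
    unfolding z_def by (rule val_eqI)
qed

text \<open>
  Here the overlap is resolved by \<open>[x, x\<^bsup>[p]\<^esup>] = ad(x)\<^sup>p (x) = 0\<close>.
\<close>
lemma confluent_power_power:
  assumes w: "w = u @ replicate (CHAR('k) + j) x @ v" and j: "j < CHAR('k)"
  shows "val (\<iota> (pmap x) * \<iota> x ^ j) = val (\<iota> x ^ j * \<iota> (pmap x))"
proof (cases "j = 0")
  case False
  define M where "M = length u + Suc j + length v"
  have M: "M < length w"
    using char_ge_2 by (simp add: M_def w)
  note inv = invariant_below_length[OF M]
  have "bracket (pmap x) x = 0"
  proof -
    obtain q where q: "CHAR('k) = Suc q"
      using char_pos by (cases "CHAR('k)") auto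
    have "(bracket x ^^ n) 0 = 0" for n
      by (induction n) simp_all
    then show ?thesis
      unfolding bracket_pmap q funpow_Suc_right o_apply bracket_self by simp
  qed
  then have "bracket x (pmap x) = 0"
    using bracket_anticommute[of x "pmap x"] by simp
  then have c: "null \<tau> M 2 (commutator (\<iota> x) (\<iota> (pmap x)))"
    using null_add[OF null_bracket[OF inv, of x "pmap x"] null_mono[OF null_gen_zero[OF inv], of 2]]
    by simp
  have "val (\<iota> x ^ i * commutator (\<iota> x) (\<iota> (pmap x)) * \<iota> x ^ (j - Suc i)) = 0" if "i < j" for i
    using null_word_mult[OF c, of "replicate i x" "replicate (j - Suc i) x"] that
    by (intro val_null) (auto simp: word_replicate M_def)
  then have "val (\<iota> x ^ j * \<iota> (pmap x) - \<iota> (pmap x) * \<iota> x ^ j) = 0"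
    unfolding commutator_power_telescope
    by (simp add: sum_distrib_left sum_distrib_right lin_ext_sum)
  then show ?thesis
    by (rule val_eqI[symmetric])
qed simp

end

text \<open>
  No left-hand side is contained in a different one: no letter is smaller than itself, \<open>p \<ge> 2\<close>, and letters
  outside the basis occur in expansions only.  So two left-hand sides in a common word are equal, or
  overlap in one of the four ways above, or are disjoint.
\<close>
lemma confluent_overlap:
  assumes r: "rule r f" "rule s g" and d: "r @ v = d @ s @ v'" "length d < length r"
    and invariant: "reduction_invariant red {t. (t, u @ r @ v) \<in> word_order} \<tau>"
  shows "lin_ext \<tau> (word u * f * word v) = lin_ext \<tau> (word (u @ d) * g * word v')"
  using r(1)
proof cases
  case (expand x)
  then have d_Nil: "d = []"
    using d(2) by simp
  from r(2) show ?thesis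
  proof cases
    case (power b)
    obtain q where "CHAR('k) = Suc q"
      using char_pos by (cases "CHAR('k)") auto
    then show ?thesis
      using d expand power d_Nil by auto
  qed (use d expand d_Nil in auto)
next
  case (swap x y)
  note swap1 = this
  consider "d = []" | "d = [y]"
    using d swap by (cases d) auto
  then show ?thesis
  proof cases
    case 1
    from r(2) show ?thesis
    proof cases
      case (power b)
      obtain q where "CHAR('k) = Suc (Suc q)"
        using char_ge_2 by (metis Suc_le_D numeral_2_eq_2 Suc_le_mono)
      then show ?thesis
        using d swap1 power 1 letter_order_irrefl by auto
    qed (use d swap1 1 in auto)
  next
    case 2
    from r(2) show ?thesis
    proof cases
      case (swap x' y')
      then have "y' = x" "v = x' # v'"
        using d swap1 2 by auto
      then show ?thesis
        using confluent_swap_swap[OF invariant, where u = u and v = v' and x = x' and y = x and z = y]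
          swap1 swap 2
        by (simp add: word_append word_Cons word_Nil mult.assoc)
    next
      case (power b)
      obtain q where q: "CHAR('k) = Suc q"
        using char_pos by (cases "CHAR('k)") auto
      have "b = x" "v = replicate q x @ v'"
        using d swap1 2 power q by auto
      then show ?thesis
        using confluent_swap_power[OF invariant, where u = u and v = v' and x = x and y = y]
          swap1 power 2 q
        by (simp add: word_append word_Cons word_Nil mult.assoc word_replicate)
    qed (use d swap1 2 in auto)
  qed
next
  case (power y)
  note power1 = this
  define j where "j = length d"
  have j: "j < CHAR('k)"
    using d(2) power by (simp add: j_def)
  have dj: "d = replicate j y" and rest: "replicate (CHAR('k) - j) y @ v = s @ v'"
  proof -
    have "r = replicate j y @ replicate (CHAR('k) - j) y"
      using power j by (simp flip: replicate_add)
    then show "d = replicate j y" "replicate (CHAR('k) - j) y @ v = s @ v'"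
      using d(1) by (simp_all add: j_def append_eq_append_conv)
  qed
  obtain k where k: "CHAR('k) - j = Suc k"
    using j by (cases "CHAR('k) - j") auto
  from r(2) show ?thesis
  proof cases
    case (swap x y')
    then have "y' = y" and "replicate k y @ v = x # v'"
      using rest k by auto
    moreover have "x \<noteq> y"
      using swap calculation letter_order_irrefl by blast
    ultimately have "k = 0" "v = x # v'"
      by (cases k; simp)+
    then have "j = CHAR('k) - 1"
      using k by simp
    then show ?thesis
      using confluent_power_swap[OF invariant, where u = u and v = v' and x = x and y = y]
        power1 swap \<open>v = x # v'\<close> \<open>y' = y\<close> dj
      by (simp add: word_append word_Cons word_Nil mult.assoc word_replicate)
  next
    case (power b)
    obtain q where q: "CHAR('k) = Suc q"
      using char_pos by (cases "CHAR('k)") auto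
    have "b = y"
      using rest k power q by auto
    have "replicate CHAR('k) y = replicate (CHAR('k) - j) y @ replicate j y"
      using j by (simp flip: replicate_add)
    then have v: "v = replicate j y @ v'"
      using rest power \<open>b = y\<close> by simp
    show ?thesis
      using confluent_power_power[OF invariant, where u = u and v = v' and x = y and j = j]
        j v power1 power \<open>b = y\<close> dj
      by (simp add: word_append mult.assoc word_replicate replicate_add)
  next
    case (expand x)
    then show ?thesis
      using rest k power1 by auto
  qed
qed

text \<open>
  If the left-hand sides are disjoint, each of the two steps can still be made after the other one,
  at words that are smaller than the given one.
\<close>
lemma confluent_ordered:
  assumes r: "rule r f" "rule s g" and w: "u @ r @ v = u' @ s @ v'" "length u \<le> length u'"
    and invariant: "reduction_invariant red {t. (t, u @ r @ v) \<in> word_order} \<tau>"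
  shows "lin_ext \<tau> (word u * f * word v) = lin_ext \<tau> (word u' * g * word v')"
proof -
  obtain d where u': "u' = u @ d"
    using w by (metis append_eq_append_conv_if append_eq_conv_conj append_take_drop_id)
  then have d: "r @ v = d @ s @ v'"
    using w(1) by simp
  show ?thesis
  proof (cases "length d < length r")
    case True
    show ?thesis
      unfolding u' by (rule confluent_overlap[OF r d True invariant])
  next
    case False
    then have "take (length r) d = r"
      using arg_cong[OF d, of "take (length r)"] by simp
    then obtain m where dm: "d = r @ m"
      by (metis append_take_drop_id)
    then have v: "v = m @ s @ v'"
      using d by simp
    have below: "u @ k @ v \<in> {t. (t, u @ r @ v) \<in> word_order}" if "FWord k \<in> Poly_Mapping.keys f" for k
      using word_order_context[OF rule_decreasing[OF r(1) that]] by simp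
    have below': "u @ r @ m @ k @ v' \<in> {t. (t, u @ r @ v) \<in> word_order}"
      if "FWord k \<in> Poly_Mapping.keys g" for k
      using word_order_context[OF rule_decreasing[OF r(2) that], of "u @ r @ m" v'] by (simp add: v)
    have "lin_ext \<tau> (word u * f * word v) = lin_ext \<tau> (word u * f * (word m * g * word v'))"
    proof (rule lin_ext_cong_sandwich)
      fix k assume "FWord k \<in> Poly_Mapping.keys f"
      then show "lin_ext \<tau> (word u * word k * word v) = lin_ext \<tau> (word u * word k * (word m * g * word v'))"
        using reduction_invariantD[OF invariant r(2), of "u @ k @ m" v'] below[of k]
        by (simp add: v word_append mult.assoc)
    qed
    also have "\<dots> = lin_ext \<tau> ((word u * f * word m) * g * word v')"
      by (simp add: mult.assoc)
    also have "\<dots> = lin_ext \<tau> ((word u * word r * word m) * g * word v')"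
    proof (rule lin_ext_cong_sandwich)
      fix k assume "FWord k \<in> Poly_Mapping.keys g"
      then show "lin_ext \<tau> ((word u * f * word m) * word k * word v')
          = lin_ext \<tau> ((word u * word r * word m) * word k * word v')"
        using reduction_invariantD[OF invariant r(1), of u "m @ k @ v'"] below'[of k]
        by (simp add: word_append mult.assoc)
    qed
    finally show ?thesis
      by (simp add: u' dm word_append mult.assoc)
  qed
qed

lemma red_confluent:
  assumes "red w f" "red w g" and invariant: "reduction_invariant red {t. (t, w) \<in> word_order} \<tau>"
  shows "lin_ext \<tau> f = lin_ext \<tau> g"
proof -
  obtain u r v f' where 1: "w = u @ r @ v" "f = word u * f' * word v" "rule r f'"
    using assms(1) by cases auto
  obtain u' s v' g' where 2: "w = u' @ s @ v'" "g = word u' * g' * word v'" "rule s g'"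
    using assms(2) by cases auto
  show ?thesis
  proof (cases "length u \<le> length u'")
    case True
    then show ?thesis
      using confluent_ordered[OF 1(3) 2(3) _ True, of v v' \<tau>] 1 2 invariant by simp
  next
    case False
    then show ?thesis
      using confluent_ordered[OF 2(3) 1(3), of u' v' u v \<tau>] 1 2 invariant by simp
  qed
qed

section \<open>Functionals that are equivariant for a subalgebra\<close>

definition irreducible_word :: "'a list \<Rightarrow> bool" where
  "irreducible_word w \<longleftrightarrow> (\<nexists>f. red w f)"

lemma rule_irreducible:
  assumes "rule r f" "irreducible_word (u @ r @ v)"
  shows False
  using assms red.intros[OF assms(1)] by (auto simp: irreducible_word_def)

lemma irreducible_word_infix:
  assumes "irreducible_word (a @ w @ b)"
  shows "irreducible_word w"
  unfolding irreducible_word_def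
proof
  assume "\<exists>f. red w f"
  then obtain u r v f where "w = u @ r @ v" "rule r f"
    by (auto elim: red.cases)
  then show False
    using rule_irreducible[of r f "a @ u" "v @ b"] assms by simp
qed

lemma irreducible_word_letters:
  assumes "irreducible_word w"
  shows "set w \<subseteq> B"
proof
  fix x assume "x \<in> set w"
  then obtain u v where "w = u @ [x] @ v"
    by (metis append_Cons append_Nil split_list)
  then show "x \<in> B"
    using rule_irreducible[OF rule.expand] assms by blast
qed

lemma letters_C:
  assumes "x \<in> B" "x \<in> span C"
  shows "x \<in> C"
proof (rule ccontr)
  assume "x \<notin> C"
  then have "span C \<subseteq> span (B - {x})"
    using C_subset_B by (intro span_mono) auto
  then show False
    using assms independent_B by (auto simp: dependent_def)
qed

lemma irreducible_word_tail:
  assumes "irreducible_word (c # t)" "c \<in> C"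
  shows "set t \<subseteq> C"
  using assms
proof (induction t arbitrary: c)
  case Nil
  then show ?case by simp
next
  case (Cons d t)
  have cd: "c \<in> B" "d \<in> B"
    using irreducible_word_letters[OF Cons.prems(1)] by auto
  have "d \<in> C"
  proof (rule ccontr)
    assume "d \<notin> C"
    then have "(d, c) \<in> letter_order"
      using Cons.prems(2) cd by (intro letter_order_rank) (simp add: letter_rank_def)
    then show False
      using rule_irreducible[OF rule.swap[OF cd(2,1)], of "[]" t] Cons.prems(1) by simp
  qed
  moreover have "irreducible_word (d # t)"
    using irreducible_word_infix[of "[c]" "d # t" "[]"] Cons.prems(1) by simp
  ultimately show ?case
    using Cons.IH by simp
qed

lemma rule_split:
  assumes "rule (r @ s) f" "y \<in> set r" "x \<in> set s"
  shows "x = y \<or> (x, y) \<in> letter_order"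
  using assms(1)
proof cases
  case (swap x' y')
  then have "r = [y'] \<and> s = [x']"
    using assms(2,3) by (cases r; cases "tl r"; cases s) auto
  then show ?thesis
    using swap assms by auto
next
  case (power b)
  then have "set (r @ s) \<subseteq> {b}"
    by (metis set_replicate_conv_if empty_subsetI order_refl)
  then show ?thesis
    using assms by auto
next
  case (expand x')
  then show ?thesis
    using assms by (cases r) auto
qed

lemma irreducible_word_append:
  assumes e: "irreducible_word e" "set e \<subseteq> B - C" and w: "irreducible_word w" "set w \<subseteq> C"
  shows "irreducible_word (e @ w)"
  unfolding irreducible_word_def
proof
  assume "\<exists>f. red (e @ w) f"
  then obtain u r v f where urv: "e @ w = u @ r @ v" and r: "rule r f"
    by (auto elim: red.cases)
  from urv consider d where "u = e @ d" "w = d @ r @ v" | d where "e = u @ d" "d @ w = r @ v"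
    by (auto simp: append_eq_append_conv2)
  then show False
  proof cases
    case 1
    then show False
      using rule_irreducible[OF r] w by blast
  next
    case 2
    from 2(2) consider s where "d = r @ s" | s where "r = d @ s" "w = s @ v"
      by (auto simp: append_eq_append_conv2)
    then show False
    proof cases
      case 1
      then show False
        using rule_irreducible[OF r] e 2 by blast
    next
      case s: 2
      show False
      proof (cases "d = [] \<or> s = []")
        case True
        then show False
          using rule_irreducible[OF r, of "[]" v] rule_irreducible[OF r, of u "[]"] e w s 2 by auto
      next
        case False
        then obtain x y where xy: "y \<in> set d" "x \<in> set s"
          by (metis ex_in_conv set_empty)
        then have "y \<in> B - C" "x \<in> C"
          using e w s 2 by auto
        then show False
          using rule_split[OF r[unfolded s(1)] xy] letter_order_rank_le[of x y]
          by (auto simp: letter_rank_def)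
      qed
    qed
  qed
qed

text \<open>
  The largest two-sided ideal on which the linear extension of \<open>\<tau>\<close> vanishes.
\<close>
definition kernel_ideal :: "('a list \<Rightarrow> 'k poly) \<Rightarrow> ('a fword \<Rightarrow>\<^sub>0 'k) set" where
  "kernel_ideal \<tau> = {f. \<forall>a b. lin_ext \<tau> (a * f * b) = 0}"

context
  fixes \<tau> :: "'a list \<Rightarrow> 'k poly"
  assumes invariant: "reduction_invariant red UNIV \<tau>"
begin

lemma two_sided_ideal_kernel: "two_sided_ideal (kernel_ideal \<tau>)"
  unfolding two_sided_ideal_def kernel_ideal_def
proof (intro conjI ballI allI CollectI)
  fix f g c a b :: "'a fword \<Rightarrow>\<^sub>0 'k"
  show "lin_ext \<tau> (a * 0 * b) = 0"
    by simp
  assume f: "f \<in> {f. \<forall>a b. lin_ext \<tau> (a * f * b) = 0}"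
  show "lin_ext \<tau> (a * (c * f) * b) = 0" "lin_ext \<tau> (a * (f * c) * b) = 0"
    using f[unfolded mem_Collect_eq, rule_format, of "a * c" b]
      f[unfolded mem_Collect_eq, rule_format, of a "c * b"] by (simp_all add: mult.assoc)
  assume "g \<in> {f. \<forall>a b. lin_ext \<tau> (a * f * b) = 0}"
  then show "lin_ext \<tau> (a * (f - g) * b) = 0"
    using f by (simp add: algebra_simps lin_ext_diff)
qed

lemma null_kernel:
  assumes "\<And>M. null \<tau> M n f"
  shows "f \<in> kernel_ideal \<tau>"
proof -
  have "lin_ext \<tau> (word u * f * word v) = 0" for u v
    using assms[of "length u + n + length v"] by (simp add: null_def)
  then have "lin_ext \<tau> (word u * f * b) = 0" for u b
    using lin_ext_sandwich[of \<tau> "word u * f" b 1] by (simp add: mult.assoc)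
  then have "lin_ext \<tau> (a * f * b) = 0" for a b
    using lin_ext_sandwich[of \<tau> 1 a "f * b"] by (simp add: mult.assoc)
  then show ?thesis
    by (simp add: kernel_ideal_def)
qed

lemma invariant_bounded: "reduction_invariant red {w. length w \<le> M} \<tau>"
  using invariant by (simp add: reduction_invariant_def)

lemma enveloping_relations_kernel: "enveloping_relations \<subseteq> kernel_ideal \<tau>"
proof -
  note inv = invariant_bounded
  have add: "\<iota> (x + y) - \<iota> x - \<iota> y \<in> kernel_ideal \<tau>" for x y
    by (rule null_kernel[OF null_gen_add[OF inv]])
  have scale: "\<iota> (c *s x) - free_const c * \<iota> x \<in> kernel_ideal \<tau>" for c x
    by (rule null_kernel[OF null_gen_scale[OF inv]])
  have br: "commutator (\<iota> x) (\<iota> y) - \<iota> (bracket x y) \<in> kernel_ideal \<tau>" for x y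
    by (rule null_kernel[OF null_bracket[OF inv]])
  have "\<iota> b ^ CHAR('k) - \<iota> (pmap b) \<in> kernel_ideal \<tau>" if "b \<in> B" for b
    using null_kernel[OF null_rule[OF inv rule.power[OF that]]] by (simp add: word_replicate)
  then have "\<iota> x ^ CHAR('k) - \<iota> (pmap x) \<in> kernel_ideal \<tau>" for x
    using power_relation_span[OF two_sided_ideal_kernel add scale br, of B x] span_B by simp
  then show ?thesis
    using add scale br unfolding enveloping_relations_def commutator_def by auto
qed

end

text \<open>
  The value prescribed at an irreducible word \<open>e h\<close>, where the letters of \<open>e\<close> are outside \<open>C\<close> and those of
  \<open>h\<close> in \<open>C\<close>: the value of the character at \<open>h\<close> if \<open>e\<close> is the chosen word, and \<open>0\<close> otherwise.
\<close>
definition normal_value :: "('a \<Rightarrow> 'k poly) \<Rightarrow> 'a list \<Rightarrow> 'a list \<Rightarrow> 'k poly" where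
  "normal_value \<chi> e\<^sub>0 w = (if takeWhile (\<lambda>x. x \<notin> C) w = e\<^sub>0
     then prod_list (map \<chi> (dropWhile (\<lambda>x. x \<notin> C) w)) else 0)"

context
  fixes \<chi> :: "'a \<Rightarrow> 'k poly" and e\<^sub>0 :: "'a list"
  assumes \<chi>_add: "\<And>x y. \<chi> (x + y) = \<chi> x + \<chi> y"
    and \<chi>_scale: "\<And>c x. \<chi> (c *s x) = smult c (\<chi> x)"
    and \<chi>_bracket: "\<And>b c. b \<in> C \<Longrightarrow> c \<in> C \<Longrightarrow> \<chi> (bracket b c) = 0"
    and \<chi>_pmap: "\<And>b. b \<in> C \<Longrightarrow> \<chi> (pmap b) = \<chi> b ^ CHAR('k)"
begin

abbreviation \<chi>_word :: "'a list \<Rightarrow> 'k poly" where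
  "\<chi>_word w \<equiv> prod_list (map \<chi> w)"

lemma \<chi>_sum: "\<chi> (sum f A) = (\<Sum>i\<in>A. \<chi> (f i))"
proof -
  have "\<chi> 0 = 0"
    using \<chi>_scale[of 0 0] by simp
  then show ?thesis
    by (induction A rule: infinite_finite_induct) (auto simp: \<chi>_add)
qed

lemma expansion_span_C:
  assumes "x \<in> span C"
  shows "representation B x = representation C x"
  using representation_extend[OF independent_B assms C_subset_B] .

text \<open>
  The conditions on \<open>\<chi>\<close> are those that the first two kinds of rules require, and \<open>\<chi>\<close> is linear for the
  sake of the third one.  A letter from \<open>span C\<close> is expanded in \<open>C\<close>, as \<open>C\<close> is part of the basis.
\<close>
lemma \<chi>_rule:
  assumes "rule r f" "set r \<subseteq> span C"
  shows "lin_ext \<chi>_word f = \<chi>_word r" "FWord k \<in> Poly_Mapping.keys f \<Longrightarrow> set k \<subseteq> span C"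
proof -
  have gens: "lin_ext \<chi>_word (\<iota> x) = \<chi> x" for x
    using lin_ext_word[of \<chi>_word "[x]"] by (simp add: word_single)
  show "lin_ext \<chi>_word f = \<chi>_word r"
    using assms(1)
  proof cases
    case (swap x y)
    have "x \<in> C" "y \<in> C"
      using swap assms(2) by (auto intro: letters_C)
    then have "\<chi> (bracket y x) = 0"
      using \<chi>_bracket by blast
    then show ?thesis
      using swap lin_ext_word[of \<chi>_word "[x, y]"]
      by (simp add: lin_ext_add gens word_Cons word_Nil)
  next
    case (power b)
    have "b \<in> C"
      using power assms(2) char_pos by (auto intro: letters_C)
    then show ?thesis
      using power by (simp add: gens \<chi>_pmap prod_list_replicate)
  next
    case (expand x)
    have "\<chi> x = \<chi> (\<Sum>b | representation B x b \<noteq> 0. representation B x b *s b)"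
      by (simp add: sum_nonzero_representation_eq independent_B span_B)
    then show ?thesis
      using expand
      by (simp add: expansion_def lin_ext_sum lin_ext_free_const gens \<chi>_sum \<chi>_scale)
  qed
  show "set k \<subseteq> span C" if k: "FWord k \<in> Poly_Mapping.keys f"
    using assms(1)
  proof cases
    case (swap x y)
    have "x \<in> C" "y \<in> C"
      using swap assms(2) by (auto intro: letters_C)
    moreover have "FWord k \<in> {FWord [x, y], FWord [bracket y x]}"
      using set_mp[OF keys_add k[unfolded swap]]
      by (auto simp: free_gen_def mult_single plus_fword_def)
    ultimately show ?thesis
      using bracket_C by (auto intro: span_base)
  next
    case (power b)
    have "b \<in> C"
      using power assms(2) char_pos by (auto intro: letters_C)
    then show ?thesis
      using power k pmap_C by (auto simp: free_gen_def)
  next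
    case (expand x)
    obtain b where b: "k = [b]" "representation B x b \<noteq> 0"
      using keys_expansion[OF k[unfolded expand]] by blast
    then have "b \<in> C"
      using expand assms(2) expansion_span_C representation_ne_zero by auto
    then show ?thesis
      using b by (auto intro: span_base)
  qed
qed

context
  fixes \<tau> :: "'a list \<Rightarrow> 'k poly"
  assumes invariant: "reduction_invariant red UNIV \<tau>"
    and \<tau>_\<nu>: "\<And>w. irreducible_word w \<Longrightarrow> \<tau> w = normal_value \<chi> e\<^sub>0 w"
begin

text \<open>
  The formula for irreducible words persists if \<open>w\<close> is an arbitrary word in the subalgebra, since
  reducing \<open>w\<close> leaves \<open>e\<close> alone.
\<close>
lemma \<tau>_append:
  assumes e: "irreducible_word e" "set e \<subseteq> B - C" and w: "set w \<subseteq> span C"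
  shows "\<tau> (e @ w) = (if e = e\<^sub>0 then \<chi>_word w else 0)"
proof -
  define c :: "'k poly" where "c = (if e = e\<^sub>0 then 1 else 0)"
  have "\<tau> (e @ w) = c * \<chi>_word w"
    using wf_lenlex[OF letter_order_wf] w
  proof (induction w rule: wf_induct_rule)
    case (less w)
    show ?case
    proof (cases "irreducible_word w")
      case True
      then have wC: "set w \<subseteq> C"
        using letters_C irreducible_word_letters less.prems by blast
      have parts: "takeWhile (\<lambda>x. x \<notin> C) (e @ w) = e" "dropWhile (\<lambda>x. x \<notin> C) (e @ w) = w"
      proof -
        have "takeWhile (\<lambda>x. x \<notin> C) w = []" "dropWhile (\<lambda>x. x \<notin> C) w = w"
          using wC by (cases w; simp)+
        moreover have "\<And>x. x \<in> set e \<Longrightarrow> x \<notin> C"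
          using e(2) by auto
        ultimately show "takeWhile (\<lambda>x. x \<notin> C) (e @ w) = e" "dropWhile (\<lambda>x. x \<notin> C) (e @ w) = w"
          by (simp_all add: takeWhile_append2 dropWhile_append2)
      qed
      then show ?thesis
        using \<tau>_\<nu>[OF irreducible_word_append[OF e True wC]] unfolding normal_value_def parts
        by (simp add: c_def)
    next
      case False
      then obtain u r v f where urv: "w = u @ r @ v" and r: "rule r f"
        by (auto simp: irreducible_word_def elim: red.cases)
      have span: "set u \<subseteq> span C" "set r \<subseteq> span C" "set v \<subseteq> span C"
        using less.prems urv by auto
      have "\<tau> (e @ w) = lin_ext \<tau> (word (e @ u) * f * word v)"
        using reduction_invariantD[OF invariant r, of "e @ u" v]
        by (simp add: urv flip: word_append)
      also have "\<dots> = (\<Sum>k\<in>Poly_Mapping.keys f. smult (poly_mapping.lookup f k)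
          (lin_ext \<tau> (word (e @ u) * word (letters k) * word v)))"
        by (rule lin_ext_sandwich)
      also have "\<dots> = (\<Sum>k\<in>Poly_Mapping.keys f. smult (poly_mapping.lookup f k)
          (c * \<chi>_word u * \<chi>_word (letters k) * \<chi>_word v))"
      proof (intro sum.cong refl arg_cong2[where f = smult])
        fix k assume "k \<in> Poly_Mapping.keys f"
        then have k: "FWord (letters k) \<in> Poly_Mapping.keys f"
          by simp
        have "\<tau> (e @ (u @ letters k @ v)) = c * \<chi>_word (u @ letters k @ v)"
          using less.IH word_order_context[OF rule_decreasing[OF r k]] \<chi>_rule(2)[OF r span(2) k] span
          by (simp add: urv)
        then show "lin_ext \<tau> (word (e @ u) * word (letters k) * word v)
            = c * \<chi>_word u * \<chi>_word (letters k) * \<chi>_word v"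
          by (simp add: mult.assoc flip: word_append)
      qed
      also have "\<dots> = c * \<chi>_word u * lin_ext \<chi>_word f * \<chi>_word v"
        by (simp add: lin_ext_def sum_distrib_left sum_distrib_right)
      also have "\<dots> = c * \<chi>_word w"
        by (simp add: \<chi>_rule(1)[OF r span(2)]) (simp add: urv mult.assoc)
      finally show ?thesis .
    qed
  qed
  then show ?thesis
    by (simp add: c_def)
qed

text \<open>
  Both sides are unchanged when a step is made inside \<open>w\<close>, so \<open>w\<close> may be taken to be an irreducible word
  \<open>e t\<close>; there it is the preceding lemma for \<open>t\<close> and for \<open>t h\<close>.
\<close>
lemma \<tau>_snoc:
  assumes h: "h \<in> span C"
  shows "\<tau> (w @ [h]) = \<chi> h * \<tau> w"
  using wf_lenlex[OF letter_order_wf]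
proof (induction w rule: wf_induct_rule)
  case (less w)
  show ?case
  proof (cases "irreducible_word w")
    case True
    define e t where "e = takeWhile (\<lambda>x. x \<notin> C) w" and "t = dropWhile (\<lambda>x. x \<notin> C) w"
    have w: "w = e @ t"
      by (simp add: e_def t_def)
    have e: "irreducible_word e" "set e \<subseteq> B - C"
      using irreducible_word_infix[of "[]" e t] irreducible_word_letters[OF True] True
      by (auto simp: w) (auto simp: e_def dest: set_takeWhileD)
    have "set t \<subseteq> C"
    proof (cases t)
      case (Cons c s)
      then have "c \<in> C"
        unfolding t_def by (simp add: dropWhile_eq_Cons_conv)
      moreover have "irreducible_word (c # s)"
        using irreducible_word_infix[of e "c # s" "[]"] True w Cons by simp
      ultimately show ?thesis
        using irreducible_word_tail Cons by simp
    qed simp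
    then have "set t \<subseteq> span C"
      using span_superset by blast
    then show ?thesis
      using \<tau>_append[OF e, of t] \<tau>_append[OF e, of "t @ [h]"] h
      by (simp add: w)
  next
    case False
    then obtain f where f: "red w f"
      by (auto simp: irreducible_word_def)
    then obtain u r v f' where urv: "w = u @ r @ v" "f = word u * f' * word v" and r: "rule r f'"
      by (auto elim: red.cases)
    have "\<tau> (w @ [h]) = lin_ext \<tau> (1 * f * word [h])"
      using reduction_invariantD[OF invariant r, of u "v @ [h]"]
      by (simp add: urv mult.assoc flip: word_append)
    also have "\<dots> = (\<Sum>k\<in>Poly_Mapping.keys f. smult (poly_mapping.lookup f k)
        (lin_ext \<tau> (1 * word (letters k) * word [h])))"
      by (rule lin_ext_sandwich)
    also have "\<dots> = (\<Sum>k\<in>Poly_Mapping.keys f. smult (poly_mapping.lookup f k) (\<chi> h * \<tau> (letters k)))"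
      using less.IH red_decreasing[OF f]
      by (intro sum.cong refl arg_cong2[where f = smult]) (simp flip: word_append)
    also have "\<dots> = \<chi> h * lin_ext \<tau> f"
      by (simp add: lin_ext_def sum_distrib_left)
    also have "lin_ext \<tau> f = \<tau> w"
      using invariant f by (simp add: reduction_invariant_def)
    finally show ?thesis .
  qed
qed

lemma lin_ext_mult_gen:
  assumes h: "h \<in> span C"
  shows "lin_ext \<tau> (f * \<iota> h) = \<chi> h * lin_ext \<tau> f"
proof -
  have "lin_ext \<tau> (1 * word (letters k) * word [h]) = \<chi> h * \<tau> (letters k)" for k
    using \<tau>_snoc[OF h] by (simp flip: word_append)
  then have "lin_ext \<tau> (1 * f * word [h]) = \<chi> h * lin_ext \<tau> f"
    by (subst lin_ext_sandwich) (simp add: lin_ext_def[of _ f] sum_distrib_left)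
  then show ?thesis
    by (simp add: word_single)
qed

end

end

text \<open>
  \<open>T\<close> is a functional on \<open>u(L)\<close>, as it vanishes on the defining ideal, and it is equivariant for the right
  action of the subalgebra.
\<close>
theorem exists_equivariant_functional:
  fixes \<chi> :: "'a \<Rightarrow> 'k poly"
  assumes \<chi>: "\<And>x y. \<chi> (x + y) = \<chi> x + \<chi> y" "\<And>c x. \<chi> (c *s x) = smult c (\<chi> x)"
    "\<And>b c. b \<in> C \<Longrightarrow> c \<in> C \<Longrightarrow> \<chi> (bracket b c) = 0"
    "\<And>b. b \<in> C \<Longrightarrow> \<chi> (pmap b) = \<chi> b ^ CHAR('k)"
    and e\<^sub>0: "e\<^sub>0 = [] \<or> (\<exists>y\<in>B - C. e\<^sub>0 = [y])"
  obtains T :: "('a fword \<Rightarrow>\<^sub>0 'k) \<Rightarrow> 'k poly" and K where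
    "\<And>f g. T (f + g) = T f + T g" "T (word e\<^sub>0) = 1"
    "\<And>f h. h \<in> span C \<Longrightarrow> T (f * \<iota> h) = \<chi> h * T f"
    "two_sided_ideal K" "enveloping_relations \<subseteq> K" "\<And>f. f \<in> K \<Longrightarrow> T f = 0"
proof -
  obtain \<tau> where \<tau>: "reduction_invariant red UNIV \<tau>" "\<And>w. \<nexists>f. red w f \<Longrightarrow> \<tau> w = normal_value \<chi> e\<^sub>0 w"
    by (rule diamond[where red = red and \<nu> = "normal_value \<chi> e\<^sub>0", OF wf_lenlex[OF letter_order_wf]])
      (blast intro: red_decreasing red_confluent)+
  have irr: "irreducible_word w \<Longrightarrow> \<tau> w = normal_value \<chi> e\<^sub>0 w" for w
    using \<tau>(2) by (simp add: irreducible_word_def)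
  have e: "irreducible_word e\<^sub>0" "set e\<^sub>0 \<subseteq> B - C"
  proof -
    have "e\<^sub>0 \<noteq> u @ r @ v" if r: "rule r f" for u r v f
    proof
      assume eq: "e\<^sub>0 = u @ r @ v"
      from r show False
      proof cases
        case (power b)
        then show False
          using e\<^sub>0 eq char_ge_2 by (auto dest: arg_cong[of _ _ length])
      qed (use e\<^sub>0 eq in \<open>auto simp: Cons_eq_append_conv append_eq_Cons_conv\<close>)
    qed
    then show "irreducible_word e\<^sub>0"
      unfolding irreducible_word_def by (metis red.cases)
    show "set e\<^sub>0 \<subseteq> B - C"
      using e\<^sub>0 by auto
  qed
  show thesis
  proof (rule that)
    show "lin_ext \<tau> (f + g) = lin_ext \<tau> f + lin_ext \<tau> g" for f g
      by (rule lin_ext_add)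
    show "lin_ext \<tau> (word e\<^sub>0) = 1"
      using \<tau>_append[OF \<chi> \<tau>(1) irr e, of "[]"] by simp
    show "lin_ext \<tau> (f * \<iota> h) = \<chi> h * lin_ext \<tau> f" if "h \<in> span C" for f h
      by (rule lin_ext_mult_gen[OF \<chi> \<tau>(1) irr that])
    show "two_sided_ideal (kernel_ideal \<tau>)"
      by (rule two_sided_ideal_kernel[OF \<tau>(1)])
    show "enveloping_relations \<subseteq> kernel_ideal \<tau>"
      by (rule enveloping_relations_kernel[OF \<tau>(1)])
    show "lin_ext \<tau> f = 0" if "f \<in> kernel_ideal \<tau>" for f
      using that[unfolded kernel_ideal_def mem_Collect_eq, rule_format, of 1 1] by simp
  qed
qed

end

section \<open>Rings that are Artinian modulo the radical\<close>

lemma ring_of_type_algebra_simps [simp]: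
  "carrier ring_of_type_algebra = UNIV" "x \<otimes>\<^bsub>ring_of_type_algebra\<^esub> y = x * y"
  "x \<oplus>\<^bsub>ring_of_type_algebra\<^esub> y = x + y" "\<one>\<^bsub>ring_of_type_algebra\<^esub> = 1" "\<zero>\<^bsub>ring_of_type_algebra\<^esub> = 0"
  by (simp_all add: ring_of_type_algebra_def)

lemma ring_of_type_algebra_minus [simp]:
  fixes x y :: "'r::ring_1"
  shows "\<ominus>\<^bsub>ring_of_type_algebra\<^esub> x = - x" "x \<ominus>\<^bsub>ring_of_type_algebra\<^esub> y = x - y"
proof -
  interpret S: ring "ring_of_type_algebra :: 'r ring"
    by (rule ring_of_type_algebra_is_ring)
  show "\<ominus>\<^bsub>ring_of_type_algebra\<^esub> x = - x" for x :: 'r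
    by (rule S.minus_equality) simp_all
  then show "x \<ominus>\<^bsub>ring_of_type_algebra\<^esub> y = x - y"
    by (simp add: a_minus_def)
qed

lemma ideal_ring_of_type_algebra_iff:
  fixes K :: "'r::ring_1 set"
  shows "ideal K ring_of_type_algebra \<longleftrightarrow> two_sided_ideal K"
proof
  interpret S: ring "ring_of_type_algebra :: 'r ring"
    by (rule ring_of_type_algebra_is_ring)
  show "two_sided_ideal K" if "ideal K ring_of_type_algebra"
  proof -
    interpret ideal K ring_of_type_algebra by (rule that)
    show ?thesis
      unfolding two_sided_ideal_def
      using zero_closed I_l_closed I_r_closed a_closed a_inv_closed
      by (auto simp: diff_conv_add_uminus simp del: add_uminus_conv_diff)
  qed
  show "ideal K ring_of_type_algebra" if K: "two_sided_ideal K"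
  proof (rule idealI)
    show "subgroup K (add_monoid ring_of_type_algebra)"
      using ideal_zero[OF K] ideal_add[OF K] ideal_minus[OF K]
      by (intro S.add.subgroupI) (auto simp flip: a_inv_def)
  qed (use K in \<open>auto simp: two_sided_ideal_def ring_of_type_algebra_is_ring\<close>)
qed

text \<open>
  Take for \<open>J\<close> the preimage of the Jacobson radical of the quotient by \<open>I\<close>.  The facts about the quotient
  are expressed by representatives, so that later calculations are made in a type of class \<open>ring_1\<close>.
\<close>
lemma artinian_mod_radical_preimage:
  fixes I :: "'r::ring_1 set"
  defines "R \<equiv> ring_of_type_algebra Quot I"
  assumes I: "two_sided_ideal I" and art: "left_artinian (R Quot jacobson_radical R)"
  obtains J where "two_sided_ideal J" "I \<subseteq> J" "\<And>j. j \<in> J \<Longrightarrow> \<exists>s. s * (1 + j) - 1 \<in> I"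
    "\<And>a :: nat \<Rightarrow> 'r. (\<And>n. \<exists>s. a (Suc n) - s * a n \<in> I) \<Longrightarrow> \<exists>n r. a n - r * a (Suc n) \<in> J"
proof -
  let ?S = "ring_of_type_algebra :: 'r ring"
  interpret S: ring ?S
    by (rule ring_of_type_algebra_is_ring)
  have idl: "ideal I ?S"
    using I by (simp add: ideal_ring_of_type_algebra_iff)
  interpret I: ideal I ?S by (rule idl)
  interpret R: ring R
    unfolding R_def by (rule I.quotient_is_ring)
  let ?\<phi> = "a_r_coset ?S I"
  have hom: "?\<phi> \<in> ring_hom ?S R"
    unfolding R_def by (rule I.rcos_ring_hom)
  have carR: "carrier R = range ?\<phi>"
    by (auto simp: R_def FactRing_def A_RCOSETS_def')
  have \<phi>: "?\<phi> f \<in> carrier R" "?\<phi> (f + g) = ?\<phi> f \<oplus>\<^bsub>R\<^esub> ?\<phi> g" "?\<phi> (f * g) = ?\<phi> f \<otimes>\<^bsub>R\<^esub> ?\<phi> g" "?\<phi> 1 = \<one>\<^bsub>R\<^esub>"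
    for f g
    using ring_hom_closed[OF hom] ring_hom_add[OF hom, of f g] ring_hom_mult[OF hom, of f g]
      ring_hom_one[OF hom] by simp_all
  have eq_iff: "?\<phi> f = ?\<phi> g \<longleftrightarrow> f - g \<in> I" for f g
    using S.quotient_eq_iff_same_a_r_cos[OF idl, of f g] by simp
  interpret JR: ideal "jacobson_radical R" R
    by (rule R.jacobson_radical_ideal)
  define J where "J = {f. ?\<phi> f \<in> jacobson_radical R}"
  have \<phi>0: "?\<phi> 0 = \<zero>\<^bsub>R\<^esub>"
    using \<phi>(2)[of 0 0] \<phi>(1)[of 0] by simp
  have \<phi>_minus: "?\<phi> (- f) = \<ominus>\<^bsub>R\<^esub> ?\<phi> f" for f
    using \<phi>(2)[of "- f" f] \<phi>(1) \<phi>0 by (intro R.minus_equality[symmetric]) simp_all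
  have two: "two_sided_ideal J"
    unfolding two_sided_ideal_def
  proof (intro conjI ballI allI)
    show "0 \<in> J"
      by (simp add: J_def \<phi>0)
    fix f assume f: "f \<in> J"
    show "a * f \<in> J" "f * a \<in> J" for a
      using f by (simp_all add: J_def \<phi> JR.I_l_closed JR.I_r_closed)
    show "f - g \<in> J" if "g \<in> J" for g
      using f that \<phi>(2)[of f "- g"] by (simp add: J_def \<phi>_minus)
  qed
  show thesis
  proof (rule that[OF two])
    show "I \<subseteq> J"
    proof
      fix f assume "f \<in> I"
      then have "?\<phi> f = ?\<phi> 0"
        by (simp add: eq_iff)
      then show "f \<in> J"
        by (simp add: J_def \<phi>0)
    qed
    show "\<exists>s. s * (1 + j) - 1 \<in> I" if j: "j \<in> J" for j
    proof -
      obtain A where A: "A \<in> carrier R" "A \<otimes>\<^bsub>R\<^esub> (\<one>\<^bsub>R\<^esub> \<oplus>\<^bsub>R\<^esub> ?\<phi> j) = \<one>\<^bsub>R\<^esub>"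
        using R.one_plus_jacobson_left_invertible[of "?\<phi> j"] j by (auto simp: J_def)
      obtain s where "A = ?\<phi> s"
        using A(1) carR by auto
      then have "?\<phi> (s * (1 + j)) = ?\<phi> 1"
        using A(2) by (simp add: \<phi>)
      then show ?thesis
        by (auto simp: eq_iff)
    qed
    fix a :: "nat \<Rightarrow> 'r"
    assume a: "\<And>n. \<exists>s. a (Suc n) - s * a n \<in> I"
    have "\<exists>n. \<exists>A\<in>carrier R. ?\<phi> (a n) \<ominus>\<^bsub>R\<^esub> A \<otimes>\<^bsub>R\<^esub> ?\<phi> (a (Suc n)) \<in> jacobson_radical R"
    proof (rule R.left_artinian_quotient_chain[OF R.jacobson_radical_ideal art \<phi>(1)])
      fix n
      obtain s where "a (Suc n) - s * a n \<in> I"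
        using a by blast
      then have "?\<phi> (a (Suc n)) = ?\<phi> s \<otimes>\<^bsub>R\<^esub> ?\<phi> (a n)"
        by (simp flip: eq_iff \<phi>)
      then show "\<exists>A\<in>carrier R. ?\<phi> (a (Suc n)) = A \<otimes>\<^bsub>R\<^esub> ?\<phi> (a n)"
        using \<phi>(1) by blast
    qed
    then obtain n A where A: "A \<in> carrier R" "?\<phi> (a n) \<ominus>\<^bsub>R\<^esub> A \<otimes>\<^bsub>R\<^esub> ?\<phi> (a (Suc n)) \<in> jacobson_radical R"
      by blast
    obtain r where r: "A = ?\<phi> r"
      using A(1) carR by auto
    have "?\<phi> (a n - r * a (Suc n)) = ?\<phi> (a n) \<ominus>\<^bsub>R\<^esub> A \<otimes>\<^bsub>R\<^esub> ?\<phi> (a (Suc n))"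
      using \<phi>(2)[of "a n" "- (r * a (Suc n))"] by (simp add: a_minus_def \<phi>_minus \<phi>(3) r)
    then show "\<exists>n r. a n - r * a (Suc n) \<in> J"
      using A(2) unfolding J_def mem_Collect_eq by metis
  qed
qed

text \<open>
  Products in which every new factor is coprime to the preceding ones, as in Euclid's proof that there are
  infinitely many primes.
\<close>
primrec coprime_chain :: "'r::ring_1 \<Rightarrow> nat \<Rightarrow> 'r" where
  "coprime_chain x 0 = x"
| "coprime_chain x (Suc n) = (1 + coprime_chain x n) * coprime_chain x n"

text \<open>
  If \<open>g - r (1 + g) g \<in> J\<close> then \<open>(1 - r g) (1 + g) \<in> 1 + J\<close>, and the elements of \<open>1 + J\<close> are left
  invertible.
\<close>
lemma coprime_chain_left_invertible:
  fixes I :: "'r::ring_1 set"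
  assumes I: "two_sided_ideal I"
    and art: "left_artinian (ring_of_type_algebra Quot I Quot jacobson_radical (ring_of_type_algebra Quot I))"
  shows "\<exists>n s. s * (1 + coprime_chain x n) - 1 \<in> I"
proof -
  obtain J where J: "\<And>j. j \<in> J \<Longrightarrow> \<exists>s. s * (1 + j) - 1 \<in> I"
    "\<And>a :: nat \<Rightarrow> 'r. (\<And>n. \<exists>s. a (Suc n) - s * a n \<in> I) \<Longrightarrow> \<exists>n r. a n - r * a (Suc n) \<in> J"
    using artinian_mod_radical_preimage[OF I art] by metis
  have "\<exists>s. coprime_chain x (Suc n) - s * coprime_chain x n \<in> I" for n
    using ideal_zero[OF I] by (intro exI[of _ "1 + coprime_chain x n"]) simp
  then obtain n r where nr: "coprime_chain x n - r * coprime_chain x (Suc n) \<in> J"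
    using J(2)[of "coprime_chain x"] by blast
  obtain s where "s * (1 + (coprime_chain x n - r * coprime_chain x (Suc n))) - 1 \<in> I"
    using J(1)[OF nr] by blast
  moreover have "1 + (coprime_chain x n - r * coprime_chain x (Suc n))
      = (1 - r * coprime_chain x n) * (1 + coprime_chain x n)"
    by (simp add: algebra_simps)
  ultimately show ?thesis
    by (metis mult.assoc)
qed

text \<open>
  The left ideals generated by the \<open>1 - e\<^sub>n\<close> descend.  Where they become stationary modulo \<open>J\<close>,
  \<open>(1 - e\<^sub>n) e\<^sub>n\<^sub>+\<^sub>1 = e\<^sub>n\<^sub>+\<^sub>1 - e\<^sub>n\<close> is an idempotent in \<open>J\<close>, hence zero: if \<open>d = d\<^sup>2\<close> and \<open>s (1 - d) = 1\<close> then
  \<open>d = s (1 - d) d = 0\<close>.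
\<close>
lemma increasing_idempotents_stationary:
  fixes I :: "'r::ring_1 set" and e :: "nat \<Rightarrow> 'r"
  assumes I: "two_sided_ideal I"
    and art: "left_artinian (ring_of_type_algebra Quot I Quot jacobson_radical (ring_of_type_algebra Quot I))"
    and idem: "\<And>n. e n * e n - e n \<in> I"
    and below: "\<And>n. e n * e (Suc n) - e n \<in> I" "\<And>n. e (Suc n) * e n - e n \<in> I"
  shows "\<exists>n. e (Suc n) - e n \<in> I"
proof -
  obtain J where two: "two_sided_ideal J" "I \<subseteq> J" and J: "\<And>j. j \<in> J \<Longrightarrow> \<exists>s. s * (1 + j) - 1 \<in> I"
    "\<And>a :: nat \<Rightarrow> 'r. (\<And>n. \<exists>s. a (Suc n) - s * a n \<in> I) \<Longrightarrow> \<exists>n r. a n - r * a (Suc n) \<in> J"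
    using artinian_mod_radical_preimage[OF I art] by metis
  have "(1 - e (Suc n)) - (1 - e (Suc n)) * (1 - e n) \<in> I" for n
  proof -
    have "(1 - e (Suc n)) - (1 - e (Suc n)) * (1 - e n) = - (e (Suc n) * e n - e n)"
      by (simp add: algebra_simps)
    then show ?thesis
      using ideal_minus[OF I below(2)] by simp
  qed
  then obtain n r where nr: "(1 - e n) - r * (1 - e (Suc n)) \<in> J"
    using J(2)[of "\<lambda>n. 1 - e n"] by blast
  define d where "d = e (Suc n) - e n"
  have "- d = - (((1 - e n) - r * (1 - e (Suc n))) * e (Suc n)
      + (e n * e (Suc n) - e n) - r * (e (Suc n) * e (Suc n) - e (Suc n)))"
    by (simp add: d_def algebra_simps)
  moreover have "e n * e (Suc n) - e n \<in> J" "e (Suc n) * e (Suc n) - e (Suc n) \<in> J"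
    using two(2) below(1) idem by auto
  ultimately have "- d \<in> J"
    using nr by (simp only: ideal_minus[OF two(1)] ideal_add[OF two(1)] ideal_diff[OF two(1)]
        ideal_mult_left[OF two(1)] ideal_mult_right[OF two(1)])
  then obtain s where s: "s * (1 + - d) - 1 \<in> I"
    using J(1) by blast
  have dd: "d * d - d = (e (Suc n) * e (Suc n) - e (Suc n)) - (e (Suc n) * e n - e n)
      - (e n * e (Suc n) - e n) + (e n * e n - e n)"
    by (simp add: d_def algebra_simps)
  have "d * d - d \<in> I"
    unfolding dd using idem below by (simp only: ideal_add[OF I] ideal_diff[OF I])
  moreover have "d = - ((s * (1 + - d) - 1) * d + s * (d * d - d))"
    by (simp add: algebra_simps)
  ultimately have "d \<in> I"
    using s by (metis ideal_minus[OF I] ideal_add[OF I] ideal_mult_left[OF I] ideal_mult_right[OF I])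
  then show ?thesis
    unfolding d_def by blast
qed

section \<open>Abelian restricted subalgebras\<close>

context restricted_lie_algebra
begin

lemma restricted_subalgebra_generated: "restricted_subalgebra \<langle>S\<rangle>\<^sub>p"
  unfolding generated_restricted_subalgebra_def
  by (rule hull_in) (auto simp: restricted_subalgebra_def intro: subspace_Inter)

lemma generated_superset: "S \<subseteq> \<langle>S\<rangle>\<^sub>p"
  unfolding generated_restricted_subalgebra_def by (rule hull_subset)

lemma generated_minimal: "S \<subseteq> T \<Longrightarrow> restricted_subalgebra T \<Longrightarrow> \<langle>S\<rangle>\<^sub>p \<subseteq> T"
  unfolding generated_restricted_subalgebra_def by (rule hull_minimal)

lemma finite_dimensional_subspace:
  assumes "subspace V" "V \<subseteq> span S" "finite S"
  shows "finite_dimensional V"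
proof -
  obtain b where b: "b \<subseteq> V" "independent b" "V \<subseteq> span b"
    using maximal_independent_subset[of V] by metis
  then have "finite b"
    using independent_span_bound[OF assms(3) b(2)] assms(2) by blast
  moreover have "span b = V"
    using b span_minimal[OF b(1) assms(1)] by blast
  ultimately show ?thesis
    unfolding finite_dimensional_def by blast
qed

lemma pmap_zero: "pmap 0 = 0"
  using pmap_scale[of 0 0] by (simp add: zero_power[OF char_pos])

text \<open>
  All terms \<open>s\<^sub>i(x, y)\<close> are iterated brackets of \<open>x\<close> and \<open>y\<close>.
\<close>
lemma pmap_add_commuting:
  assumes "bracket x y = 0"
  shows "pmap (x + y) = pmap x + pmap y"
proof -
  have zero: "(ad_poly x y ^^ n) 0 = 0" for n
    by (induction n) (simp_all add: ad_poly_def)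
  have "bracket y x = 0"
    using assms bracket_anticommute[of y x] by simp
  then have "ad_poly x y [:x:] = 0"
    by (simp add: ad_poly_def map_poly_pCons bracket_self)
  moreover obtain q where "CHAR('k) - 1 = Suc q"
    using char_ge_2 by (cases "CHAR('k) - 1") auto
  ultimately have "(ad_poly x y ^^ (CHAR('k) - 1)) [:x:] = 0"
    by (simp only: funpow_Suc_right o_apply zero)
  then show ?thesis
    by (simp add: pmap_add jacobson_s_def)
qed

lemma bracket_zero_left [simp]: "bracket 0 x = 0"
  using bracket_scale_left[of 0 0 x] by simp

lemma bracket_span_zero:
  assumes S: "\<And>a b. a \<in> S \<Longrightarrow> b \<in> S \<Longrightarrow> bracket a b = 0" and "x \<in> span S" "y \<in> span S"
  shows "bracket x y = 0"
proof -
  have "subspace {x. bracket x b = 0}" "subspace {y. bracket b y = 0}" for b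
    by (auto intro!: subspaceI simp: bracket_add_left bracket_add_right bracket_scale_left bracket_scale_right)
  then have "bracket x b = 0" if "b \<in> S" for b
    using span_induct[OF assms(2), of "\<lambda>x. bracket x b = 0"] S that by blast
  then show ?thesis
    using span_induct[OF assms(3), of "\<lambda>y. bracket x y = 0"] \<open>\<And>b. subspace {y. bracket b y = 0}\<close> by blast
qed

lemma restricted_subalgebra_span:
  assumes comm: "\<And>a b. a \<in> S \<Longrightarrow> b \<in> S \<Longrightarrow> bracket a b = 0" and p: "\<And>a. a \<in> S \<Longrightarrow> pmap a \<in> span S"
  shows "restricted_subalgebra (span S)"
proof -
  have zero: "bracket x y = 0" if "x \<in> span S" "y \<in> span S" for x y
    using bracket_span_zero[OF comm that] .
  have "subspace {x. x \<in> span S \<and> pmap x \<in> span S}"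
    by (auto intro!: subspaceI simp: pmap_zero span_zero span_add span_scale pmap_scale pmap_add_commuting zero)
  then have "pmap x \<in> span S" if "x \<in> span S" for x
    using span_induct[OF that, of "\<lambda>x. x \<in> span S \<and> pmap x \<in> span S"] p by (auto intro: span_base)
  then show ?thesis
    by (simp add: restricted_subalgebra_def zero span_zero)
qed

lemma bracket_pmap_zero:
  assumes "bracket x y = 0"
  shows "bracket (pmap x) y = 0" "bracket y (pmap x) = 0"
proof -
  have "(bracket x ^^ n) 0 = 0" for n
    by (induction n) simp_all
  moreover obtain q where "CHAR('k) = Suc q"
    using char_pos by (cases "CHAR('k)") auto
  ultimately show "bracket (pmap x) y = 0"
    by (simp only: bracket_pmap funpow_Suc_right o_apply assms)
  then show "bracket y (pmap x) = 0"
    using bracket_anticommute[of y "pmap x"] by simp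
qed

lemma bracket_pmap_funpow: "bracket ((pmap ^^ i) x) ((pmap ^^ j) x) = 0"
proof -
  have 1: "bracket x ((pmap ^^ j) x) = 0" for j
  proof (induction j)
    case (Suc j)
    then show ?case
      using bracket_anticommute[of "(pmap ^^ j) x" x] by (simp add: bracket_pmap_zero)
  qed (simp add: bracket_self)
  then show ?thesis
    by (induction i) (simp_all add: bracket_pmap_zero)
qed

lemma generated_pmap_subset: "\<langle>{pmap x}\<rangle>\<^sub>p \<subseteq> span (range (\<lambda>i. (pmap ^^ Suc i) x))"
proof (rule generated_minimal)
  show "{pmap x} \<subseteq> span (range (\<lambda>i. (pmap ^^ Suc i) x))"
    by (auto intro!: span_base range_eqI[of _ _ 0])
  show "restricted_subalgebra (span (range (\<lambda>i. (pmap ^^ Suc i) x)))"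
  proof (rule restricted_subalgebra_span)
    fix a b assume "a \<in> range (\<lambda>i. (pmap ^^ Suc i) x)" "b \<in> range (\<lambda>i. (pmap ^^ Suc i) x)"
    then obtain i j where "a = (pmap ^^ Suc i) x" "b = (pmap ^^ Suc j) x"
      by blast
    then show "bracket a b = 0"
      by (simp only: bracket_pmap_funpow)
  next
    fix a assume "a \<in> range (\<lambda>i. (pmap ^^ Suc i) x)"
    then obtain i where "a = (pmap ^^ Suc i) x"
      by blast
    then have s: "pmap a = (pmap ^^ Suc (Suc i)) x"
      by simp
    show "pmap a \<in> span (range (\<lambda>i. (pmap ^^ Suc i) x))"
      unfolding s by (rule span_base, rule rangeI)
  qed
qed

text \<open>
  If \<open>x\<^bsup>[p]^n\<^esup>\<close> is a combination of the preceding powers, then these span a restricted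
  subalgebra.
\<close>
lemma p_algebraic_of_dependence:
  assumes "(pmap ^^ n) x \<in> span ((\<lambda>i. (pmap ^^ i) x) ` {..<n})"
  shows "p_algebraic x"
proof -
  let ?S = "(\<lambda>i. (pmap ^^ i) x) ` {..<n}"
  have "restricted_subalgebra (span ?S)"
  proof (rule restricted_subalgebra_span)
    show "bracket a b = 0" if "a \<in> ?S" "b \<in> ?S" for a b
      using that bracket_pmap_funpow by blast
    fix a assume "a \<in> ?S"
    then obtain i where i: "a = (pmap ^^ i) x" "i < n"
      by blast
    then have "pmap a = (pmap ^^ Suc i) x"
      by simp
    then show "pmap a \<in> span ?S"
      using assms i(2) by (cases "Suc i = n") (auto intro!: span_base simp del: funpow.simps)
  qed
  moreover have "x \<in> span ?S"
    using assms by (cases "n = 0") (auto intro!: span_base image_eqI[of _ _ 0])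
  ultimately have "\<langle>{x}\<rangle>\<^sub>p \<subseteq> span ?S"
    by (intro generated_minimal) auto
  then show ?thesis
    unfolding p_algebraic_def
    using restricted_subalgebra_generated[of "{x}"]
    by (intro finite_dimensional_subspace[of _ ?S]) (auto simp: restricted_subalgebra_def)
qed

lemma independent_pmap_powers:
  assumes "\<not> p_algebraic x"
  shows "independent (range (\<lambda>i. (pmap ^^ i) x))" "inj (\<lambda>i. (pmap ^^ i) x)"
proof -
  let ?S = "\<lambda>n. (\<lambda>i. (pmap ^^ i) x) ` {..<n}"
  have new: "(pmap ^^ n) x \<notin> span (?S n)" for n
    using p_algebraic_of_dependence assms by blast
  have ind: "independent (?S n)" for n
    by (induction n) (simp_all add: lessThan_Suc independent_insertI new independent_empty)
  have "range (\<lambda>i. (pmap ^^ i) x) = (\<Union>n. ?S n)"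
    by auto
  moreover have "independent (\<Union>(range ?S))"
  proof (rule independent_Union_directed)
    fix c d assume "c \<in> range ?S" "d \<in> range ?S"
    then obtain m n where "c = ?S m" "d = ?S n"
      by blast
    then show "c \<subseteq> d \<or> d \<subseteq> c"
      by (cases "m \<le> n") auto
  qed (use ind in auto)
  ultimately show "independent (range (\<lambda>i. (pmap ^^ i) x))"
    by simp
  have "(pmap ^^ i) x \<noteq> (pmap ^^ j) x" if "i < j" for i j
    using new[of j] that by (metis imageI lessThan_iff span_base)
  then show "inj (\<lambda>i. (pmap ^^ i) x)"
    by (intro injI) (metis nat_neq_iff)
qed

subsection \<open>Functionals on the restricted enveloping algebra\<close>

definition relation_ideal :: "('a fword \<Rightarrow>\<^sub>0 'k) set" where
  "relation_ideal = genideal ring_of_type_algebra enveloping_relations"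

lemma two_sided_relation_ideal: "two_sided_ideal relation_ideal"
  and relations_in_ideal: "enveloping_relations \<subseteq> relation_ideal"
  and relation_ideal_minimal: "two_sided_ideal K \<Longrightarrow> enveloping_relations \<subseteq> K \<Longrightarrow> relation_ideal \<subseteq> K"
proof -
  interpret S: ring "ring_of_type_algebra :: ('a fword \<Rightarrow>\<^sub>0 'k) ring"
    by (rule ring_of_type_algebra_is_ring)
  show "two_sided_ideal relation_ideal"
    unfolding relation_ideal_def ideal_ring_of_type_algebra_iff[symmetric]
    by (rule S.genideal_ideal) simp
  show "enveloping_relations \<subseteq> relation_ideal"
    unfolding relation_ideal_def by (rule S.genideal_self) simp
  show "two_sided_ideal K \<Longrightarrow> enveloping_relations \<subseteq> K \<Longrightarrow> relation_ideal \<subseteq> K"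
    unfolding relation_ideal_def ideal_ring_of_type_algebra_iff[symmetric]
    by (rule S.genideal_minimal)
qed

lemma relation_ideal_gens:
  "\<iota> (x + y) - \<iota> x - \<iota> y \<in> relation_ideal"
  "\<iota> (c *s x) - free_const c * \<iota> x \<in> relation_ideal"
  "commutator (\<iota> x) (\<iota> y) - \<iota> (bracket x y) \<in> relation_ideal"
  "\<iota> x ^ CHAR('k) - \<iota> (pmap x) \<in> relation_ideal"
  using relations_in_ideal unfolding enveloping_relations_def commutator_def by blast+

text \<open>
  A basis of the subalgebra, together with the given element outside it, is extended to a basis of the Lie
  algebra.
\<close>
lemma exists_enveloping_functional:
  fixes \<chi> :: "'a \<Rightarrow> 'k poly"
  assumes C: "independent C" "\<And>b c. b \<in> C \<Longrightarrow> c \<in> C \<Longrightarrow> bracket b c \<in> span C" "\<And>b. b \<in> C \<Longrightarrow> pmap b \<in> span C"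
    and \<chi>: "\<And>x y. \<chi> (x + y) = \<chi> x + \<chi> y" "\<And>c x. \<chi> (c *s x) = smult c (\<chi> x)"
    "\<And>b c. b \<in> C \<Longrightarrow> c \<in> C \<Longrightarrow> \<chi> (bracket b c) = 0"
    "\<And>b. b \<in> C \<Longrightarrow> \<chi> (pmap b) = \<chi> b ^ CHAR('k)"
    and e\<^sub>0: "e\<^sub>0 = [] \<or> (\<exists>y. y \<notin> span C \<and> e\<^sub>0 = [y])"
  obtains T :: "('a fword \<Rightarrow>\<^sub>0 'k) \<Rightarrow> 'k poly" where
    "\<And>f g. T (f + g) = T f + T g" "T (word e\<^sub>0) = 1"
    "\<And>f h. h \<in> span C \<Longrightarrow> T (f * \<iota> h) = \<chi> h * T f" "\<And>f. f \<in> relation_ideal \<Longrightarrow> T f = 0"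
proof -
  have ind: "independent (C \<union> set e\<^sub>0)"
    using e\<^sub>0 C(1) by (auto simp: independent_insertI)
  define B where "B = extend_basis (C \<union> set e\<^sub>0)"
  have B: "independent B" "span B = UNIV" "C \<union> set e\<^sub>0 \<subseteq> B"
    using independent_extend_basis[OF ind] span_extend_basis[OF ind] extend_basis_superset[OF ind]
    by (auto simp: B_def)
  interpret adapted_basis scale bracket pmap B C
    by unfold_locales (use B C in auto)
  have "e\<^sub>0 = [] \<or> (\<exists>y\<in>B - C. e\<^sub>0 = [y])"
    using e\<^sub>0 B(3) by (auto intro: span_base)
  from exists_equivariant_functional[OF \<chi> this] obtain T :: "('a fword \<Rightarrow>\<^sub>0 'k) \<Rightarrow> 'k poly" and K where
    T: "\<And>f g. T (f + g) = T f + T g" "T (word e\<^sub>0) = 1"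
      "\<And>f h. h \<in> span C \<Longrightarrow> T (f * \<iota> h) = \<chi> h * T f"
    and K: "two_sided_ideal K" "enveloping_relations \<subseteq> K" "\<And>f. f \<in> K \<Longrightarrow> T f = 0"
    by metis
  have "T f = 0" if "f \<in> relation_ideal" for f
    using relation_ideal_minimal[OF K(1,2)] K(3) that by blast
  then show thesis
    using that T by blast
qed

inductive_set left_ideal_span :: "'a set \<Rightarrow> ('a fword \<Rightarrow>\<^sub>0 'k) set" for H where
  zero: "0 \<in> left_ideal_span H"
| step: "f \<in> left_ideal_span H \<Longrightarrow> h \<in> H \<Longrightarrow> a * \<iota> h + f \<in> left_ideal_span H"

lemma left_ideal_span_add: "f \<in> left_ideal_span H \<Longrightarrow> g \<in> left_ideal_span H \<Longrightarrow> f + g \<in> left_ideal_span H"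
  by (induction f rule: left_ideal_span.induct) (auto simp: add.assoc intro: left_ideal_span.intros)

lemma left_ideal_span_mult: "f \<in> left_ideal_span H \<Longrightarrow> b * f \<in> left_ideal_span H"
proof (induction f rule: left_ideal_span.induct)
  case (step f h a)
  then show ?case
    using left_ideal_span.step[of "b * f" H h "b * a"] by (simp add: distrib_left mult.assoc)
qed (simp add: left_ideal_span.zero)

lemma left_ideal_span_mono: "f \<in> left_ideal_span H \<Longrightarrow> H \<subseteq> H' \<Longrightarrow> f \<in> left_ideal_span H'"
  by (induction f rule: left_ideal_span.induct) (auto intro: left_ideal_span.intros)

lemma left_ideal_span_gen: "h \<in> H \<Longrightarrow> a * \<iota> h \<in> left_ideal_span H"
  using left_ideal_span.step[OF left_ideal_span.zero, of h H a] by simp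

text \<open>
  Take the functional for the zero character that is \<open>1\<close> at \<open>y\<close>: it vanishes on the left ideal.
\<close>
lemma gen_not_in_left_ideal:
  assumes H: "restricted_subalgebra H" and y: "y \<notin> H" and f: "f \<in> left_ideal_span H"
  shows "\<iota> y - f \<notin> relation_ideal"
proof
  assume rel: "\<iota> y - f \<in> relation_ideal"
  obtain C where C: "C \<subseteq> H" "independent C" "H \<subseteq> span C"
    using maximal_independent_subset[of H] by metis
  have span: "span C = H"
    using C H span_minimal[OF C(1)] by (auto simp: restricted_subalgebra_def)
  obtain T :: "('a fword \<Rightarrow>\<^sub>0 'k) \<Rightarrow> 'k poly" where T: "\<And>f g. T (f + g) = T f + T g" "T (word [y]) = 1"
    "\<And>f h. h \<in> span C \<Longrightarrow> T (f * \<iota> h) = 0 * T f" "\<And>f. f \<in> relation_ideal \<Longrightarrow> T f = 0"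
  proof (rule exists_enveloping_functional[OF C(2), of "\<lambda>_. 0" "[y]"])
    show "bracket b c \<in> span C" if "b \<in> C" "c \<in> C" for b c
      using that C(1) H by (auto simp: span restricted_subalgebra_def)
    show "pmap b \<in> span C" if "b \<in> C" for b
      using that C(1) H by (auto simp: span restricted_subalgebra_def)
  qed (use y span char_pos in \<open>auto simp: zero_power\<close>)
  have "T f = 0"
    using f
  proof (induction f rule: left_ideal_span.induct)
    case zero
    then show ?case
      using T(1)[of 0 0] by (simp only: add_0 add_cancel_right_right)
  next
    case (step f h a)
    then show ?case
      using T(3)[of h a] by (simp add: T(1) span)
  qed
  moreover have "T (\<iota> y) = T (\<iota> y - f) + T f"
    using T(1)[of "\<iota> y - f" f] by simp
  ultimately show False
    using T(2,4) rel by (simp add: word_single)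
qed

end

section \<open>The two conclusions\<close>

locale artinian_restricted_lie_algebra = restricted_lie_algebra scale bracket pmap
  for scale :: "'k::field \<Rightarrow> 'a::ab_group_add \<Rightarrow> 'a" (infixr \<open>*s\<close> 75) and bracket pmap +
  assumes artinian:
    "left_artinian (restricted_enveloping_algebra Quot jacobson_radical restricted_enveloping_algebra)"
begin

lemma artinian': "left_artinian (ring_of_type_algebra Quot relation_ideal
    Quot jacobson_radical (ring_of_type_algebra Quot relation_ideal))"
  using artinian unfolding restricted_enveloping_algebra_def relation_ideal_def .

lemma degree_coprime_chain: "degree (coprime_chain [:0, 1::'k:] n) = 2 ^ n"
proof (induction n)
  case (Suc n)
  let ?g = "coprime_chain [:0, 1::'k:] n"
  have "degree (1 + ?g) = degree ?g"
    by (rule degree_add_eq_right) (simp add: Suc)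
  moreover have "?g \<noteq> 0" "1 + ?g \<noteq> 0"
    using Suc calculation by force+
  ultimately show ?case
    using Suc by (simp add: degree_mult_eq)
qed simp

text \<open>
  The character with \<open>\<chi>(x\<^bsup>[p]^i\<^esup>) = t\<^bsup>p^i\<^esup>\<close> exists because these elements are independent.  Its
  functional sends \<open>s (1 + g\<^sub>n(x))\<close> to \<open>(1 + g\<^sub>n(t)) T(s)\<close>, which is never \<open>1\<close> because \<open>g\<^sub>n(t)\<close> has degree
  \<open>2\<^sup>n\<close>.
\<close>
theorem all_p_algebraic: "p_algebraic x"
proof (rule ccontr)
  assume x: "\<not> p_algebraic x"
  let ?C = "range (\<lambda>i. (pmap ^^ i) x)"
  note ind = independent_pmap_powers[OF x]
  interpret V: vector_space_pair scale "smult :: 'k \<Rightarrow> 'k poly \<Rightarrow> 'k poly"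
    by unfold_locales (simp_all add: smult_add_left smult_add_right)
  define d where "d b = [:0, 1::'k:] ^ (CHAR('k) ^ the_inv (\<lambda>i. (pmap ^^ i) x) b)" for b
  obtain \<chi> where lin: "Vector_Spaces.linear scale smult \<chi>" and \<chi>: "\<And>b. b \<in> ?C \<Longrightarrow> \<chi> b = d b"
    using V.linear_independent_extend[OF ind(1), of d] by blast
  have \<chi>_pmap: "\<chi> ((pmap ^^ i) x) = [:0, 1:] ^ (CHAR('k) ^ i)" for i
    using \<chi>[of "(pmap ^^ i) x"] the_inv_f_f[OF ind(2), of i] by (simp add: d_def)
  have \<chi>_linear: "\<chi> (u + v) = \<chi> u + \<chi> v" "\<chi> (c *s u) = smult c (\<chi> u)" for u v c
    using lin by (simp_all add: V.linear_add V.linear_scale)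
  have "\<chi> 0 = 0"
    using \<chi>_linear(2)[of 0 0] by simp
  obtain T :: "('a fword \<Rightarrow>\<^sub>0 'k) \<Rightarrow> 'k poly" where
    T: "\<And>f g. T (f + g) = T f + T g" "T (word []) = 1"
      "\<And>f h. h \<in> span ?C \<Longrightarrow> T (f * \<iota> h) = \<chi> h * T f" "\<And>f. f \<in> relation_ideal \<Longrightarrow> T f = 0"
  proof (rule exists_enveloping_functional[OF ind(1), of \<chi> "[]"])
    show "bracket b c \<in> span ?C" "\<chi> (bracket b c) = 0" if "b \<in> ?C" "c \<in> ?C" for b c
      using that \<open>\<chi> 0 = 0\<close> by (auto simp: bracket_pmap_funpow span_zero)
    show "pmap b \<in> span ?C" "\<chi> (pmap b) = \<chi> b ^ CHAR('k)" if b: "b \<in> ?C" for b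
    proof -
      obtain i where i: "b = (pmap ^^ i) x"
        using b by blast
      then have s: "pmap b = (pmap ^^ Suc i) x"
        by simp
      show "pmap b \<in> span ?C"
        unfolding s by (rule span_base, rule rangeI)
      show "\<chi> (pmap b) = \<chi> b ^ CHAR('k)"
        unfolding s unfolding i \<chi>_pmap by (simp add: power_mult[symmetric] mult.commute)
    qed
  qed (use \<chi>_linear in auto)
  have "x \<in> span ?C" "\<chi> x = [:0, 1:]"
    using \<chi>_pmap[of 0] by (auto intro!: span_base range_eqI[of _ _ 0])
  then have chain: "T (f * coprime_chain (\<iota> x) n) = coprime_chain [:0, 1:] n * T f" for f n
  proof (induction n arbitrary: f)
    case (Suc n)
    let ?g = "coprime_chain (\<iota> x) n" and ?\<gamma> = "coprime_chain [:0, 1::'k:] n"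
    have "T (f * coprime_chain (\<iota> x) (Suc n)) = T ((f + f * ?g) * ?g)"
      by (simp add: algebra_simps)
    also have "\<dots> = ?\<gamma> * T (f + f * ?g)"
      by (rule Suc.IH) (rule Suc.prems)+
    also have "\<dots> = ?\<gamma> * (T f + ?\<gamma> * T f)"
      unfolding T(1) using Suc by simp
    finally show ?case
      by (simp add: algebra_simps)
  qed (simp add: T(3))
  obtain n s where "s * (1 + coprime_chain (\<iota> x) n) - 1 \<in> relation_ideal"
    using coprime_chain_left_invertible[OF two_sided_relation_ideal artinian'] by blast
  then have "T (s * (1 + coprime_chain (\<iota> x) n)) = 1"
    using T(1)[of "s * (1 + coprime_chain (\<iota> x) n) - 1" 1] T(2,4) by (simp add: word_Nil)
  then have "(1 + coprime_chain [:0, 1:] n) * T s = 1"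
    by (simp add: distrib_left distrib_right T(1) chain)
  then have "1 + coprime_chain [:0, 1::'k:] n dvd 1"
    by (metis dvd_triv_left)
  then have "degree (1 + coprime_chain [:0, 1::'k:] n) = 0"
    by (auto simp: is_unit_poly_iff)
  moreover have "degree (1 + coprime_chain [:0, 1::'k:] n) = 2 ^ n"
    using degree_coprime_chain[of n] by (subst degree_add_eq_right) simp_all
  ultimately show False
    by simp
qed

subsection \<open>Tori\<close>

lemma gen_pmap_funpow: "\<iota> ((pmap ^^ i) x) - \<iota> x ^ (CHAR('k) ^ i) \<in> relation_ideal"
proof (induction i)
  case 0
  then show ?case
    by (simp add: ideal_zero[OF two_sided_relation_ideal])
next
  case (Suc i)
  note I = two_sided_relation_ideal
  have "\<iota> ((pmap ^^ i) x) ^ CHAR('k) - (\<iota> x ^ (CHAR('k) ^ i)) ^ CHAR('k) \<in> relation_ideal"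
    by (rule ideal_cong_power[OF I Suc])
  from ideal_cong_trans[OF I ideal_cong_sym[OF I relation_ideal_gens(4)] this] show ?case
    by (simp add: power_mult[symmetric] mult.commute)
qed

text \<open>
  A semisimple \<open>x\<close> is a combination of the \<open>x\<^bsup>p^i\<^esup>\<close> with \<open>i \<ge> 1\<close>, so \<open>x = a x\<^sup>2\<close> for a
  polynomial \<open>a\<close> in \<open>x\<close>, and \<open>a x\<close> is an idempotent.
\<close>
lemma semisimple_divides_square:
  assumes "semisimple x"
  obtains a where "\<iota> x - a * \<iota> x * \<iota> x \<in> relation_ideal"
    "\<And>z. z * \<iota> x - \<iota> x * z \<in> relation_ideal \<Longrightarrow> z * a - a * z \<in> relation_ideal"
proof -
  note I = two_sided_relation_ideal
  define P where "P v \<longleftrightarrow> (\<exists>a. \<iota> v - a * \<iota> x * \<iota> x \<in> relation_ideal \<and>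
    (\<forall>z. z * \<iota> x - \<iota> x * z \<in> relation_ideal \<longrightarrow> z * a - a * z \<in> relation_ideal))" for v
  have "subspace {v. P v}"
  proof (rule subspaceI)
    have "\<iota> 0 - 0 * \<iota> x * \<iota> x \<in> relation_ideal"
      using relation_ideal_gens(2)[of 0 0] by (simp add: free_const_simps)
    then show "0 \<in> {v. P v}"
      unfolding P_def using ideal_zero[OF I] by (auto intro!: exI[of _ 0])
    fix v assume "v \<in> {v. P v}"
    then obtain a where a: "\<iota> v - a * \<iota> x * \<iota> x \<in> relation_ideal"
      "\<And>z. z * \<iota> x - \<iota> x * z \<in> relation_ideal \<Longrightarrow> z * a - a * z \<in> relation_ideal"
      unfolding P_def by blast
    show "c *s v \<in> {v. P v}" for c
    proof -
      have "\<iota> (c *s v) - free_const c * a * \<iota> x * \<iota> x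
          = (\<iota> (c *s v) - free_const c * \<iota> v) + free_const c * (\<iota> v - a * \<iota> x * \<iota> x)"
        by (simp add: algebra_simps)
      then have "\<iota> (c *s v) - free_const c * a * \<iota> x * \<iota> x \<in> relation_ideal"
        using a(1) relation_ideal_gens(2) by (simp only: ideal_add[OF I] ideal_mult_left[OF I])
      moreover have "z * (free_const c * a) - (free_const c * a) * z = free_const c * (z * a - a * z)" for z
        by (simp add: right_diff_distrib mult.assoc free_const_left_commute)
      ultimately show ?thesis
        unfolding P_def mem_Collect_eq using a(2)
        by (intro exI[of _ "free_const c * a"]) (simp add: ideal_mult_left[OF I])
    qed
    fix w assume "w \<in> {v. P v}"
    then obtain b where b: "\<iota> w - b * \<iota> x * \<iota> x \<in> relation_ideal"
      "\<And>z. z * \<iota> x - \<iota> x * z \<in> relation_ideal \<Longrightarrow> z * b - b * z \<in> relation_ideal"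
      unfolding P_def by blast
    have "\<iota> (v + w) - (a + b) * \<iota> x * \<iota> x
        = (\<iota> (v + w) - \<iota> v - \<iota> w) + (\<iota> v - a * \<iota> x * \<iota> x) + (\<iota> w - b * \<iota> x * \<iota> x)"
      by (simp add: algebra_simps)
    then have "\<iota> (v + w) - (a + b) * \<iota> x * \<iota> x \<in> relation_ideal"
      using a(1) b(1) relation_ideal_gens(1) by (simp only: ideal_add[OF I])
    moreover have "z * (a + b) - (a + b) * z = (z * a - a * z) + (z * b - b * z)" for z
      by (simp add: algebra_simps)
    ultimately show "v + w \<in> {v. P v}"
      unfolding P_def mem_Collect_eq using a(2) b(2)
      by (intro exI[of _ "a + b"]) (simp add: ideal_add[OF I])
  qed
  moreover have "P ((pmap ^^ Suc i) x)" for i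
  proof -
    let ?n = "CHAR('k) ^ Suc i - 2"
    have "CHAR('k) ^ 1 \<le> CHAR('k) ^ Suc i"
      by (rule power_increasing) (use char_pos in auto)
    then have "2 \<le> CHAR('k) ^ Suc i"
      using char_ge_2 unfolding power_one_right by (rule order_trans[rotated])
    then have n: "CHAR('k) ^ Suc i = ?n + 2"
      by (simp only: le_add_diff_inverse2)
    have "\<iota> x ^ (CHAR('k) ^ Suc i) = \<iota> x ^ (?n + 2)"
      by (rule arg_cong[OF n, where f = "\<lambda>m. \<iota> x ^ m"])
    also have "\<dots> = \<iota> x ^ ?n * \<iota> x * \<iota> x"
      by (simp only: power_add power2_eq_square mult.assoc)
    finally have "\<iota> x ^ (CHAR('k) ^ Suc i) = \<iota> x ^ ?n * \<iota> x * \<iota> x" .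
    moreover have "z * \<iota> x ^ n - \<iota> x ^ n * z \<in> relation_ideal"
      if z: "z * \<iota> x - \<iota> x * z \<in> relation_ideal" for z n
    proof (induction n)
      case (Suc n)
      have "z * \<iota> x ^ Suc n - \<iota> x ^ Suc n * z
          = (z * \<iota> x - \<iota> x * z) * \<iota> x ^ n + \<iota> x * (z * \<iota> x ^ n - \<iota> x ^ n * z)"
        by (simp add: algebra_simps)
      then show ?case
        using z Suc by (simp only: ideal_add[OF I] ideal_mult_left[OF I] ideal_mult_right[OF I])
    qed (simp add: ideal_zero[OF I])
    ultimately show ?thesis
      unfolding P_def using gen_pmap_funpow[of "Suc i" x] by (intro exI[of _ "\<iota> x ^ ?n"]) simp
  qed
  moreover have "x \<in> span (range (\<lambda>i. (pmap ^^ Suc i) x))"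
    using assms generated_pmap_subset unfolding semisimple_def by blast
  ultimately have "P x"
    using span_induct[of x "range (\<lambda>i. (pmap ^^ Suc i) x)" P] by blast
  then show thesis
    using that unfolding P_def by blast
qed

text \<open>
  The data carried along the construction of the increasing idempotents; equations are meant in
  \<open>u(L)\<close>.  The idempotent \<open>e\<close> lies in \<open>u(L) H\<close> and commutes with \<open>T\<close>.
\<close>
definition torus_stage :: "'a set \<Rightarrow> 'a set \<Rightarrow> ('a fword \<Rightarrow>\<^sub>0 'k) \<Rightarrow> bool" where
  "torus_stage T H e \<longleftrightarrow> restricted_subalgebra H \<and> H \<subseteq> T \<and> finite_dimensional H \<and>
     e \<in> left_ideal_span H \<and> e * e - e \<in> relation_ideal \<and>
     (\<forall>t\<in>T. e * \<iota> t - \<iota> t * e \<in> relation_ideal)"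

text \<open>
  Choose \<open>x \<in> T\<close> outside \<open>H\<close> and join \<open>e\<close> with the idempotent \<open>f\<close> of \<open>x\<close>.  If nothing changed,
  then \<open>x = e x = x e\<close> would lie in \<open>u(L) H\<close>.
\<close>
lemma torus_stage_extend:
  assumes T: "torus T" "\<not> finite_dimensional T" and stage: "torus_stage T H e"
  obtains H' e' where "torus_stage T H' e'" "e * e' - e \<in> relation_ideal"
    "e' * e - e \<in> relation_ideal" "e' - e \<notin> relation_ideal"
proof -
  note I = two_sided_relation_ideal
  note closed = ideal_add[OF I] ideal_diff[OF I] ideal_mult_left[OF I] ideal_mult_right[OF I]
  have Tr: "restricted_subalgebra T" and comm: "\<And>s t. s \<in> T \<Longrightarrow> t \<in> T \<Longrightarrow> bracket s t = 0"
    and ss: "\<And>t. t \<in> T \<Longrightarrow> semisimple t"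
    using T(1) by (auto simp: torus_def)
  have H: "restricted_subalgebra H" "H \<subseteq> T" "finite_dimensional H" "e \<in> left_ideal_span H"
    and ee: "e * e - e \<in> relation_ideal" and et: "\<And>t. t \<in> T \<Longrightarrow> e * \<iota> t - \<iota> t * e \<in> relation_ideal"
    using stage by (auto simp: torus_stage_def)
  obtain x where x: "x \<in> T" "x \<notin> H"
    using H(2,3) T(2) by (metis subsetI subset_antisym)
  obtain a where a: "\<iota> x - a * \<iota> x * \<iota> x \<in> relation_ideal"
    "\<And>z. z * \<iota> x - \<iota> x * z \<in> relation_ideal \<Longrightarrow> z * a - a * z \<in> relation_ideal"
    using semisimple_divides_square[OF ss[OF x(1)]] by blast
  have gens: "\<iota> s * \<iota> t - \<iota> t * \<iota> s \<in> relation_ideal" if "s \<in> T" "t \<in> T" for s t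
  proof -
    have "\<iota> 0 \<in> relation_ideal"
      using relation_ideal_gens(2)[of 0 0] by (simp add: free_const_simps)
    then show ?thesis
      using ideal_add[OF I relation_ideal_gens(3)[of s t], of "\<iota> 0"] comm[OF that] by (simp add: commutator_def)
  qed
  define f where "f = a * \<iota> x"
  have fx: "f * \<iota> x - \<iota> x \<in> relation_ideal"
    using ideal_cong_sym[OF I a(1)] by (simp add: f_def)
  have commutes_f: "z * f - f * z \<in> relation_ideal" if z: "z * \<iota> x - \<iota> x * z \<in> relation_ideal" for z
  proof -
    have "z * f - f * z = (z * a - a * z) * \<iota> x + a * (z * \<iota> x - \<iota> x * z)"
      by (simp add: f_def algebra_simps)
    then show ?thesis
      using z a(2)[OF z] by (simp only: closed)
  qed
  have ft: "f * \<iota> t - \<iota> t * f \<in> relation_ideal" if "t \<in> T" for t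
    using commutes_f[OF gens[OF that x(1)]] by (rule ideal_cong_sym[OF I])
  have ef: "e * f - f * e \<in> relation_ideal"
    by (rule commutes_f[OF et[OF x(1)]])
  have ff: "f * f - f \<in> relation_ideal"
  proof -
    have "a * \<iota> x - \<iota> x * a \<in> relation_ideal"
      using a(2)[of "\<iota> x"] ideal_cong_sym[OF I] ideal_zero[OF I] by simp
    moreover have "f * f - f = a * (f * \<iota> x - \<iota> x) - a * (a * \<iota> x - \<iota> x * a) * \<iota> x"
      by (simp add: f_def algebra_simps)
    ultimately show ?thesis
      using fx by (simp only: closed)
  qed
  \<comment> \<open>the join of the commuting idempotents \<open>e\<close> and \<open>f\<close>\<close>
  define e' where "e' = e + f - e * f"
  have e'e: "e' * e - e \<in> relation_ideal"
  proof -
    have "e' * e - e = (e * e - e) - (e * f - f * e) - (e * e - e) * f + e * (e * f - f * e)"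
      by (simp add: e'_def algebra_simps)
    then show ?thesis
      using ee ef by (simp only: closed)
  qed
  have ee': "e * e' - e \<in> relation_ideal"
  proof -
    have "e * e' - e = (e * e - e) - (e * e - e) * f"
      by (simp add: e'_def algebra_simps)
    then show ?thesis
      using ee by (simp only: closed)
  qed
  have e'e': "e' * e' - e' \<in> relation_ideal"
  proof -
    have "e' * e' - e' = (e' * e - e) + ((f * f - f) - e * (f * f - f)) - (e' * e - e) * f"
      by (simp add: e'_def algebra_simps)
    then show ?thesis
      using e'e ff by (simp only: closed)
  qed
  have e't: "e' * \<iota> t - \<iota> t * e' \<in> relation_ideal" if "t \<in> T" for t
  proof -
    have "e' * \<iota> t - \<iota> t * e' = (e * \<iota> t - \<iota> t * e) + (f * \<iota> t - \<iota> t * f)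
        - e * (f * \<iota> t - \<iota> t * f) - (e * \<iota> t - \<iota> t * e) * f"
      by (simp add: e'_def algebra_simps)
    then show ?thesis
      using et[OF that] ft[OF that] by (simp only: closed)
  qed
  have new: "e' - e \<notin> relation_ideal"
  proof
    assume eq: "e' - e \<in> relation_ideal"
    have "\<iota> x - \<iota> x * e = (e' - e) * \<iota> x + (e * \<iota> x - \<iota> x * e)
        - ((f * \<iota> x - \<iota> x) - e * (f * \<iota> x - \<iota> x))"
      by (simp add: e'_def algebra_simps)
    then have "\<iota> x - \<iota> x * e \<in> relation_ideal"
      using eq et[OF x(1)] fx by (simp only: closed)
    then show False
      using gen_not_in_left_ideal[OF H(1) x(2) left_ideal_span_mult[OF H(4)]] by blast
  qed
  define H' where "H' = span (H \<union> \<langle>{x}\<rangle>\<^sub>p)"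
  have gT: "\<langle>{x}\<rangle>\<^sub>p \<subseteq> T"
    using generated_minimal[OF _ Tr] x(1) by blast
  have "restricted_subalgebra H'"
    unfolding H'_def
  proof (rule restricted_subalgebra_span)
    show "bracket b c = 0" if "b \<in> H \<union> \<langle>{x}\<rangle>\<^sub>p" "c \<in> H \<union> \<langle>{x}\<rangle>\<^sub>p" for b c
      using comm that H(2) gT by blast
    show "pmap b \<in> span (H \<union> \<langle>{x}\<rangle>\<^sub>p)" if "b \<in> H \<union> \<langle>{x}\<rangle>\<^sub>p" for b
      using that H(1) restricted_subalgebra_generated[of "{x}"]
      by (intro span_base) (auto simp: restricted_subalgebra_def)
  qed
  moreover have "H' \<subseteq> T"
    unfolding H'_def using H(2) gT Tr by (intro span_minimal) (auto simp: restricted_subalgebra_def)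
  moreover have "finite_dimensional H'"
  proof -
    obtain b c where "finite b" "span b = H" "finite c" "span c = \<langle>{x}\<rangle>\<^sub>p"
      using H(3) all_p_algebraic[of x] by (auto simp: finite_dimensional_def p_algebraic_def)
    then have "H \<union> \<langle>{x}\<rangle>\<^sub>p \<subseteq> span (b \<union> c)"
      using span_mono[of b "b \<union> c"] span_mono[of c "b \<union> c"] by auto
    then have "H' \<subseteq> span (b \<union> c)"
      unfolding H'_def by (intro span_minimal) auto
    then show ?thesis
      using \<open>finite b\<close> \<open>finite c\<close>
      by (intro finite_dimensional_subspace[of _ "b \<union> c"]) (simp_all add: H'_def)
  qed
  moreover have "e' \<in> left_ideal_span H'"
  proof -
    have sub: "H \<subseteq> H'" "x \<in> H'"
      using generated_superset[of "{x}"] by (auto simp: H'_def intro: span_base)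
    have "e' = e + ((1 - e) * a) * \<iota> x"
      by (simp add: e'_def f_def algebra_simps)
    then show ?thesis
      using left_ideal_span_add[OF left_ideal_span_mono[OF H(4) sub(1)] left_ideal_span_gen[OF sub(2)]]
      by simp
  qed
  ultimately have "torus_stage T H' e'"
    using e'e' e't by (simp add: torus_stage_def)
  then show thesis
    using that ee' e'e new by blast
qed

text \<open>
  Dependent choice iterates the extension, starting with \<open>H = {0}\<close> and \<open>e = 0\<close>.
\<close>
theorem torus_finite_dimensional:
  assumes T: "torus T"
  shows "finite_dimensional T"
proof (rule ccontr)
  assume inf: "\<not> finite_dimensional T"
  define step where "step e e' \<longleftrightarrow> e * e' - e \<in> relation_ideal \<and> e' * e - e \<in> relation_ideal
      \<and> e' - e \<notin> relation_ideal" for e e' :: "'a fword \<Rightarrow>\<^sub>0 'k"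
  have "\<exists>s. \<forall>n::nat. torus_stage T (fst (s n)) (snd (s n)) \<and> step (snd (s n)) (snd (s (Suc n)))"
  proof (rule dependent_nat_choice)
    have "restricted_subalgebra {0}"
      by (simp add: restricted_subalgebra_def subspace_single_0 pmap_zero)
    moreover have "finite_dimensional {0}"
      unfolding finite_dimensional_def by (intro exI[of _ "{}"]) simp
    moreover have "0 \<in> T"
      using T by (simp add: torus_def restricted_subalgebra_def subspace_0)
    ultimately have "torus_stage T {0} 0"
      by (simp add: torus_stage_def left_ideal_span.zero ideal_zero[OF two_sided_relation_ideal])
    then show "\<exists>s. torus_stage T (fst s) (snd s)"
      by (intro exI[of _ "({0}, 0)"]) simp
    show "\<exists>s'. torus_stage T (fst s') (snd s') \<and> step (snd s) (snd s')"
      if "torus_stage T (fst s) (snd s)" for s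
      using torus_stage_extend[OF T inf that] unfolding step_def by (metis fst_conv snd_conv)
  qed
  then obtain s where s: "\<And>n::nat. torus_stage T (fst (s n)) (snd (s n))"
    and increasing: "\<And>n. step (snd (s n)) (snd (s (Suc n)))"
    by blast
  have "\<exists>n. snd (s (Suc n)) - snd (s n) \<in> relation_ideal"
    using s increasing by (intro increasing_idempotents_stationary[OF two_sided_relation_ideal artinian'])
      (auto simp: torus_stage_def step_def)
  then show False
    using increasing by (auto simp: step_def)
qed

end

theorem corollary2p2:
  fixes scale :: "'k::field \<Rightarrow> 'a::ab_group_add \<Rightarrow> 'a"
    and bracket :: "'a \<Rightarrow> 'a \<Rightarrow> 'a"
    and pmap :: "'a \<Rightarrow> 'a"
  assumes "restricted_lie_algebra scale bracket pmap"
    and "semiperfect (restricted_lie_algebra.restricted_enveloping_algebra scale bracket pmap)"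
  shows "(\<forall>x. restricted_lie_algebra.p_algebraic scale bracket pmap x) \<and>
    \<not> (\<exists>T. restricted_lie_algebra.torus scale bracket pmap T \<and>
           \<not> restricted_lie_algebra.finite_dimensional scale T)"
proof -
  interpret restricted_lie_algebra scale bracket pmap
    by (rule assms(1))
  interpret artinian_restricted_lie_algebra scale bracket pmap
    by unfold_locales (use assms(2) in \<open>simp add: semiperfect_def\<close>)
  show ?thesis
    using all_p_algebraic torus_finite_dimensional by blast
qed

end
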